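(* There is a subset $\mathscr{S}\subseteq[0,1/2]$ of full Lebesgue measure such that for every $\alpha\in\mathscr{S}$, \[ \frac{1}{\sharp \mathscr{F}(Q)} \sum_{x\in\mathscr{F}_{\alpha}(Q)} s(x) = \frac{1}{12}\log Q + o_\alpha(\log Q)\qquad (Q\to\infty), \] where $Q$ ranges over positive integers.
   Context: For $x\in\mathbb{R}$ let $((x)) = x-\lfloor x\rfloor - \tfrac12$ if $x\notin\mathbb{Z}$ and $((x))=0$ if $x\in\mathbb{Z}$. For integers $a,b$ with $b\neq 0$ the Dedekind sum is $s(a,b)=\sum_{n=1}^{b} ((n/b))((na/b))$; $s(a/b):=s(a,b)$ is a well-defined function on the nonnegative rationals. For a positive integer $Q$, $\mathscr{F}(Q)=\{v/w\in\mathbb{Q}\cap[0,1] : 1\le w\le Q\}$ (each rational counted once), and for $\alpha\in(0,1)$, $\mathscr{F}_\alpha(Q)=\mathscr{F}(Q)\cap[0,\alpha)$. *)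

theory Defs
  imports "HOL-Analysis.Analysis" "HOL-Library.Landau_Symbols"
begin

definition sawtooth :: "real \<Rightarrow> real" where
  "sawtooth x = (if x \<in> \<int> then 0 else x - of_int \<lfloor>x\<rfloor> - 1 / 2)"

text \<open>Only \<open>b > 0\<close> is meaningful: for \<open>b \<le> 0\<close> the range of summation is empty.\<close>

definition dedekind_sum :: "int \<Rightarrow> int \<Rightarrow> real" where
  "dedekind_sum a b =
     (\<Sum>n\<in>{1..b}. sawtooth (of_int n / of_int b) * sawtooth (of_int n * of_int a / of_int b))"

text \<open>
  The value at a rational is read off from its reduced fraction with positive denominator;
  \<open>dedekind_rat_divide\<close> below shows that any other fraction with positive denominator
  gives the same value.
\<close>

definition dedekind_rat :: "rat \<Rightarrow> real" where
  "dedekind_rat x = dedekind_sum (fst (quotient_of x)) (snd (quotient_of x))"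

definition farey :: "nat \<Rightarrow> rat set" where
  "farey Q = {x. 0 \<le> x \<and> x \<le> 1 \<and>
     (\<exists>v w :: int. 1 \<le> w \<and> w \<le> int Q \<and> x = of_int v / of_int w)}"

definition farey_below :: "real \<Rightarrow> nat \<Rightarrow> rat set" where
  "farey_below \<alpha> Q = {x \<in> farey Q. 0 \<le> real_of_rat x \<and> real_of_rat x < \<alpha>}"

lemma finite_farey: "finite (farey Q)"
proof (rule finite_subset)
  show "farey Q \<subseteq> (\<lambda>(v, w). of_int v / of_int w) ` ({0..int Q} \<times> {1..int Q})"
  proof
    fix x assume "x \<in> farey Q"
    then obtain v w :: int where x: "0 \<le> x" "x \<le> 1" "1 \<le> w" "w \<le> int Q" "x = of_int v / of_int w"
      by (auto simp: farey_def)
    from x have "0 \<le> v" "v \<le> w"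
      by (simp_all add: zero_le_divide_iff divide_le_eq_1)
    with x show "x \<in> (\<lambda>(v, w). of_int v / of_int w) ` ({0..int Q} \<times> {1..int Q})"
      by (intro image_eqI[of _ _ "(v, w)"]) auto
  qed
qed auto

lemma sawtooth_add_int: "sawtooth (x + of_int m) = sawtooth x"
proof -
  have "x + of_int m \<in> \<int> \<longleftrightarrow> x \<in> \<int>"
    by (metis Ints_add Ints_diff Ints_of_int add_diff_cancel_right')
  then show ?thesis by (simp add: sawtooth_def)
qed

lemma sawtooth_unit:
  assumes "0 < x" "x < 1" shows "sawtooth x = x - 1 / 2"
proof -
  have f: "\<lfloor>x\<rfloor> = 0" using assms by linarith
  have "x \<notin> \<int>" using assms f by (auto elim!: Ints_cases)
  with f show ?thesis by (simp add: sawtooth_def)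
qed

lemma sum_int_block:
  fixes f :: "int \<Rightarrow> real" and b :: int
  assumes "b > 0"
  shows "(\<Sum>n\<in>{1..int k * b}. f n) = (\<Sum>r\<in>{1..b}. \<Sum>j<k. f (r + int j * b))"
proof (induction k)
  case (Suc k)
  have "{1..int (Suc k) * b} = {1..int k * b} \<union> {int k * b + 1..int k * b + b}"
    using assms by (auto simp: algebra_simps) (smt (verit) mult_nonneg_nonneg of_nat_0_le_iff)
  then have "(\<Sum>n\<in>{1..int (Suc k) * b}. f n)
    = (\<Sum>n\<in>{1..int k * b}. f n) + (\<Sum>n\<in>{int k * b + 1..int k * b + b}. f n)"
    by (simp add: sum.union_disjoint)
  also have "(\<Sum>n\<in>{int k * b + 1..int k * b + b}. f n) = (\<Sum>r\<in>{1..b}. f (r + int k * b))"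
    by (rule sum.reindex_bij_witness[of _ "\<lambda>r. r + int k * b" "\<lambda>n. n - int k * b"]) auto
  finally show ?case using Suc by (simp add: sum.distrib)
qed simp

lemma dedekind_sum_scale:
  assumes "k > 0" "b > 0"
  shows "dedekind_sum (int k * a) (int k * b) = dedekind_sum a b"
proof -
  let ?g = "\<lambda>n :: int. sawtooth (of_int n / of_int (int k * b)) *
              sawtooth (of_int n * of_int (int k * a) / of_int (int k * b))"
  have "dedekind_sum (int k * a) (int k * b) = (\<Sum>r\<in>{1..b}. \<Sum>j<k. ?g (r + int j * b))"
    unfolding dedekind_sum_def by (rule sum_int_block[OF assms(2)])
  also have "\<dots> = dedekind_sum a b"
    unfolding dedekind_sum_def
  proof (rule sum.cong[OF refl])
    fix r assume r: "r \<in> {1..b}"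
    have second: "sawtooth (of_int (r + int j * b) * of_int (int k * a) / of_int (int k * b))
        = sawtooth (of_int r * of_int a / of_int b)" for j
    proof -
      have "of_int (r + int j * b) * of_int (int k * a) / of_int (int k * b)
          = of_int r * of_int a / (of_int b :: real) + of_int (int j * a)"
        using assms by (simp add: field_simps)
      then show ?thesis by (simp only: sawtooth_add_int)
    qed
    show "(\<Sum>j<k. ?g (r + int j * b))
        = sawtooth (of_int r / of_int b) * sawtooth (of_int r * of_int a / of_int b)"
    proof (cases "r = b")
      case True
      then have "sawtooth (of_int r * of_int a / of_int b) = 0"
        using assms by (simp add: sawtooth_def)
      then show ?thesis by (simp only: second) simp
    next
      case False
      with r have r': "0 < r" "r < b" by auto
      have first: "sawtooth (of_int (r + int j * b) / of_int (int k * b))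
          = of_int r / (of_int b * of_nat k) + of_nat j / of_nat k - 1 / 2" if "j < k" for j
      proof -
        have "r + int j * b < int k * b"
        proof -
          have "r + int j * b < (int j + 1) * b" using r' by (simp add: algebra_simps)
          also have "\<dots> \<le> int k * b" using that assms by (intro mult_right_mono) auto
          finally show ?thesis .
        qed
        moreover have "0 < r + int j * b" using r' assms by (simp add: add_pos_nonneg)
        moreover have "0 < int k * b" using assms by simp
        ultimately have "sawtooth (of_int (r + int j * b) / of_int (int k * b))
            = of_int (r + int j * b) / of_int (int k * b) - 1 / 2"
          by (intro sawtooth_unit) (simp_all only: divide_less_eq_1_pos of_int_0_less_iff
                of_int_less_iff zero_less_divide_iff simp_thms)
        moreover have "of_int (r + int j * b) / of_int (int k * b)
            = of_int r / (of_int b * of_nat k) + (of_nat j / of_nat k :: real)"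
          using assms by (simp add: field_simps)
        ultimately show ?thesis by linarith
      qed
      have gauss: "(\<Sum>j<k. real j) = real k * (real k - 1) / 2"
        by (induction k) (auto simp: field_simps)
      have "(\<Sum>j<k. sawtooth (of_int (r + int j * b) / of_int (int k * b)))
          = (\<Sum>j<k. of_int r / (of_int b * of_nat k) + of_nat j / of_nat k - 1 / 2)"
        by (rule sum.cong[OF refl]) (simp only: lessThan_iff first)
      also have "\<dots> = of_int r / of_int b - 1 / 2"
        using assms by (simp add: sum.distrib sum_subtractf gauss flip: sum_divide_distrib)
          (simp add: field_simps)
      also have "\<dots> = sawtooth (of_int r / of_int b)"
        using r' by (subst sawtooth_unit) auto
      finally show ?thesis by (simp only: second flip: sum_distrib_right)
    qed
  qed
  finally show ?thesis .
qed

lemma dedekind_rat_divide: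
  assumes "b > 0"
  shows "dedekind_rat (of_int a / of_int b) = dedekind_sum a b"
proof -
  define g where "g = gcd a b"
  have g: "g > 0" using assms by (simp add: g_def)
  have ab: "a = int (nat g) * (a div g)" "b = int (nat g) * (b div g)"
    using g by (simp_all add: g_def)
  have bg: "b div g > 0" using ab(2) assms g by (metis zero_less_mult_pos int_nat_eq less_imp_le)
  have "quotient_of (of_int a / of_int b) = (a div g, b div g)"
    using assms by (simp add: quotient_of_Fract Rat.normalize_def Let_def g_def
        flip: Fract_of_int_quotient)
  then have "dedekind_rat (of_int a / of_int b) = dedekind_sum (a div g) (b div g)"
    by (simp add: dedekind_rat_def)
  also have "\<dots> = dedekind_sum a b"
    using dedekind_sum_scale[of "nat g" "b div g" "a div g"] g bg ab by simp
  finally show ?thesis .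
qed

end

theory Submission
  imports Defs
begin

text \<open>
  By finite Fourier analysis \<open>s(a, b) = 1 / (4 b) * (\<Sum>k<b. cot (pi k / b) * cot (pi k a / b))\<close>. Splitting
  \<open>cot (pi t)\<close> into a conjugate Poisson kernel and a remainder \<open>c(t)\<close> concentrated on
  \<open>\<bar>t\<bar> \<lessapprox> 1 - r\<close>, the Poisson part contributes \<open>O(1 / (1 - r))\<close> to every single Dedekind sum, since each
  of its Fourier modes produces just a few values of the sawtooth function.

  In the rest, summed over all \<open>b \<le> Q\<close> and \<open>0 < a < \<alpha> b\<close>, fix \<open>k\<close> and cut at the singularities \<open>a / b = j / k\<close>.
  Those with \<open>j = 0\<close> are one-sided and give the main term \<open>(\<Sum>k. 1 / k\<^sup>2) / (4 pi\<^sup>2) * Q\<^sup>2 ln Q\<close>. Around \<open>j / k\<close>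
  in \<open>(0, \<alpha>)\<close> the sum over \<open>a\<close> is, up to \<open>O(1)\<close>, \<open>b\<close> times an odd function of \<open>j b\<close> mod \<open>k\<close>, which averages
  out over \<open>b\<close>; the loss is \<open>O((1 - r) Q\<^sup>2 ln Q)\<close>. The cell that contains \<open>\<alpha>\<close> costs a negative power of the
  distance from \<open>k \<alpha>\<close> to the integers, and these are summable for almost every \<open>\<alpha>\<close>. Let \<open>r \<rightarrow> 1\<close> at the end.

  Passing from all pairs \<open>(a, b)\<close> to reduced fractions needs no Moebius inversion: the error \<open>e\<close> is controlled
  through \<open>\<Sum>g\<le>Q. e (Q div g)\<close> by induction, because \<open>(\<Sum>g\<ge>2. 1 / g\<^sup>2) < 1\<close>.
\<close>

section \<open>Finite Fourier analysis of the sawtooth function\<close>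

text \<open>A single s(a, b) can be about as large as b / 12, so no pointwise bound suffices. With r
  fixed, any error that is O(b) for each b, with a constant depending on r and \<alpha>, adds up to
  O(Q^2) and disappears beside Q^2 ln Q. Only losses that carry the logarithm have to be small, and
  these come with the factor 1 - r. Hence the order of the limits, and an o(ln Q) without a rate. On
  the Farey side the sizes of the sets for Q div g, summed over g, count the pairs a \<le> b \<le>
  Q, about Q^2 / 2. One twelfth of this matches the coefficient 1 / 24 found for all pairs, so the
  density 3 / pi^2 of reduced fractions never enters. The power of the distance to the integers is
  -1/2 by choice: the nearest point beyond the cut alone suggests the inverse distance, whose
  integral over \<alpha> diverges.\<close>

lemma sum_cos_int_multiples:
  fixes b :: nat and n :: int
  assumes "b > 0"
  shows "(\<Sum>k<b. cos (2 * pi * of_int n * real k / real b)) = (if int b dvd n then real b else 0)"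
proof (cases "int b dvd n")
  case True
  then obtain m where m: "n = int b * m" by auto
  have "cos (2 * pi * of_int n * real k / real b) = 1" for k
  proof -
    have "2 * pi * of_int n * real k / real b = 2 * pi * of_int (m * int k)"
      using assms by (simp add: m)
    then show ?thesis by (metis cos_int_2pin mult.commute)
  qed
  then show ?thesis using True by simp
next
  case False
  define z where "z = cis (2 * pi * of_int n / real b)"
  have zk: "z ^ k = cis (2 * pi * of_int n * real k / real b)" for k
    unfolding z_def Complex.DeMoivre by (rule arg_cong[of _ _ cis]) simp
  have "z \<noteq> 1"
  proof
    assume "z = 1"
    then have "cos (2 * pi * of_int n / real b) = 1"
      by (metis cis.sel(1) one_complex.sel(1) z_def)
    then obtain m :: int where "2 * pi * of_int n / real b = of_int m * 2 * pi"
      by (auto simp: cos_one_2pi_int)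
    then have "real_of_int n = of_int (m * int b)"
      using assms by (simp add: field_simps)
    then have "n = m * int b" by (simp only: of_int_eq_iff)
    then show False using False by simp
  qed
  moreover have "z ^ b = 1"
  proof -
    have "z ^ b = cis (2 * pi * of_int n)" using assms by (simp add: zk)
    then show ?thesis by (simp add: cis_multiple_2pi)
  qed
  ultimately have "(\<Sum>k<b. z ^ k) = 0" by (simp add: geometric_sum)
  then have "Re (\<Sum>k<b. z ^ k) = 0" by simp
  then show ?thesis using False by (simp add: zk)
qed

lemma sum_sin_mult_sin:
  fixes b :: nat and n m :: int
  assumes "b > 0"
  shows "(\<Sum>k<b. sin (2 * pi * of_int n * real k / real b) * sin (2 * pi * of_int m * real k / real b))
    = real b / 2 * (of_bool (int b dvd n - m) - of_bool (int b dvd n + m))"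
proof -
  have "sin (2 * pi * of_int n * real k / real b) * sin (2 * pi * of_int m * real k / real b)
     = (cos (2 * pi * of_int (n - m) * real k / real b) - cos (2 * pi * of_int (n + m) * real k / real b)) / 2"
    for k
    by (simp add: sin_times_sin ring_distribs diff_divide_distrib add_divide_distrib)
  then have "(\<Sum>k<b. sin (2 * pi * of_int n * real k / real b) * sin (2 * pi * of_int m * real k / real b))
     = ((\<Sum>k<b. cos (2 * pi * of_int (n - m) * real k / real b))
        - (\<Sum>k<b. cos (2 * pi * of_int (n + m) * real k / real b))) / 2"
    by (simp only: sum_subtractf sum_divide_distrib[symmetric])
  then show ?thesis
    by (simp only: sum_cos_int_multiples[OF assms]) (auto simp: field_simps)
qed

lemma sum_sin_half_angle:
  fixes t :: real
  shows "2 * sin (t / 2) * (\<Sum>n<b. sin (real n * t)) = cos (t / 2) - cos ((real b - 1 / 2) * t)"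
proof (induction b)
  case 0 then show ?case by simp
next
  case (Suc b)
  have *: "2 * sin (t / 2) * sin (real b * t) = cos ((real b - 1/2) * t) - cos ((real b + 1/2) * t)"
    using sin_times_sin[of "real b * t" "t / 2"] by (simp add: field_simps)
  show ?case using Suc * by (simp add: algebra_simps)
qed

text \<open>Summation by parts of the preceding formula; the boundary term with the factor
  \<open>real b\<close> is what survives for t = 2 pi l / b and becomes the cotangent.\<close>

lemma sum_mult_sin_half_angle:
  fixes t :: real
  shows "4 * (sin (t / 2))\<^sup>2 * (\<Sum>n<b. real n * sin (real n * t))
    = sin (real b * t) - 2 * real b * sin (t / 2) * cos ((real b - 1 / 2) * t)"
proof (induction b)
  case 0 then show ?case by simp
next
  case (Suc b)
  have 1: "2 * sin (t / 2) * sin (real b * t) = cos ((real b - 1/2) * t) - cos ((real b + 1/2) * t)"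
    using sin_times_sin[of "real b * t" "t / 2"] by (simp add: field_simps)
  have 2: "sin (real (Suc b) * t) - sin (real b * t) = 2 * sin (t / 2) * cos ((real b + 1/2) * t)"
    using sin_diff_sin[of "real (Suc b) * t" "real b * t"] by (simp add: field_simps)
  have "4 * (sin (t / 2))\<^sup>2 * (real b * sin (real b * t))
      = 2 * real b * sin (t / 2) * (2 * sin (t / 2) * sin (real b * t))"
    by (simp add: power2_eq_square)
  also have "\<dots> = 2 * real b * sin (t / 2) * cos ((real b - 1/2) * t)
      - 2 * real (Suc b) * sin (t / 2) * cos ((real b + 1/2) * t)
      + (sin (real (Suc b) * t) - sin (real b * t))"
    unfolding 1 2 by (simp add: algebra_simps)
  finally show ?case using Suc by (simp add: ring_distribs add.commute)
qed

lemma sin_even_pi_multiple: "sin (2 * pi * of_int n * real m) = 0"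
proof -
  have "sin (2 * pi * of_int n * real m) = sin (pi * of_int (2 * n * int m))" by (simp add: mult_ac)
  then show ?thesis by (metis sin_npi_int mult.commute)
qed

text \<open>Finite sine transform of the sawtooth function. Division by zero makes
  \<open>cot\<close> vanish at multiples of pi, in agreement with the right-hand side when b divides
  l, so later sums may run over all k < b including k = 0.\<close>

lemma cot_eq_sum_sawtooth:
  fixes b :: nat and l :: int
  assumes "b > 0"
  shows "cot (pi * of_int l / real b)
    = - 2 * (\<Sum>n<b. sawtooth (real n / real b) * sin (2 * pi * of_int l * real n / real b))"
proof (cases "int b dvd l")
  case True
  then obtain m where m: "l = int b * m" by auto
  have "sin (2 * pi * of_int l * real n / real b) = 0" for n
    using sin_even_pi_multiple[of m n] assms by (simp add: m mult_ac)
  moreover have "cot (pi * of_int l / real b) = 0"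
    using sin_npi_int[of m] assms by (simp add: m cot_def mult_ac)
  ultimately show ?thesis by simp
next
  case False
  define t where "t = 2 * pi * of_int l / real b"
  have bt: "real b * t = 2 * pi * of_int l" using assms by (simp add: t_def)
  have s: "sin (t / 2) \<noteq> 0"
  proof
    assume "sin (t / 2) = 0"
    then obtain m :: int where "t / 2 = of_int m * pi" by (auto simp: sin_zero_iff_int2)
    then have "real_of_int l = of_int (m * int b)" using assms by (simp add: t_def field_simps)
    then have "l = m * int b" by (simp only: of_int_eq_iff)
    then show False using False by simp
  qed
  have c: "cos ((real b - 1/2) * t) = cos (t / 2)"
  proof -
    have "(real b - 1/2) * t = 2 * pi * of_int l - t / 2" using bt by (simp add: algebra_simps)
    then show ?thesis by (simp add: cos_diff cos_int_2pin sin_int_2pin)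
  qed
  have sb: "sin (real b * t) = 0" unfolding bt by (simp add: sin_int_2pin)
  have S0: "(\<Sum>n<b. sin (real n * t)) = 0"
    using sum_sin_half_angle[of t b] s c by simp
  have S1: "(\<Sum>n<b. real n * sin (real n * t)) = - (real b / 2) * cot (t / 2)"
  proof -
    have "2 * sin (t / 2) * (2 * sin (t / 2) * (\<Sum>n<b. real n * sin (real n * t)))
        = 4 * (sin (t / 2))\<^sup>2 * (\<Sum>n<b. real n * sin (real n * t))"
      by (simp add: power2_eq_square)
    also have "\<dots> = 2 * sin (t / 2) * (- (real b * cos (t / 2)))"
      unfolding sum_mult_sin_half_angle c sb by simp
    finally have "2 * sin (t / 2) * (2 * sin (t / 2) * (\<Sum>n<b. real n * sin (real n * t)))
        = 2 * sin (t / 2) * (- (real b * cos (t / 2)))" .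
    then have "2 * sin (t / 2) * (\<Sum>n<b. real n * sin (real n * t)) = - (real b * cos (t / 2))"
      using s by (subst (asm) mult_left_cancel) auto
    then show ?thesis using s by (simp add: cot_def field_simps)
  qed
  have "(\<Sum>n<b. sawtooth (real n / real b) * sin (2 * pi * of_int l * real n / real b))
     = (\<Sum>n<b. real n * sin (real n * t) / real b - sin (real n * t) / 2)"
  proof (rule sum.cong[OF refl])
    fix n assume n: "n \<in> {..<b}"
    have e: "2 * pi * of_int l * real n / real b = real n * t" by (simp add: t_def)
    show "sawtooth (real n / real b) * sin (2 * pi * of_int l * real n / real b)
      = real n * sin (real n * t) / real b - sin (real n * t) / 2"
    proof (cases "n = 0")
      case False
      then have "sawtooth (real n / real b) = real n / real b - 1/2"
        using n by (intro sawtooth_unit) auto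
      then show ?thesis unfolding e by (simp add: left_diff_distrib)
    qed simp
  qed
  also have "\<dots> = - cot (t / 2) / 2"
    using assms by (simp add: sum_subtractf S0 S1 flip: sum_divide_distrib)
  finally show ?thesis by (simp add: t_def)
qed


text \<open>Expand the cotangent by \<open>cot_eq_sum_sawtooth\<close>; orthogonality of the sines
  keeps only those n for which n a is congruent to m or - m.\<close>

lemma sum_cot_mult_sin:
  fixes b :: nat and a m :: int
  assumes "b > 0"
  shows "(\<Sum>k<b. cot (pi * of_int a * real k / real b) * sin (2 * pi * of_int m * real k / real b))
    = real b * (\<Sum>n<b. sawtooth (real n / real b) *
        (of_bool (int b dvd int n * a + m) - of_bool (int b dvd int n * a - m)))"
proof -
  have c: "cot (pi * of_int a * real k / real b)
     = - 2 * (\<Sum>n<b. sawtooth (real n / real b) * sin (2 * pi * of_int (int n * a) * real k / real b))" for k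
    using cot_eq_sum_sawtooth[OF assms, of "a * int k"] by (simp add: mult_ac)
  have "(\<Sum>k<b. cot (pi * of_int a * real k / real b) * sin (2 * pi * of_int m * real k / real b))
     = (\<Sum>k<b. \<Sum>n<b. - 2 * (sawtooth (real n / real b) * (sin (2 * pi * of_int (int n * a) * real k / real b)
         * sin (2 * pi * of_int m * real k / real b))))"
    unfolding c sum_distrib_left sum_distrib_right by (simp add: mult_ac)
  also have "\<dots> = (\<Sum>n<b. - 2 * (sawtooth (real n / real b) * (\<Sum>k<b. sin (2 * pi * of_int (int n * a) * real k / real b)
         * sin (2 * pi * of_int m * real k / real b))))"
    by (subst sum.swap) (simp only: sum_distrib_left)
  also have "\<dots> = (\<Sum>n<b. real b * (sawtooth (real n / real b) *
        (of_bool (int b dvd int n * a + m) - of_bool (int b dvd int n * a - m))))"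
    by (simp only: sum_sin_mult_sin[OF assms]) (simp add: algebra_simps)
  finally show ?thesis by (simp only: sum_distrib_left)
qed

lemma sawtooth_minus: "sawtooth (- x) = - sawtooth x"
proof (cases "x \<in> \<int>")
  case False
  then have "\<lfloor>- x\<rfloor> = - \<lfloor>x\<rfloor> - 1"
    by (auto simp: floor_minus ceiling_altdef) (metis Ints_of_int)
  with False show ?thesis by (simp add: sawtooth_def)
qed (simp add: sawtooth_def)

lemma sum_sawtooth_dvd:
  fixes b :: nat and l :: int
  assumes "b > 0"
  shows "(\<Sum>n<b. sawtooth (real n / real b) * of_bool (int b dvd l - int n)) = sawtooth (of_int l / real b)"
proof -
  define n where "n = nat (l mod int b)"
  have n: "n < b" "int n = l mod int b"
    using assms by (auto simp: n_def nat_less_iff)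
  have iff: "int b dvd l - int i \<longleftrightarrow> i = n" if "i < b" for i
  proof -
    have "int b dvd l - int i \<longleftrightarrow> l mod int b = int i mod int b"
      by (simp add: mod_eq_dvd_iff)
    also have "\<dots> \<longleftrightarrow> i = n" using that n(2) by (auto simp: zmod_int)
    finally show ?thesis .
  qed
  have "(\<Sum>i<b. sawtooth (real i / real b) * of_bool (int b dvd l - int i))
     = (\<Sum>i<b. if i = n then sawtooth (real i / real b) else 0)"
    by (rule sum.cong[OF refl]) (auto simp: iff)
  also have "\<dots> = sawtooth (real n / real b)" using n by simp
  also have "real n / real b = of_int l / real b + of_int (- (l div int b))"
  proof -
    have "l = int b * (l div int b) + int n" using n(2) by simp
    then have "real_of_int l = real b * of_int (l div int b) + real n"
      by (metis of_int_add of_int_mult of_int_of_nat_eq)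
    then show ?thesis using assms by (simp add: field_simps)
  qed
  finally show ?thesis by (simp only: sawtooth_add_int)
qed

lemma dedekind_sum_eq_sum_lessThan:
  fixes b :: nat and a :: int
  assumes "b > 0"
  shows "dedekind_sum a (int b) = (\<Sum>n<b. sawtooth (real n / real b) * sawtooth (real n * of_int a / real b))"
proof -
  let ?f = "\<lambda>n::nat. sawtooth (real n / real b) * sawtooth (real n * of_int a / real b)"
  have "dedekind_sum a (int b) = (\<Sum>n\<in>{1..b}. ?f n)"
    unfolding dedekind_sum_def
    by (rule sum.reindex_bij_witness[of _ int nat]) auto
  also have "\<dots> = (\<Sum>n\<in>{0<..<b}. ?f n)"
    using assms by (intro sum.mono_neutral_right) (auto simp: sawtooth_def)
  also have "\<dots> = (\<Sum>n<b. ?f n)"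
    by (intro sum.mono_neutral_left) (auto simp: sawtooth_def)
  finally show ?thesis .
qed

text \<open>Parseval with only the factor cot(pi k / b) expanded: the two congruences yield the
  sawtooth at n a / b and at - n a / b, and oddness turns their difference into a factor 2.\<close>

lemma dedekind_sum_eq_sum_cot:
  fixes b :: nat and a :: int
  assumes "b > 0"
  shows "dedekind_sum a (int b)
    = 1 / (4 * real b) * (\<Sum>k<b. cot (pi * real k / real b) * cot (pi * of_int a * real k / real b))"
proof -
  let ?s = "\<lambda>n::nat. sawtooth (real n / real b)"
  have c: "cot (pi * real k / real b) = - 2 * (\<Sum>m<b. ?s m * sin (2 * pi * of_int (int m) * real k / real b))" for k
    using cot_eq_sum_sawtooth[OF assms, of "int k"] by (simp add: mult_ac)
  have "(\<Sum>k<b. cot (pi * real k / real b) * cot (pi * of_int a * real k / real b))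
     = (\<Sum>k<b. \<Sum>m<b. - 2 * ?s m * (cot (pi * of_int a * real k / real b) * sin (2 * pi * of_int (int m) * real k / real b)))"
    unfolding c sum_distrib_left sum_distrib_right by (simp add: mult_ac)
  also have "\<dots> = (\<Sum>m<b. - 2 * ?s m * (\<Sum>k<b. cot (pi * of_int a * real k / real b) * sin (2 * pi * of_int (int m) * real k / real b)))"
    by (subst sum.swap) (simp only: sum_distrib_left)
  also have "\<dots> = (\<Sum>m<b. \<Sum>n<b. 2 * real b * ?s n * (?s m * of_bool (int b dvd int n * a - int m)
        - ?s m * of_bool (int b dvd - (int n * a) - int m)))"
  proof (rule sum.cong[OF refl])
    fix m
    have e: "int b dvd - (int n * a) - int m \<longleftrightarrow> int b dvd int n * a + int m" for n
      by (subst dvd_minus_iff[symmetric]) simp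
    show "- 2 * ?s m * (\<Sum>k<b. cot (pi * of_int a * real k / real b) * sin (2 * pi * of_int (int m) * real k / real b))
      = (\<Sum>n<b. 2 * real b * ?s n * (?s m * of_bool (int b dvd int n * a - int m)
        - ?s m * of_bool (int b dvd - (int n * a) - int m)))"
      unfolding sum_cot_mult_sin[OF assms] e sum_distrib_left
      by (rule sum.cong[OF refl]) (simp add: algebra_simps)
  qed
  also have "\<dots> = (\<Sum>n<b. 2 * real b * ?s n * ((\<Sum>m<b. ?s m * of_bool (int b dvd int n * a - int m))
        - (\<Sum>m<b. ?s m * of_bool (int b dvd - (int n * a) - int m))))"
    by (subst sum.swap) (simp only: sum_distrib_left sum_subtractf[symmetric])
  also have "\<dots> = (\<Sum>n<b. 4 * real b * (?s n * sawtooth (real n * of_int a / real b)))"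
    unfolding sum_sawtooth_dvd[OF assms]
    by (rule sum.cong[OF refl]) (simp add: sawtooth_minus)
  finally show ?thesis
    using assms by (simp add: dedekind_sum_eq_sum_lessThan flip: sum_distrib_left)
qed

text \<open>By the distribution relation the sum collapses to one sawtooth value, n0 / d - 1/2 for
  n0 > 0 and 0 for n0 = 0, so the bound does not grow with the number g of terms.\<close>

lemma abs_sum_sawtooth_mod_class_le:
  fixes g d n0 :: nat
  assumes "g > 0" "n0 < d"
  shows "\<bar>\<Sum>i<g. sawtooth (real (n0 + i * d) / real (g * d))\<bar> \<le> 1 / 2"
proof -
  have d: "d > 0" using assms by auto
  have gauss: "(\<Sum>i<g. real i) = real g * (real g - 1) / 2" for g
    by (induction g) (auto simp: field_simps)
  have lt: "n0 + i * d < g * d" if "i < g" for i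
  proof -
    have "n0 + i * d < (i + 1) * d" using assms by simp
    also have "\<dots> \<le> g * d" using that by (intro mult_right_mono) auto
    finally show ?thesis .
  qed
  show ?thesis
  proof (cases "n0 = 0")
    case False
    have "(\<Sum>i<g. sawtooth (real (n0 + i * d) / real (g * d)))
       = (\<Sum>i<g. real n0 / real (g * d) - 1/2 + real i / real g)"
    proof (rule sum.cong[OF refl])
      fix i assume i: "i \<in> {..<g}"
      have "sawtooth (real (n0 + i * d) / real (g * d)) = real (n0 + i * d) / real (g * d) - 1/2"
        using lt[of i] i False assms(1) d
        by (intro sawtooth_unit) (auto simp: divide_less_eq simp flip: of_nat_mult of_nat_add)
      also have "\<dots> = real n0 / real (g * d) - 1/2 + real i / real g"
        using assms d by (simp add: field_simps)
      finally show "sawtooth (real (n0 + i * d) / real (g * d)) = real n0 / real (g * d) - 1/2 + real i / real g" .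
    qed
    also have "\<dots> = real n0 / real d - 1/2"
      using assms d by (simp add: sum.distrib sum_subtractf gauss flip: sum_divide_distrib) (simp add: field_simps)
    finally have eq: "(\<Sum>i<g. sawtooth (real (n0 + i * d) / real (g * d))) = real n0 / real d - 1/2" .
    have "real n0 / real d \<le> 1" "real n0 / real d \<ge> 0" using assms by auto
    then show ?thesis unfolding eq by linarith
  next
    case True
    \<comment> \<open>The term i = 0 is the sawtooth at 0, that is 0 and not - 1/2; it is split off
      before the linear formula applies.\<close>
    obtain h where h: "g = Suc h" using assms by (cases g) auto
    have "(\<Sum>i<g. sawtooth (real (n0 + i * d) / real (g * d)))
       = (\<Sum>i<h. sawtooth (real (Suc i * d) / real (g * d)))"
      unfolding h sum.lessThan_Suc_shift by (simp add: True sawtooth_def)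
    also have "\<dots> = (\<Sum>i<h. real i / real g + 1 / real g - 1/2)"
    proof (rule sum.cong[OF refl])
      fix i assume i: "i \<in> {..<h}"
      have "sawtooth (real (Suc i * d) / real (g * d)) = real (Suc i * d) / real (g * d) - 1/2"
        using lt[of "Suc i"] i True assms(1) d h
        by (intro sawtooth_unit) (auto simp: divide_less_eq simp flip: of_nat_mult of_nat_add simp del: of_nat_Suc)
      also have "\<dots> = real i / real g + 1 / real g - 1/2"
        using assms d by (simp add: field_simps)
      finally show "sawtooth (real (Suc i * d) / real (g * d)) = real i / real g + 1 / real g - 1/2" .
    qed
    also have "\<dots> = (real h * (real h - 1) / 2 + real h) / real g - real h / 2"
      by (simp add: sum.distrib sum_subtractf gauss add_divide_distrib flip: sum_divide_distrib)
    also have "real h * (real h - 1) / 2 + real h = real h / 2 * real g"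
      by (simp add: h algebra_simps add_divide_distrib diff_divide_distrib)
    also have "real h / 2 * real g / real g - real h / 2 = 0" using assms by simp
    finally show ?thesis by simp
  qed
qed

text \<open>All pairs are summed later, so a and b may share a factor g. The solutions n, if any,
  then form one residue class mod b / g, and the preceding lemma bounds the g of them
  together.\<close>

lemma abs_sum_sawtooth_congruence_le:
  fixes b :: nat and a m :: int
  assumes "b > 0"
  shows "\<bar>\<Sum>n<b. sawtooth (real n / real b) * of_bool (int b dvd int n * a - m)\<bar> \<le> 1 / 2"
proof (cases "\<exists>n<b. int b dvd int n * a - m")
  case False
  then have "(\<Sum>n<b. sawtooth (real n / real b) * of_bool (int b dvd int n * a - m)) = 0"
    by (intro sum.neutral) auto
  then show ?thesis by linarith
next
  case True
  then obtain n1 where n1: "n1 < b" "int b dvd int n1 * a - m" by auto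
  define g where "g = nat (gcd a (int b))"
  define d where "d = b div g"
  have g: "g > 0" "int g = gcd a (int b)" using assms by (auto simp: g_def)
  have "g dvd b" using g(2) by (metis gcd_dvd2 of_nat_dvd_iff)
  then have b: "b = g * d" by (simp add: d_def)
  then have d: "d > 0" using assms by (cases d) auto
  obtain a' where a': "a = int g * a'" using g(2) by (metis dvdE gcd_dvd1)
  have cop: "coprime (int d) a'"
  proof -
    have "int g * gcd a' (int d) = int g" using g(2) by (simp add: a' b gcd_mult_left)
    then have "gcd a' (int d) = 1" using g(1) by simp
    then show ?thesis by (simp add: coprime_iff_gcd_eq_1 gcd.commute)
  qed
  have iff: "int b dvd int n * a - m \<longleftrightarrow> n mod d = n1 mod d" for n
  proof -
    have "int b dvd int n * a - m \<longleftrightarrow> int b dvd (int n * a - m) - (int n1 * a - m)"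
      using n1(2) by (metis dvd_diff_left_iff dvd_diff diff_add_cancel dvd_add)
    also have "(int n * a - m) - (int n1 * a - m) = int g * ((int n - int n1) * a')"
      by (simp add: a' algebra_simps)
    also have "int b dvd \<dots> \<longleftrightarrow> int d dvd (int n - int n1) * a'"
      using g(1) by (simp add: b)
    also have "\<dots> \<longleftrightarrow> int d dvd int n - int n1"
      using cop by (rule coprime_dvd_mult_left_iff)
    also have "\<dots> \<longleftrightarrow> n mod d = n1 mod d"
      by (metis mod_eq_dvd_iff of_nat_eq_iff zmod_int)
    finally show ?thesis .
  qed
  define n0 where "n0 = n1 mod d"
  have n0: "n0 < d" using d by (simp add: n0_def)
  have "(\<Sum>n<b. sawtooth (real n / real b) * of_bool (int b dvd int n * a - m))
      = (\<Sum>n\<in>{n. n < b \<and> n mod d = n0}. sawtooth (real n / real b))"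
    unfolding iff n0_def[symmetric]
    by (rule sum.mono_neutral_cong_right) auto
  also have "\<dots> = (\<Sum>i<g. sawtooth (real (n0 + i * d) / real (g * d)))"
  proof (rule sum.reindex_bij_witness[of _ "\<lambda>i. n0 + i * d" "\<lambda>n. n div d"])
    fix i assume i: "i \<in> {..<g}"
    have "n0 + i * d < (i + 1) * d" using n0 by simp
    also have "\<dots> \<le> g * d" using i by (intro mult_right_mono) auto
    finally show "n0 + i * d \<in> {n. n < b \<and> n mod d = n0}" using n0 by (simp add: b)
    show "(n0 + i * d) div d = i" using n0 by simp
  next
    fix n assume n: "n \<in> {n. n < b \<and> n mod d = n0}"
    then show eq: "n0 + n div d * d = n" using mod_mult_div_eq[of n d] by (simp add: mult.commute add.commute)
    show "n div d \<in> {..<g}" using n d by (simp add: b div_less_iff_less_mult)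
    show "sawtooth (real (n0 + n div d * d) / real (g * d)) = sawtooth (real n / real b)"
      using eq by (simp add: b)
  qed
  finally show ?thesis using abs_sum_sawtooth_mod_class_le[OF g(1) n0] by simp
qed

lemma abs_sum_cot_mult_sin_le:
  fixes b :: nat and a m :: int
  assumes "b > 0"
  shows "\<bar>\<Sum>k<b. cot (pi * of_int a * real k / real b) * sin (2 * pi * of_int m * real k / real b)\<bar> \<le> real b"
proof -
  let ?S = "\<lambda>m. \<Sum>n<b. sawtooth (real n / real b) * of_bool (int b dvd int n * a - m)"
  have "(\<Sum>k<b. cot (pi * of_int a * real k / real b) * sin (2 * pi * of_int m * real k / real b))
     = real b * (?S (- m) - ?S m)"
    unfolding sum_cot_mult_sin[OF assms] by (simp add: right_diff_distrib sum_subtractf)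
  moreover have "\<bar>?S (- m) - ?S m\<bar> \<le> 1"
    using abs_sum_sawtooth_congruence_le[OF assms, of a m] abs_sum_sawtooth_congruence_le[OF assms, of a "- m"]
    by linarith
  ultimately show ?thesis using assms by (simp add: abs_mult)
qed

section \<open>Splitting the cotangent by the conjugate Poisson kernel\<close>

text \<open>
  The cotangent minus the conjugate Poisson kernel \<open>2 (\<Sum>m\<ge>1. r ^ m * sin (2 * pi * m * t))\<close>;
  on \<open>{0<..1/2}\<close> it behaves like \<open>1 / (pi * t)\<close> up to the scale \<open>1 - r\<close> and decays quickly beyond it.
\<close>

definition ckernel :: "real \<Rightarrow> real \<Rightarrow> real" where
  "ckernel r t = cot (pi * t) * ((1 - r)\<^sup>2 / ((1 - r)\<^sup>2 + 4 * r * (sin (pi * t))\<^sup>2))"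

text \<open>For z = r exp(2 pi i t) the series is twice the imaginary part of 1 / (1 - z), and
  \<open>D\<close> is |1 - z|^2. Where sin(pi t) = 0, both \<open>cot\<close> and
  \<open>ckernel\<close> are 0 by division by zero.\<close>

lemma conj_poisson_sums:
  assumes "0 \<le> r" "r < 1"
  shows "(\<lambda>m. 2 * r ^ m * sin (2 * pi * real m * t)) sums (cot (pi * t) - ckernel r t)"
proof -
  define z where "z = of_real r * cis (2 * pi * t)"
  have nz: "norm z < 1" using assms by (simp add: z_def norm_mult)
  have zm: "z ^ m = of_real (r ^ m) * cis (2 * pi * real m * t)" for m
    by (simp add: z_def power_mult_distrib Complex.DeMoivre mult_ac)
  from geometric_sums[OF nz] have "(\<lambda>m. Im (z ^ m)) sums Im (1 / (1 - z))"
    by (rule sums_Im)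
  then have "(\<lambda>m. 2 * Im (z ^ m)) sums (2 * Im (1 / (1 - z)))" by (rule sums_mult)
  moreover have "2 * Im (z ^ m) = 2 * r ^ m * sin (2 * pi * real m * t)" for m
    by (simp add: zm flip: of_real_power)
  moreover have "2 * Im (1 / (1 - z)) = cot (pi * t) - ckernel r t"
  proof -
    define s c where "s = sin (pi * t)" and "c = cos (pi * t)"
    have sc: "s\<^sup>2 + c\<^sup>2 = 1" by (simp add: s_def c_def)
    have cs: "cos (2 * pi * t) = 1 - 2 * s\<^sup>2" "sin (2 * pi * t) = 2 * s * c"
      using cos_double_sin[of "pi * t"] sin_double[of "pi * t"] by (simp_all add: s_def c_def mult_ac)
    define D where "D = (1 - r)\<^sup>2 + 4 * r * s\<^sup>2"
    have D: "D > 0" using assms by (simp add: D_def add_pos_nonneg)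
    have eqD: "(1 - r * (1 - 2 * s\<^sup>2))\<^sup>2 + (r * (2 * s * c))\<^sup>2 = D"
    proof -
      have "(1 - r * (1 - 2 * s\<^sup>2))\<^sup>2 + (r * (2 * s * c))\<^sup>2
         = (1 - r * (1 - 2 * s\<^sup>2))\<^sup>2 + 4 * r\<^sup>2 * s\<^sup>2 * c\<^sup>2" by (simp add: power_mult_distrib)
      also have "c\<^sup>2 = 1 - s\<^sup>2" using sc by simp
      finally show ?thesis by (simp add: D_def power2_eq_square algebra_simps)
    qed
    have "2 * Im (1 / (1 - z)) = 4 * r * s * c / D"
      by (simp add: z_def Im_divide cs eqD flip: power2_eq_square)
    also have "\<dots> = cot (pi * t) - ckernel r t"
    proof (cases "s = 0")
      case True
      then show ?thesis by (simp add: ckernel_def cot_def s_def)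
    next
      case False
      have "cot (pi * t) - ckernel r t = c / s * ((D - (1 - r)\<^sup>2) / D)"
        using D by (simp add: ckernel_def cot_def s_def[symmetric] c_def[symmetric] D_def[symmetric]
            right_diff_distrib diff_divide_distrib)
      also have "\<dots> = 4 * r * s * c / D"
        using False D by (simp add: D_def[of] field_simps power2_eq_square)
      finally show ?thesis ..
    qed
    finally show ?thesis .
  qed
  ultimately show ?thesis by simp
qed

text \<open>Mode m costs at most 2 r^m b by \<open>abs_sum_cot_mult_sin_le\<close>, whatever a is.
  The geometric series gives 2 b / (1 - r), and the prefactor 1 / (4 b) removes b.\<close>

lemma dedekind_sum_ckernel_approx:
  fixes b :: nat and a :: int
  assumes "b > 0" "0 \<le> r" "r < 1"
  shows "\<bar>dedekind_sum a (int b)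
     - 1 / (4 * real b) * (\<Sum>k<b. ckernel r (real k / real b) * cot (pi * of_int a * real k / real b))\<bar>
     \<le> 1 / (1 - r)"
proof -
  let ?ct = "\<lambda>k. cot (pi * of_int a * real k / real b)"
  let ?Y = "\<lambda>m. \<Sum>k<b. ?ct k * sin (2 * pi * of_int (int m) * real k / real b)"
  have "(\<lambda>m. 2 * r ^ m * sin (2 * pi * real m * (real k / real b)) * ?ct k) sums
     ((cot (pi * (real k / real b)) - ckernel r (real k / real b)) * ?ct k)" for k
    by (intro sums_mult2 conj_poisson_sums assms)
  then have "(\<lambda>m. \<Sum>k<b. 2 * r ^ m * sin (2 * pi * real m * (real k / real b)) * ?ct k) sums
     (\<Sum>k<b. (cot (pi * (real k / real b)) - ckernel r (real k / real b)) * ?ct k)"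
    by (intro sums_sum)
  also have "(\<lambda>m. \<Sum>k<b. 2 * r ^ m * sin (2 * pi * real m * (real k / real b)) * ?ct k) = (\<lambda>m. 2 * r ^ m * ?Y m)"
    by (simp add: sum_distrib_left mult_ac)
  finally have S: "(\<lambda>m. 2 * r ^ m * ?Y m) sums
     (\<Sum>k<b. (cot (pi * (real k / real b)) - ckernel r (real k / real b)) * ?ct k)" .
  have G: "(\<lambda>m. 2 * real b * r ^ m) sums (2 * real b * (1 / (1 - r)))"
    using assms by (intro sums_mult geometric_sums) auto
  have le: "\<bar>2 * r ^ m * ?Y m\<bar> \<le> 2 * real b * r ^ m" for m
  proof -
    have "\<bar>2 * r ^ m * ?Y m\<bar> = 2 * r ^ m * \<bar>?Y m\<bar>" using assms by (simp add: abs_mult)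
    also have "\<dots> \<le> 2 * r ^ m * real b"
      using assms abs_sum_cot_mult_sin_le[OF assms(1), of a "int m"] by (intro mult_left_mono) auto
    finally show ?thesis by (simp add: mult_ac)
  qed
  have "\<bar>\<Sum>k<b. (cot (pi * (real k / real b)) - ckernel r (real k / real b)) * ?ct k\<bar> \<le> 2 * real b * (1 / (1 - r))"
  proof -
    have "\<bar>\<Sum>m. 2 * r ^ m * ?Y m\<bar> \<le> (\<Sum>m. 2 * real b * r ^ m)"
    proof -
      have s: "summable (\<lambda>m. norm (2 * r ^ m * ?Y m))"
        using le by (intro summable_comparison_test'[OF sums_summable[OF G]]) auto
      have "norm (\<Sum>m. 2 * r ^ m * ?Y m) \<le> (\<Sum>m. norm (2 * r ^ m * ?Y m))"
        by (rule summable_norm[OF s])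
      also have "\<dots> \<le> (\<Sum>m. 2 * real b * r ^ m)"
        using le s by (intro suminf_le sums_summable[OF G]) auto
      finally show ?thesis by simp
    qed
    then show ?thesis using sums_unique[OF S] sums_unique[OF G] by simp
  qed
  then have B: "1 / (4 * real b) * \<bar>\<Sum>k<b. (cot (pi * (real k / real b)) - ckernel r (real k / real b)) * ?ct k\<bar>
      \<le> 1 / (4 * real b) * (2 * real b * (1 / (1 - r)))"
    by (intro mult_left_mono) auto
  have "dedekind_sum a (int b)
     - 1 / (4 * real b) * (\<Sum>k<b. ckernel r (real k / real b) * ?ct k)
     = 1 / (4 * real b) * (\<Sum>k<b. (cot (pi * (real k / real b)) - ckernel r (real k / real b)) * ?ct k)"
    unfolding dedekind_sum_eq_sum_cot[OF assms(1)]
    by (simp add: left_diff_distrib sum_subtractf right_diff_distrib)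
  also have "\<bar>\<dots>\<bar> \<le> 1 / (4 * real b) * (2 * real b * (1 / (1 - r)))"
    using B by (simp only: abs_mult) simp
  also have "\<dots> \<le> 1 / (1 - r)" using assms by (simp add: field_simps)
  finally show ?thesis .
qed

section \<open>Inequalities for the cotangent and for the remaining kernel\<close>

lemma first_quadrant:
  fixes x :: real assumes "0 < x" "x \<le> pi / 2"
  shows "0 < sin x" "0 \<le> cos x" "0 \<le> cot x"
proof -
  show s: "0 < sin x" using assms by (intro sin_gt_zero) auto
  show c: "0 \<le> cos x" using assms by (intro cos_ge_zero) auto
  show "0 \<le> cot x" unfolding cot_def using s c by (intro divide_nonneg_nonneg) auto
qed

lemma first_quadrant_pi:
  fixes t :: real assumes "0 < t" "t \<le> 1 / 2"
  shows "0 < pi * t" "pi * t \<le> pi / 2"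
  using assms mult_left_mono[of t "1/2" pi] by auto

lemma cot_le_inverse:
  fixes x :: real assumes "0 < x" "x \<le> pi / 2" shows "cot x \<le> 1 / x"
proof -
  have "sin 0 - 0 * cos (0::real) \<le> sin x - x * cos x"
  proof (rule DERIV_nonneg_imp_nondecreasing[where f = "\<lambda>x. sin x - x * cos x"])
    fix y assume y: "0 \<le> y" "y \<le> x"
    have "((\<lambda>x. sin x - x * cos x) has_real_derivative y * sin y) (at y)"
      by (auto intro!: derivative_eq_intros)
    moreover have "y * sin y \<ge> 0" using y assms by (intro mult_nonneg_nonneg sin_ge_zero) auto
    ultimately show "\<exists>d. ((\<lambda>x. sin x - x * cos x) has_real_derivative d) (at y) \<and> 0 \<le> d" by blast
  qed (use assms in auto)
  moreover have "sin x > 0" using assms by (intro sin_gt_zero) auto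
  ultimately show ?thesis using assms by (auto simp: cot_def field_simps)
qed

lemma cot_ge_inverse_minus:
  fixes x :: real assumes "0 < x" "x \<le> pi / 2" shows "1 / x - x \<le> cot x"
proof -
  have s: "sin x > 0" using assms by (intro sin_gt_zero) auto
  have c: "cos x \<ge> 0" using assms by (intro cos_ge_zero) auto
  have "(1 - x\<^sup>2) * sin x \<le> x * cos x"
  \<comment> \<open>Beyond 1 the left side is not positive; up to 1 the bounds sin x \<le> x and cos
    x \<ge> 1 - x^2 / 2 suffice.\<close>
  proof (cases "x \<le> 1")
    case True
    have "(1 - x\<^sup>2) * sin x \<le> (1 - x\<^sup>2) * x"
      using True assms by (intro mult_left_mono sin_x_le_x) (auto simp: power_le_one)
    also have "\<dots> \<le> (1 - x\<^sup>2 / 2) * x" using assms by (intro mult_right_mono) auto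
    also have "\<dots> \<le> cos x * x"
    proof (rule mult_right_mono)
      have "0 \<le> sin (x / 2)" using assms by (intro sin_ge_zero) auto
      moreover have "sin (x / 2) \<le> x / 2" using assms by (intro sin_x_le_x) auto
      ultimately have "(sin (x / 2))\<^sup>2 \<le> (x / 2)\<^sup>2" by (intro power_mono)
      then show "1 - x\<^sup>2 / 2 \<le> cos x"
        using cos_double_sin[of "x / 2"] by (simp add: power_divide)
    qed (use assms in auto)
    finally show ?thesis by (simp add: mult.commute)
  next
    case False
    then have "1 - x\<^sup>2 \<le> 0" using one_le_power[of x 2] by simp
    then have "(1 - x\<^sup>2) * sin x \<le> 0" using s by (intro mult_nonpos_nonneg) auto
    also have "0 \<le> x * cos x" using assms c by auto
    finally show ?thesis .
  qed
  then show ?thesis using s assms by (simp add: cot_def field_simps power2_eq_square)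
qed

text \<open>The derivative is 1 / z^2 - 1 / sin^2 z. Monotonicity of the difference lets the
  reciprocal replace the cotangent in interlaced sums at bounded cost, see
  \<open>sum_cotcell_interlaced\<close>.\<close>

lemma cot_minus_inverse_antimono:
  fixes x y :: real assumes "0 < x" "x \<le> y" "y \<le> pi / 2"
  shows "cot y - 1 / y \<le> cot x - 1 / x"
proof (rule DERIV_nonpos_imp_nonincreasing[where f = "\<lambda>x. cot x - 1 / x", OF assms(2)])
  fix z assume z: "x \<le> z" "z \<le> y"
  have s: "sin z > 0" using z assms by (intro sin_gt_zero) auto
  have "((\<lambda>x. cot x - 1 / x) has_real_derivative (- inverse ((sin z)\<^sup>2) + 1 / z\<^sup>2)) (at z)"
    using s z assms by (auto intro!: derivative_eq_intros DERIV_cot simp: power2_eq_square)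
  moreover have "- inverse ((sin z)\<^sup>2) + 1 / z\<^sup>2 \<le> 0"
  proof -
    have "(sin z)\<^sup>2 \<le> z\<^sup>2" using s z assms by (intro power_mono sin_x_le_x) auto
    then have "1 / z\<^sup>2 \<le> 1 / (sin z)\<^sup>2"
      using s z assms by (intro divide_left_mono mult_pos_pos zero_less_power) auto
    then show ?thesis by (simp add: inverse_eq_divide)
  qed
  ultimately show "\<exists>d. ((\<lambda>x. cot x - 1 / x) has_real_derivative d) (at z) \<and> d \<le> 0" by blast
qed

lemma cot_antimono:
  fixes x y :: real assumes "0 < x" "x \<le> y" "y \<le> pi / 2"
  shows "cot y \<le> cot x"
proof -
  have "1 / y \<le> 1 / x" using assms by (intro divide_left_mono) auto
  then show ?thesis using cot_minus_inverse_antimono[OF assms] by simp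
qed

text \<open>A weak Jordan inequality (the sharp constant is 4). From x cos x \<le> sin x one gets
  x^2 \<le> (1 + x^2) sin^2 x, and 1 + x^2 \<le> 5 \<le> pi^2.\<close>

lemma sin_pi_mult_squared_ge:
  fixes t :: real assumes "0 < t" "t \<le> 1 / 2" shows "t\<^sup>2 \<le> (sin (pi * t))\<^sup>2"
proof -
  define x where "x = pi * t"
  have x: "0 < x" "x \<le> pi / 2" using assms mult_left_mono[of t "1/2" pi] by (auto simp: x_def)
  have s: "sin x > 0" and c: "cos x \<ge> 0" using x by (auto intro!: sin_gt_zero cos_ge_zero)
  have "x * cos x \<le> sin x" using cot_le_inverse[OF x] s x by (simp add: cot_def field_simps)
  then have "(x * cos x)\<^sup>2 \<le> (sin x)\<^sup>2" using x c by (intro power_mono) auto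
  then have 1: "x\<^sup>2 \<le> (sin x)\<^sup>2 * (1 + x\<^sup>2)" by (simp add: power_mult_distrib cos_squared_eq algebra_simps)
  have "x \<le> 2" using x pi_less_4 by linarith
  then have "1 + x\<^sup>2 \<le> 5" using x power_mono[of x 2 2] by simp
  then have 2: "(sin x)\<^sup>2 * (1 + x\<^sup>2) \<le> (sin x)\<^sup>2 * 5" by (intro mult_left_mono) auto
  have "3\<^sup>2 \<le> pi\<^sup>2" using pi_gt3 by (intro power_mono) auto
  then have "5 * t\<^sup>2 \<le> pi\<^sup>2 * t\<^sup>2" by (intro mult_right_mono) auto
  then show ?thesis using 1 2 by (simp add: x_def power_mult_distrib)
qed

context
  fixes r :: real
  assumes r: "1 / 2 \<le> r" "r < 1"
begin

lemma ckernel_nonneg: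
  assumes "0 < t" "t \<le> 1 / 2" shows "0 \<le> ckernel r t"
proof -
  have "0 \<le> cot (pi * t)" by (rule first_quadrant[OF first_quadrant_pi[OF assms]])
  then show ?thesis using r by (auto simp: ckernel_def)
qed

text \<open>As r is at least 1/2, 4 r \<ge> 1, and \<open>sin_pi_mult_squared_ge\<close> turns the
  damping factor into a Lorentz profile of width 1 - r.\<close>

lemma ckernel_le:
  assumes "0 < t" "t \<le> 1 / 2"
  shows "ckernel r t \<le> 1 / (pi * t) * ((1 - r)\<^sup>2 / ((1 - r)\<^sup>2 + t\<^sup>2))"
proof -
  have "1 * t\<^sup>2 \<le> 4 * r * (sin (pi * t))\<^sup>2"
    using r assms sin_pi_mult_squared_ge[of t] by (intro mult_mono) auto
  then have "(1 - r)\<^sup>2 / ((1 - r)\<^sup>2 + 4 * r * (sin (pi * t))\<^sup>2) \<le> (1 - r)\<^sup>2 / ((1 - r)\<^sup>2 + t\<^sup>2)"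
    using r by (intro divide_left_mono mult_pos_pos add_pos_nonneg) auto
  moreover have "cot (pi * t) \<le> 1 / (pi * t)" using assms by (intro cot_le_inverse) auto
  ultimately show ?thesis unfolding ckernel_def using assms r by (intro mult_mono) auto
qed

lemma ckernel_le_inverse:
  assumes "0 < t" "t \<le> 1 / 2"
  shows "ckernel r t \<le> 1 / (pi * t)"
proof -
  have "(1 - r)\<^sup>2 / ((1 - r)\<^sup>2 + t\<^sup>2) \<le> 1" using r by (simp add: divide_le_eq add_pos_nonneg)
  then have "1 / (pi * t) * ((1 - r)\<^sup>2 / ((1 - r)\<^sup>2 + t\<^sup>2)) \<le> 1 / (pi * t) * 1"
    using assms by (intro mult_left_mono) auto
  then show ?thesis using ckernel_le[OF assms] by simp
qed

text \<open>The term 2 bounds the error pi t of the cotangent. The term 8 / (1 - r)^2 pays for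
  replacing the damping factor by 1: its defect is at most 4 (pi t)^2 / (1 - r)^2, enough to absorb
  the pole 1 / (pi t).\<close>

lemma ckernel_ge:
  assumes "0 < t" "t \<le> 1 / 2"
  shows "1 / (pi * t) - (2 + 8 / (1 - r)\<^sup>2) \<le> ckernel r t"
proof -
  define e where "e = (1 - r)\<^sup>2"
  define w where "w = 4 * r * (sin (pi * t))\<^sup>2"
  have e: "e > 0" using r by (simp add: e_def)
  note pt = first_quadrant_pi[OF assms]
  have s: "0 \<le> sin (pi * t)" "sin (pi * t) \<le> pi * t"
    using first_quadrant[OF pt] pt by (simp, intro sin_x_le_x, simp)
  have w: "0 \<le> w" using r by (simp add: w_def)
  have "w \<le> 4 * 1 * (pi * t)\<^sup>2" unfolding w_def using r s by (intro mult_mono power_mono) auto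
  then have wle: "w \<le> 4 * (pi * t)\<^sup>2" by simp
  have cot: "0 \<le> cot (pi * t)" "cot (pi * t) \<le> 1 / (pi * t)" "1 / (pi * t) - pi * t \<le> cot (pi * t)"
    using first_quadrant(3)[OF pt] cot_le_inverse[OF pt] cot_ge_inverse_minus[OF pt] .
  have "ckernel r t = cot (pi * t) - cot (pi * t) * (w / (e + w))"
  proof -
    have "e / (e + w) = 1 - w / (e + w)" using e w by (simp add: field_simps)
    moreover have "ckernel r t = cot (pi * t) * (e / (e + w))" by (simp only: ckernel_def e_def w_def)
    ultimately show ?thesis by (simp add: right_diff_distrib)
  qed
  moreover have "cot (pi * t) * (w / (e + w)) \<le> 1 / (pi * t) * (4 * (pi * t)\<^sup>2 / e)"
    using cot e w wle assms by (intro mult_mono frac_le) auto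
  moreover have "1 / (pi * t) * (4 * (pi * t)\<^sup>2 / e) = 4 * (pi * t) / e"
    using assms by (simp add: power2_eq_square)
  moreover have "pi * t \<le> 2" using pi_less_4 pt by linarith
  moreover from this have "4 * (pi * t) / e \<le> 8 / e" using e by (intro divide_right_mono) auto
  ultimately show ?thesis using cot by (simp add: e_def)
qed

text \<open>Used at k / b: for fixed k the weight increases with b, as the Abel summation over b
  requires.\<close>

lemma ckernel_antimono:
  assumes "0 < s" "s \<le> t" "t \<le> 1 / 2"
  shows "ckernel r t \<le> ckernel r s"
proof -
  have pt: "0 < pi * s" "pi * s \<le> pi * t" "pi * t \<le> pi / 2"
    using assms mult_left_mono[of t "1/2" pi] by auto
  have sn: "0 \<le> sin (pi * s)" using first_quadrant[of "pi * s"] pt by linarith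
  have sn': "sin (pi * s) \<le> sin (pi * t)" by (rule sin_monotone_2pi_le) (use pt in linarith)+
  have "0 \<le> cot (pi * t)" using first_quadrant[of "pi * t"] pt by linarith
  moreover have "cot (pi * t) \<le> cot (pi * s)" using pt by (intro cot_antimono)
  moreover have "4 * r * (sin (pi * s))\<^sup>2 \<le> 4 * r * (sin (pi * t))\<^sup>2"
    using sn sn' r by (intro mult_left_mono power_mono) auto
  then have "(1 - r)\<^sup>2 / ((1 - r)\<^sup>2 + 4 * r * (sin (pi * t))\<^sup>2) \<le> (1 - r)\<^sup>2 / ((1 - r)\<^sup>2 + 4 * r * (sin (pi * s))\<^sup>2)"
    using r by (intro divide_left_mono mult_pos_pos add_pos_nonneg) auto
  ultimately show ?thesis unfolding ckernel_def using r by (intro mult_mono) auto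
qed

end

lemma ckernel_one_minus: "ckernel r (1 - t) = - ckernel r t"
proof -
  have "sin (pi * (1 - t)) = sin (pi * t)" "cos (pi * (1 - t)) = - cos (pi * t)"
    by (simp_all add: right_diff_distrib sin_diff cos_diff)
  then show ?thesis by (simp add: ckernel_def cot_def)
qed

text \<open>Both factors change sign under k -> b - k, so their product is symmetric, while k = 0
  and 2 k = b contribute 0. The kernel bounds hold only on the half range.\<close>

lemma sum_ckernel_fold:
  fixes b :: nat and a :: int
  assumes "b > 0"
  shows "(\<Sum>k<b. ckernel r (real k / real b) * cot (pi * of_int a * real k / real b))
    = 2 * (\<Sum>k | 0 < k \<and> 2 * k < b. ckernel r (real k / real b) * cot (pi * of_int a * real k / real b))"
proof -
  let ?f = "\<lambda>k. ckernel r (real k / real b) * cot (pi * of_int a * real k / real b)"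
  let ?L = "{k. 0 < k \<and> 2 * k < b}" and ?U = "{k. b < 2 * k \<and> k < b}"
  have fin: "finite ?L" "finite ?U" by (auto intro!: finite_subset[of _ "{..<b}"])
  have refl: "?f (b - k) = ?f k" if "k \<le> b" for k
  proof -
    have "ckernel r (real (b - k) / real b) = - ckernel r (real k / real b)"
      using that assms ckernel_one_minus[of r "real k / real b"] by (simp add: of_nat_diff diff_divide_distrib)
    moreover have "cot (pi * of_int a * real (b - k) / real b) = - cot (pi * of_int a * real k / real b)"
    proof -
      have "pi * of_int a * real (b - k) / real b = - (pi * of_int a * real k / real b) + of_int a * pi"
        using that assms by (simp add: of_nat_diff field_simps)
      moreover have "cot (x + of_int a * pi) = cot x" for x
      proof -
        have "sin (of_int a * pi) = 0" by (metis sin_npi_int mult.commute)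
        moreover from this have "cos (of_int a * pi) \<noteq> 0"
          by (metis sin_zero_abs_cos_one abs_zero zero_neq_one)
        ultimately show ?thesis by (simp add: cot_def sin_add cos_add)
      qed
      ultimately show ?thesis by (simp only: cot_minus)
    qed
    ultimately show ?thesis by simp
  qed
  have zero: "?f k = 0" if "k < b" "k \<notin> ?L \<union> ?U" for k
  proof -
    have "k = 0 \<or> 2 * k = b" using that by auto
    then show ?thesis
    proof
      assume "2 * k = b"
      then have "real k / real b = 1/2" using assms by (auto simp: field_simps)
      then show ?thesis by (simp add: ckernel_def cot_def)
    qed (simp add: cot_def)
  qed
  have "(\<Sum>k<b. ?f k) = (\<Sum>k\<in>?L \<union> ?U. ?f k)"
  proof (rule sum.mono_neutral_right)
    show "\<forall>k\<in>{..<b} - (?L \<union> ?U). ?f k = 0" using zero by blast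
  qed auto
  also have "\<dots> = (\<Sum>k\<in>?L. ?f k) + (\<Sum>k\<in>?U. ?f k)"
    using fin by (intro sum.union_disjoint) auto
  also have "(\<Sum>k\<in>?U. ?f k) = (\<Sum>k\<in>?L. ?f k)"
  proof (rule sum.reindex_bij_witness[of _ "\<lambda>k. b - k" "\<lambda>k. b - k"])
    fix k assume k: "k \<in> ?U"
    show "?f (b - k) = ?f k" by (rule refl) (use k in auto)
  qed auto
  finally show ?thesis by simp
qed

lemma dedekind_sum_half_ckernel_approx:
  fixes b :: nat and a :: int
  assumes "b > 0" "0 \<le> r" "r < 1"
  shows "\<bar>dedekind_sum a (int b)
     - 1 / (2 * real b) * (\<Sum>k | 0 < k \<and> 2 * k < b. ckernel r (real k / real b) * cot (pi * of_int a * real k / real b))\<bar>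
     \<le> 1 / (1 - r)"
  using dedekind_sum_ckernel_approx[OF assms, of a] unfolding sum_ckernel_fold[OF assms(1)] by simp

section \<open>Summing the cotangent over lattice points\<close>

text \<open>One period of cot(pi t) around its pole. The interval can be closed at both ends because
  the cotangent vanishes at pi / 2.\<close>

definition cotcell :: "real \<Rightarrow> real" where
  "cotcell t = (if \<bar>t\<bar> \<le> 1 / 2 then cot (pi * t) else 0)"

lemma cotcell_minus: "cotcell (- t) = - cotcell t"
  by (simp add: cotcell_def)

lemma cotcell_0 [simp]: "cotcell 0 = 0"
  by (simp add: cotcell_def)

lemma cotcell_eq_0: "\<bar>t\<bar> > 1 / 2 \<Longrightarrow> cotcell t = 0"
  by (simp add: cotcell_def)

lemma abs_cotcell_le:
  assumes "t > 0" shows "\<bar>cotcell t\<bar> \<le> 1 / (pi * t)"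
proof (cases "t \<le> 1 / 2")
  case True
  note pt = first_quadrant_pi[OF assms True]
  show ?thesis using first_quadrant(3)[OF pt] cot_le_inverse[OF pt] True assms by (simp add: cotcell_def)
qed (use assms in \<open>simp add: cotcell_def\<close>)

lemma cot_pi_eq_sum_cotcell:
  fixes x :: real and k :: nat
  assumes "0 \<le> x" "x < real k"
  shows "cot (pi * x) = (\<Sum>j\<le>k. cotcell (x - real j))"
proof -
  define n where "n = nat \<lfloor>x\<rfloor>"
  have n: "real n \<le> x" "x < real n + 1" using assms by (auto simp: n_def)
  have nk: "n < k" using n assms by linarith
  have per: "cot (pi * (x - real j)) = cot (pi * x)" for j
  proof -
    have "sin (real j * pi) = 0" "cos (real j * pi) \<noteq> 0"
      by (simp_all add: cos_npi)
    then show ?thesis by (simp add: cot_def right_diff_distrib sin_diff cos_diff mult.commute[of pi])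
  qed
  have "(\<Sum>j\<le>k. cotcell (x - real j)) = (\<Sum>j\<in>{n, Suc n}. cotcell (x - real j))"
  proof (rule sum.mono_neutral_right)
    show "\<forall>j\<in>{..k} - {n, Suc n}. cotcell (x - real j) = 0"
    proof
      fix j assume "j \<in> {..k} - {n, Suc n}"
      then have "j + 1 \<le> n \<or> n + 2 \<le> j" by auto
      then have "\<bar>x - real j\<bar> > 1/2" using n by auto
      then show "cotcell (x - real j) = 0" by (rule cotcell_eq_0)
    qed
  qed (use nk in auto)
  also have "\<dots> = cotcell (x - real n) + cotcell (x - real (Suc n))" by simp
  also have "\<dots> = cot (pi * x)"
  proof -
    consider "x - real n < 1/2" | "x - real n = 1/2" | "x - real n > 1/2" by linarith
    then show ?thesis
    proof cases
      case 1
      then show ?thesis using n per[of n] by (simp add: cotcell_def)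
    next
      \<comment> \<open>Exactly halfway, both neighbouring cells are active and both vanish.\<close>
      case 2
      then have "x - real (Suc n) = - (1/2)" by simp
      moreover have "cot (pi * x) = 0" using per[of n] 2 by (simp add: cot_def)
      ultimately show ?thesis using 2 by (simp only: cotcell_minus)
    next
      case 3
      then show ?thesis using n per[of "Suc n"] by (simp add: cotcell_def)
    qed
  qed
  finally show ?thesis ..
qed

text \<open>An alternating-series argument: the points u + i k and v + i k interlace, and moving v +
  i k up to u + (i + 1) k makes the sum telescope.\<close>

lemma sum_interlaced_antimono:
  fixes f :: "real \<Rightarrow> real"
  assumes anti: "\<And>x y. 0 < x \<Longrightarrow> x \<le> y \<Longrightarrow> f y \<le> f x"
    and "0 < u" "u \<le> v" "v \<le> u + k"
  shows "0 \<le> (\<Sum>i<N. f (u + real i * k) - f (v + real i * k))"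
    and "(\<Sum>i<N. f (u + real i * k) - f (v + real i * k)) \<le> f u - f (u + real N * k)"
proof -
  have k: "0 \<le> k" using assms by linarith
  have pos: "0 < u + real i * k" "0 < v + real i * k" for i :: nat
    using k assms by (auto intro!: add_pos_nonneg)
  show "0 \<le> (\<Sum>i<N. f (u + real i * k) - f (v + real i * k))"
    using pos assms by (intro sum_nonneg) (simp add: anti)
  have "(\<Sum>i<N. f (u + real i * k) - f (v + real i * k)) \<le> (\<Sum>i<N. f (u + real i * k) - f (u + real (Suc i) * k))"
    using pos assms by (intro sum_mono diff_left_mono anti) (auto simp: algebra_simps)
  also have "\<dots> = f (u + real 0 * k) - f (u + real N * k)"
    by (rule sum_lessThan_telescope')
  finally show "(\<Sum>i<N. f (u + real i * k) - f (v + real i * k)) \<le> f u - f (u + real N * k)" by simp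
qed

lemma abs_sum_interlaced_antimono_le:
  fixes f :: "real \<Rightarrow> real"
  assumes anti: "\<And>x y. 0 < x \<Longrightarrow> x \<le> y \<Longrightarrow> f y \<le> f x"
    and "0 < u" "0 < v" "\<bar>u - v\<bar> \<le> k"
  shows "\<bar>\<Sum>i<N. f (u + real i * k) - f (v + real i * k)\<bar> \<le> f (min u v) - f (min u v + real N * k)"
proof (cases "u \<le> v")
  case True
  then show ?thesis using sum_interlaced_antimono[where f = f and u = u and v = v and k = k and N = N] assms by (simp add: min_def)
next
  case False
  have "(\<Sum>i<N. f (u + real i * k) - f (v + real i * k)) = - (\<Sum>i<N. f (v + real i * k) - f (u + real i * k))"
    by (simp add: sum_subtractf)
  then show ?thesis using False sum_interlaced_antimono[where f = f and u = v and v = u and k = k and N = N] assms by (simp add: min_def)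
qed

section \<open>Sums of reciprocals along a residue class\<close>

text \<open>
  \<open>resum N k c\<close> is the sum of \<open>1 / n\<close> over the \<open>2 N\<close> integers \<open>n \<equiv> - c (mod k)\<close> nearest to \<open>0\<close>,
  an elementary stand-in for \<open>- pi / k * cot (pi * c / k)\<close>.
\<close>

definition resum :: "nat \<Rightarrow> nat \<Rightarrow> nat \<Rightarrow> real" where
  "resum N k c = (if c mod k = 0 then 0 else
     (\<Sum>i<N. 1 / (real (k - c mod k) + real i * real k) - 1 / (real (c mod k) + real i * real k)))"

lemma resum_mod: "resum N k (c mod k) = resum N k c"
  by (simp add: resum_def)

lemma resum_reflect:
  assumes "0 < c" "c < k" shows "resum N k (k - c) = - resum N k c"
  using assms by (simp add: resum_def sum_subtractf)

lemma abs_resum_le: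
  assumes "0 < c" "c < k" shows "\<bar>resum N k c\<bar> \<le> 1 / real c + 1 / real (k - c)"
proof -
  define m where "m = min (real (k - c)) (real c)"
  have m: "m > 0" using assms by (simp add: m_def)
  have "\<bar>\<Sum>i<N. 1 / (real (k - c) + real i * real k) - 1 / (real c + real i * real k)\<bar>
     \<le> 1 / m - 1 / (m + real N * real k)"
    unfolding m_def
  proof (rule abs_sum_interlaced_antimono_le[where f = "\<lambda>x. 1 / x"])
    show "\<bar>real (k - c) - real c\<bar> \<le> real k" using assms by linarith
  qed (use assms in \<open>auto simp: frac_le\<close>)
  also have "\<dots> \<le> 1 / m" using m by simp
  also have "\<dots> \<le> 1 / real c + 1 / real (k - c)"
    by (cases "real (k - c) \<le> real c") (auto simp: m_def)
  finally show ?thesis using assms by (simp add: resum_def)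
qed

lemma sum_resum_eq_0: "(\<Sum>c<k. resum N k c) = 0"
proof -
  have "(\<Sum>c<k. resum N k c) = (\<Sum>c\<in>{0<..<k}. resum N k c)"
    by (intro sum.mono_neutral_right) (auto simp: resum_def)
  moreover have "(\<Sum>c\<in>{0<..<k}. resum N k c) = (\<Sum>c\<in>{0<..<k}. - resum N k c)"
  proof (rule sum.reindex_bij_witness[of _ "\<lambda>c. k - c" "\<lambda>c. k - c"])
    fix c assume "c \<in> {0<..<k}"
    then show "- resum N k (k - c) = resum N k c" using resum_reflect[of c k N] by simp
  qed auto
  ultimately show ?thesis unfolding sum_negf by linarith
qed

lemma sum_inverse_le_ln:
  assumes "n > 0" shows "(\<Sum>i=1..n. 1 / real i) \<le> 1 + ln (real n)"
  using assms
proof (induction n rule: nat_induct_non_zero)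
  case (Suc n)
  have "1 / real (Suc n) \<le> ln (real (Suc n)) - ln (real n)"
  proof -
    have "ln (real n / real (Suc n)) \<le> real n / real (Suc n) - 1"
      using Suc by (intro ln_le_minus_one) auto
    also have "\<dots> = - (1 / real (Suc n))" by (simp add: field_simps)
    finally show ?thesis using Suc by (simp add: ln_div)
  qed
  then show ?case using Suc by simp
qed simp

lemma sum_abs_resum_le:
  assumes "k > 0" shows "(\<Sum>c<k. \<bar>resum N k c\<bar>) \<le> 2 * (1 + ln (real k))"
proof -
  have "(\<Sum>c<k. \<bar>resum N k c\<bar>) = (\<Sum>c\<in>{0<..<k}. \<bar>resum N k c\<bar>)"
    by (intro sum.mono_neutral_right) (auto simp: resum_def)
  also have "\<dots> \<le> (\<Sum>c\<in>{0<..<k}. 1 / real c + 1 / real (k - c))"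
    by (intro sum_mono abs_resum_le) auto
  also have "\<dots> = (\<Sum>c\<in>{0<..<k}. 1 / real c) + (\<Sum>c\<in>{0<..<k}. 1 / real (k - c))"
    by (rule sum.distrib)
  also have "(\<Sum>c\<in>{0<..<k}. 1 / real (k - c)) = (\<Sum>c\<in>{0<..<k}. 1 / real c)"
    by (rule sum.reindex_bij_witness[of _ "\<lambda>c. k - c" "\<lambda>c. k - c"]) auto
  also have "(\<Sum>c\<in>{0<..<k}. 1 / real c) + (\<Sum>c\<in>{0<..<k}. 1 / real c) = 2 * (\<Sum>c\<in>{0<..<k}. 1 / real c)"
    by simp
  also have "\<dots> \<le> 2 * (\<Sum>c=1..k. 1 / real c)"
    by (intro mult_left_mono sum_mono2) auto
  also have "\<dots> \<le> 2 * (1 + ln (real k))"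
    by (intro mult_left_mono sum_inverse_le_ln assms) auto
  finally show ?thesis .
qed

text \<open>Brings j / k to lowest terms: in \<open>abs_sum_resum_le\<close> the residues of j b mod
  k are d times those of p b mod q with p and q coprime.\<close>

lemma resum_scale:
  assumes "d > 0" shows "resum N (d * k) (d * c) = resum N k c / real d"
proof (cases "c mod k = 0")
  case False
  have e: "d * c mod (d * k) = d * (c mod k)" by (rule mod_mult_mult1)
  have 1: "real (d * k - d * (c mod k)) + real i * real (d * k) = real d * (real (k - c mod k) + real i * real k)" for i :: nat
    unfolding diff_mult_distrib2[symmetric] of_nat_mult by (simp add: algebra_simps)
  have 2: "real (d * (c mod k)) + real i * real (d * k) = real d * (real (c mod k) + real i * real k)" for i :: nat
    by (simp add: algebra_simps)
  have 3: "1 / (real d * x) = 1 / x / real d" for x by simp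
  have "resum N (d * k) (d * c) =
     (\<Sum>i<N. 1 / (real (k - c mod k) + real i * real k) / real d - 1 / (real (c mod k) + real i * real k) / real d)"
    using False assms unfolding resum_def e 1 2 3 by simp
  also have "\<dots> = resum N k c / real d"
    using False unfolding resum_def diff_divide_distrib[symmetric] sum_divide_distrib[symmetric] by simp
  finally show ?thesis .
qed (simp add: resum_def)

text \<open>As p is invertible mod q, any q consecutive b meet each residue once and contribute 0.
  After removing full blocks a shorter run is left; it meets distinct residues, so the absolute sum
  over one period bounds it.\<close>

lemma abs_sum_periodic_le:
  fixes f :: "nat \<Rightarrow> real"
  assumes q: "q > 0" and cop: "coprime p q" and per: "\<And>c. f (c mod q) = f c"
    and zero: "(\<Sum>c<q. f c) = 0" and bd: "(\<Sum>c<q. \<bar>f c\<bar>) \<le> P"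
  shows "\<bar>\<Sum>b\<in>{m..<n}. f (p * b)\<bar> \<le> P"
proof -
  have inj: "inj_on (\<lambda>b. p * b mod q) {m..<m + l}" if "l \<le> q" for m l
  proof (rule inj_onI)
    fix x y assume xy: "x \<in> {m..<m + l}" "y \<in> {m..<m + l}" "p * x mod q = p * y mod q"
    have aux: "x = y" if "x \<le> y" "x \<in> {m..<m + l}" "y \<in> {m..<m + l}" "p * x mod q = p * y mod q" for x y
    proof -
      have "p * x \<le> p * y" using that(1) by simp
      then have "q dvd p * y - p * x" using that(4) by (simp add: mod_eq_dvd_iff_nat[symmetric])
      then have "q dvd p * (y - x)" by (simp add: diff_mult_distrib2)
      then have "q dvd y - x" using coprime_dvd_mult_right_iff[of q p "y - x"] cop
        by (simp only: coprime_commute[of q p])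
      moreover have "y - x < q" using that \<open>l \<le> q\<close> by auto
      ultimately have "y - x = 0" using nat_dvd_not_less by blast
      then show ?thesis using that(1) by simp
    qed
    show "x = y"
    proof (cases "x \<le> y")
      case True then show ?thesis using aux xy by blast
    next
      case False
      then have "y \<le> x" by simp
      then show ?thesis using aux[of y x] xy by (metis (no_types))
    qed
  qed
  have full: "(\<Sum>b\<in>{m..<m + q}. f (p * b)) = 0" for m
  proof -
    have "(\<lambda>b. p * b mod q) ` {m..<m + q} = {..<q}"
      using q card_image[OF inj[of q m]] by (intro card_subset_eq) auto
    then have "(\<Sum>c<q. f c) = (\<Sum>b\<in>{m..<m + q}. f (p * b mod q))"
      using sum.reindex[OF inj[of q m], of f] by simp
    then show ?thesis unfolding per zero by (rule sym)
  qed
  show ?thesis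
  proof (induction "n - m" arbitrary: m rule: less_induct)
    case less
    show ?case
    proof (cases "n - m < q")
      case True
      define l where "l = n - m"
      have l: "{m..<n} = {m..<m + l}" "l \<le> q" using True by (auto simp: l_def)
      have "\<bar>\<Sum>b\<in>{m..<n}. f (p * b)\<bar> \<le> (\<Sum>b\<in>{m..<m + l}. \<bar>f (p * b mod q)\<bar>)"
        unfolding l per by (rule sum_abs)
      also have "\<dots> = (\<Sum>c\<in>(\<lambda>b. p * b mod q) ` {m..<m + l}. \<bar>f c\<bar>)"
        by (simp add: sum.reindex[OF inj[OF l(2)]])
      also have "\<dots> \<le> (\<Sum>c<q. \<bar>f c\<bar>)" using q by (intro sum_mono2) auto
      finally show ?thesis using bd by linarith
    next
      case False
      then have "{m..<n} = {m..<m + q} \<union> {m + q..<n}" by auto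
      then have "(\<Sum>b\<in>{m..<n}. f (p * b)) = (\<Sum>b\<in>{m..<m + q}. f (p * b)) + (\<Sum>b\<in>{m + q..<n}. f (p * b))"
        by (simp add: sum.union_disjoint ivl_disj_int)
      then show ?thesis using less[of "m + q"] False q full[of m] by simp
    qed
  qed
qed

text \<open>The cancellation over b: by oddness \<open>resum\<close> has mean 0 over a period, and
  its absolute sum over a period is only logarithmic in k.\<close>

lemma abs_sum_resum_le:
  assumes "k > 0"
  shows "\<bar>\<Sum>b\<in>{m..<n}. resum N k (j * b)\<bar> \<le> 2 * (1 + ln (real k))"
proof -
  define d where "d = gcd j k"
  have d: "d > 0" using assms by (simp add: d_def)
  obtain p q where pq: "j = d * p" "k = d * q" "coprime p q"
  proof (rule that)
    show "j = d * (j div d)" "k = d * (k div d)" by (simp_all add: d_def)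
    show "coprime (j div d) (k div d)" unfolding d_def by (rule div_gcd_coprime) (use assms in auto)
  qed
  have q: "q > 0" using pq assms by (cases q) auto
  have "\<bar>\<Sum>b\<in>{m..<n}. resum N q (p * b)\<bar> \<le> 2 * (1 + ln (real q))"
    by (rule abs_sum_periodic_le[OF q pq(3) resum_mod sum_resum_eq_0 sum_abs_resum_le[OF q]])
  moreover have "(\<Sum>b\<in>{m..<n}. resum N k (j * b)) = (\<Sum>b\<in>{m..<n}. resum N q (p * b)) / real d"
    using resum_scale[OF d, of N q] by (simp add: pq mult.assoc sum_divide_distrib)
  ultimately have "\<bar>\<Sum>b\<in>{m..<n}. resum N k (j * b)\<bar> \<le> 2 * (1 + ln (real q)) / real d"
    using d by (simp add: abs_divide divide_right_mono)
  also have "\<dots> \<le> 2 * (1 + ln (real q)) / 1" using d q by (intro divide_left_mono) auto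
  also have "\<dots> \<le> 2 * (1 + ln (real k))" using d q by (simp add: pq)
  finally show ?thesis .
qed

text \<open>The share of the singularity a / b = j / k in the sum of cot(pi a k / b) over all 0 < a
  < b, with no cut at \<alpha>.\<close>

definition fullcell :: "nat \<Rightarrow> nat \<Rightarrow> nat \<Rightarrow> real" where
  "fullcell k b j = (\<Sum>a\<in>{0<..<b}. cotcell (real a * real k / real b - real j))"

text \<open>Up to b / 2 a cell value is b / (pi x) plus the decreasing \<open>A\<close>. Past b / 2,
  \<open>A\<close> is frozen at its end value - 2 / pi and \<open>B\<close> removes the rest of the
  reciprocal. Both remain decreasing with values between - 2 / pi and 0, so each interlaced sum is
  at most 2 / pi and the cutoff causes no extra loss.\<close>

lemma sum_cotcell_interlaced:
  fixes b N :: nat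
  assumes b: "b > 0" and uv: "0 < u" "0 < v" "\<bar>u - v\<bar> \<le> k"
  shows "\<bar>(\<Sum>i<N. cotcell ((u + real i * k) / real b) - cotcell ((v + real i * k) / real b))
     - real b / pi * (\<Sum>i<N. 1 / (u + real i * k) - 1 / (v + real i * k))\<bar> \<le> 2"
proof -
  define A where "A = (\<lambda>x. if 2 * x \<le> real b then cot (pi * (x / real b)) - 1 / (pi * (x / real b)) else - 2 / pi)"
  define B where "B = (\<lambda>x. if 2 * x \<le> real b then 0 else 1 / (pi * (x / real b)) - 2 / pi)"
  have k: "0 \<le> k" using uv by linarith
  have quad: "0 < pi * (x / real b)" "pi * (x / real b) \<le> pi / 2" if "0 < x" "2 * x \<le> real b" for x
    using first_quadrant_pi[of "x / real b"] that b by (auto simp: field_simps)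
  have A_lo: "- 2 / pi \<le> A x" if "0 < x" for x
  proof (cases "2 * x \<le> real b")
    case True
    have "cot (pi / 2) - 1 / (pi / 2) \<le> cot (pi * (x / real b)) - 1 / (pi * (x / real b))"
      using quad[OF that True] by (intro cot_minus_inverse_antimono) auto
    then show ?thesis using True by (simp add: A_def cot_def)
  qed (simp add: A_def)
  have A_hi: "A x \<le> 0" if "0 < x" for x
    using cot_le_inverse[OF quad[OF that]] by (simp add: A_def)
  have A_anti: "A y \<le> A x" if "0 < x" "x \<le> y" for x y
  proof (cases "2 * y \<le> real b")
    case True
    have "cot (pi * (y / real b)) - 1 / (pi * (y / real b)) \<le> cot (pi * (x / real b)) - 1 / (pi * (x / real b))"
      using quad[of x] quad[of y] that True b
      by (intro cot_minus_inverse_antimono) (auto intro!: divide_right_mono)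
    then show ?thesis using True that by (simp add: A_def)
  next
    case False
    then show ?thesis using A_lo[of x] that by (simp add: A_def)
  qed
  have B_bd: "- 2 / pi \<le> B x" "B x \<le> 0" if "0 < x" for x
  proof -
    have "1 / (pi * (x / real b)) \<le> 1 / (pi / 2)" if "\<not> 2 * x \<le> real b"
      using that \<open>0 < x\<close> b by (intro divide_left_mono) (auto simp: field_simps)
    then show "B x \<le> 0" by (simp add: B_def)
    show "- 2 / pi \<le> B x" using that b by (simp add: B_def)
  qed
  have B_anti: "B y \<le> B x" if "0 < x" "x \<le> y" for x y
  proof (cases "2 * x \<le> real b")
    case True
    then show ?thesis using B_bd[of y] that by (simp add: B_def)
  next
    case False
    have "1 / (pi * (y / real b)) \<le> 1 / (pi * (x / real b))"
      using that b by (intro divide_left_mono) (auto intro!: divide_right_mono)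
    then show ?thesis using False that by (simp add: B_def)
  qed
  have decomp: "cotcell (x / real b) = A x - B x + real b / pi * (1 / x)" if "0 < x" for x
  proof -
    have "\<bar>x / real b\<bar> \<le> 1 / 2 \<longleftrightarrow> 2 * x \<le> real b" using that b by (auto simp: field_simps)
    then show ?thesis using that b by (auto simp: cotcell_def A_def B_def)
  qed
  have pos: "0 < u + real i * k" "0 < v + real i * k" for i :: nat
    using k uv by (auto intro!: add_pos_nonneg)
  have "cotcell ((u + real i * k) / real b) - cotcell ((v + real i * k) / real b)
     - real b / pi * (1 / (u + real i * k) - 1 / (v + real i * k))
     = (A (u + real i * k) - A (v + real i * k)) - (B (u + real i * k) - B (v + real i * k))" for i :: nat
    using decomp[OF pos(1)[of i]] decomp[OF pos(2)[of i]] by (simp add: right_diff_distrib)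
  then have "(\<Sum>i<N. cotcell ((u + real i * k) / real b) - cotcell ((v + real i * k) / real b))
     - real b / pi * (\<Sum>i<N. 1 / (u + real i * k) - 1 / (v + real i * k))
     = (\<Sum>i<N. A (u + real i * k) - A (v + real i * k)) - (\<Sum>i<N. B (u + real i * k) - B (v + real i * k))"
    by (simp only: sum_distrib_left sum_subtractf[symmetric])
  moreover have "\<bar>\<Sum>i<N. A (u + real i * k) - A (v + real i * k)\<bar> \<le> 2 / pi"
  proof -
    have m: "0 < min u v" "0 < min u v + real N * k" using uv k by (auto intro!: add_pos_nonneg)
    show ?thesis using abs_sum_interlaced_antimono_le[where f = A, OF A_anti uv, of N] A_lo[OF m(2)] A_hi[OF m(1)]
      by simp
  qed
  moreover have "\<bar>\<Sum>i<N. B (u + real i * k) - B (v + real i * k)\<bar> \<le> 2 / pi"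
  proof -
    have m: "0 < min u v" "0 < min u v + real N * k" using uv k by (auto intro!: add_pos_nonneg)
    show ?thesis using abs_sum_interlaced_antimono_le[where f = B, OF B_anti uv, of N] B_bd(1)[OF m(2)] B_bd(2)[OF m(1)]
      by simp
  qed
  moreover have "2 / pi \<le> 1" using pi_gt3 by simp
  ultimately show ?thesis by linarith
qed

text \<open>The integer k a - j b runs through the class of - c mod k: upwards through k - c + i k,
  downwards through - (c + i k). As \<open>cotcell\<close> is odd, these pair into interlaced
  differences. For 1 \<le> j < k the whole cell lies inside 0 < a < b; for j = 0 it would be
  one-sided.\<close>

lemma fullcell_resum_approx:
  assumes j: "1 \<le> j" "j < k" and b: "b > 0" and N: "b \<le> N * k"
  shows "\<bar>fullcell k b j - real b / pi * resum N k (j * b)\<bar> \<le> 2"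
proof -
  define F where "F = (\<lambda>z::int. cotcell (of_int z / real b))"
  define q c where "q = j * b div k" and "c = j * b mod k"
  have qc: "j * b = k * q + c" "c < k" using j by (auto simp: q_def c_def)
  have qc': "int j * int b = int k * int q + int c" using qc(1) by (metis of_nat_add of_nat_mult)
  define g where "g = (\<lambda>a::int. F (int k * a - int j * int b))"
  have N0: "N > 0" using N b by (cases N) auto
  \<comment> \<open>A nonzero value needs |k a - j b| \<le> b / 2. This forces 0 < a < b, and with
    \<open>b \<le> N * k\<close> also that a lies in the window of N integers on each side of j b /
    k, so the two ranges are interchangeable.\<close>
  have supp: "g a = 0" if "a \<notin> {0<..<int b} \<or> a \<notin> {int q + 1 - int N..int q + int N}" for a
  proof -
    have "\<not> (2 * \<bar>int k * a - int j * int b\<bar> \<le> int b)"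
    proof
      assume abs_le: "2 * \<bar>int k * a - int j * int b\<bar> \<le> int b"
      have le: "2 * (int k * a - int j * int b) \<le> int b" "- int b \<le> 2 * (int k * a - int j * int b)"
        using abs_le abs_ge_self[of "int k * a - int j * int b"] abs_ge_minus_self[of "int k * a - int j * int b"]
        by (smt (verit))+
      have b': "int b > 0" using b by simp
      have jb: "int b \<le> int j * int b" using j b by simp
      have "(int j + 1) * int b \<le> int k * int b" using j by (intro mult_right_mono) auto
      then have jb2: "int j * int b + int b \<le> int k * int b" by (simp add: algebra_simps)
      have "int k * a > 0" using le jb b' by (smt (verit))
      then have 1: "a > 0" using j by (simp add: zero_less_mult_iff)
      have "int k * a < int k * int b" using le jb2 b' by (smt (verit))
      then have 2: "a < int b" using j by simp
      have Nk: "int b \<le> int N * int k" using N by (metis of_nat_le_iff of_nat_mult)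
      have kN: "int N * int k > 0" using N0 j by simp
      have d: "int k * a - int j * int b = int k * (a - int q) - int c" using qc' by (simp add: algebra_simps)
      have "int k * (a - int q) < int k * (int N + 1)"
        using le d Nk qc(2) kN by (simp add: algebra_simps)
      then have 3: "a - int q < int N + 1" using j by (subst (asm) mult_less_cancel_left_pos) auto
      have "int k * (- int N) < int k * (a - int q)"
        using le d Nk kN by (simp add: algebra_simps)
      then have 4: "- int N < a - int q" using j by (subst (asm) mult_less_cancel_left_pos) auto
      show False using that 1 2 3 4 by auto
    qed
    then have "2 * \<bar>real_of_int (int k * a - int j * int b)\<bar> > real b"
      by linarith
    then have "\<bar>of_int (int k * a - int j * int b) / real b\<bar> > 1 / 2" using b by (simp add: field_simps)
    then show ?thesis unfolding g_def F_def by (rule cotcell_eq_0)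
  qed
  have "fullcell k b j = (\<Sum>a\<in>{0<..<b}. g (int a))"
    unfolding fullcell_def g_def F_def using b by (intro sum.cong refl arg_cong[of _ _ cotcell]) (simp add: field_simps)
  also have "\<dots> = (\<Sum>a\<in>{0<..<int b}. g a)"
    by (rule sum.reindex_bij_witness[of _ nat int]) auto
  also have "\<dots> = (\<Sum>a\<in>{int q + 1 - int N..int q + int N}. g a)"
    by (rule sum.mono_neutral_cong) (use supp in auto)
  also have "{int q + 1 - int N..int q + int N} = {int q + 1..int q + int N} \<union> {int q + 1 - int N..int q}"
    using N0 by auto
  also have "(\<Sum>a\<in>\<dots>. g a) = (\<Sum>a\<in>{int q + 1..int q + int N}. g a) + (\<Sum>a\<in>{int q + 1 - int N..int q}. g a)"
    by (intro sum.union_disjoint) auto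
  also have "(\<Sum>a\<in>{int q + 1..int q + int N}. g a) = (\<Sum>i<N. g (int q + 1 + int i))"
    by (rule sum.reindex_bij_witness[of _ "\<lambda>i. int q + 1 + int i" "\<lambda>a. nat (a - int q - 1)"]) auto
  also have "(\<Sum>a\<in>{int q + 1 - int N..int q}. g a) = (\<Sum>i<N. g (int q - int i))"
    by (rule sum.reindex_bij_witness[of _ "\<lambda>i. int q - int i" "\<lambda>a. nat (int q - a)"]) auto
  also have "(\<Sum>i<N. g (int q + 1 + int i)) + (\<Sum>i<N. g (int q - int i))
     = (\<Sum>i<N. cotcell ((real (k - c) + real i * real k) / real b) - cotcell ((real c + real i * real k) / real b))"
  proof -
    have e: "int k * (int q + 1 + int i) - int j * int b = int (k - c) + int i * int k" for i
      using qc' qc(2) by (simp add: algebra_simps of_nat_diff)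
    have 1: "g (int q + 1 + int i) = cotcell ((real (k - c) + real i * real k) / real b)" for i
      unfolding g_def F_def e by simp
    have e': "int k * (int q - int i) - int j * int b = - (int c + int i * int k)" for i
      using qc' by (simp add: algebra_simps)
    have 2: "g (int q - int i) = - cotcell ((real c + real i * real k) / real b)" for i
      unfolding g_def F_def e' cotcell_minus[symmetric] by (simp add: minus_divide_left)
    show ?thesis by (simp add: 1 2 sum_subtractf sum_negf)
  qed
  finally have eq: "fullcell k b j = (\<Sum>i<N. cotcell ((real (k - c) + real i * real k) / real b)
      - cotcell ((real c + real i * real k) / real b))" .
  show ?thesis
  \<comment> \<open>If k divides j b, the reciprocal 1 / c is meaningless, but the two sides of the
    pole cancel and leave a telescoping sum of value 0.\<close>
  proof (cases "c = 0")
    case True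
    have "fullcell k b j = (\<Sum>i<N. cotcell (real (Suc i) * real k / real b) - cotcell (real i * real k / real b))"
      unfolding eq True by (simp add: algebra_simps)
    also have "\<dots> = cotcell (real N * real k / real b) - cotcell (real 0 * real k / real b)"
      by (rule sum_lessThan_telescope)
    also have "\<dots> = 0"
    proof -
      have "real b \<le> real N * real k" using N by (metis of_nat_le_iff of_nat_mult)
      then have "\<bar>real N * real k / real b\<bar> > 1 / 2" using b by (simp add: field_simps)
      then show ?thesis by (simp add: cotcell_eq_0)
    qed
    finally show ?thesis using True by (simp add: resum_def c_def)
  next
    case False
    have r: "resum N k (j * b) = (\<Sum>i<N. 1 / (real (k - c) + real i * real k) - 1 / (real c + real i * real k))"
      using False by (simp add: resum_def c_def)
    show ?thesis unfolding eq r
      by (rule sum_cotcell_interlaced[OF b]) (use False qc(2) in auto)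
  qed
qed


section \<open>The cost of cutting the sum over a at \<alpha>\<close>

lemma sum_inverse_sqrt_le: "(\<Sum>i=1..n. 1 / sqrt (real i)) \<le> 2 * sqrt (real n)"
proof (induction n)
  case (Suc n)
  define x y where "x = sqrt (real n)" and "y = sqrt (real (Suc n))"
  have xy: "0 \<le> x" "x < y" "y\<^sup>2 - x\<^sup>2 = 1" by (auto simp: x_def y_def)
  have "1 = (y - x) * (y + x)" using xy(3) by (simp add: power2_eq_square algebra_simps)
  also have "\<dots> \<le> (y - x) * (2 * y)" using xy by (intro mult_left_mono) auto
  finally have "1 / y \<le> 2 * (y - x)" using xy by (simp add: field_simps)
  then show ?case using Suc by (simp add: x_def y_def)
qed simp

text \<open>At t \<ge> \<eta> one has 1 / t \<le> 1 / sqrt(\<eta> t): half of the decay is traded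
  for the integrable power of \<eta>. The common residue makes \<open>u div k\<close> injective on
  the active points, so the remaining sum is one of inverse square roots with spacing k.\<close>

lemma sum_cotcell_tail_le:
  fixes U :: "nat set" and b k :: nat
  assumes fin: "finite U" and k: "k > 0" and b: "b > 0" and eta: "\<eta> > 0"
    and U: "\<And>u. u \<in> U \<Longrightarrow> 0 < u \<and> \<eta> * real b \<le> real u"
    and cong: "\<And>u v. u \<in> U \<Longrightarrow> v \<in> U \<Longrightarrow> u mod k = v mod k"
  shows "(\<Sum>u\<in>U. \<bar>cotcell (real u / real b)\<bar>) \<le> (sqrt (real b) + 2 * real b / real k) / sqrt \<eta>"
proof -
  \<comment> \<open>The block \<open>u div k = 0\<close> holds at most one point, about which only u
    \<ge> 1 is used.\<close>
  define g where "g = (\<lambda>i::nat. if i = 0 then 1 else 1 / sqrt (real k * real i))"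
  define V where "V = {u\<in>U. 2 * u \<le> b}"
  have V: "finite V" "V \<subseteq> U" using fin by (auto simp: V_def)
  have inj: "inj_on (\<lambda>u. u div k) V"
  proof (rule inj_onI)
    fix u v assume "u \<in> V" "v \<in> V" "u div k = v div k"
    then show "u = v" using cong V(2) by (metis div_mult_mod_eq subsetD)
  qed
  have term_le: "\<bar>cotcell (real u / real b)\<bar> \<le> sqrt (real b) / sqrt \<eta> * g (u div k)" if "u \<in> U" for u
  proof -
    have u: "u > 0" "\<eta> * real b \<le> real u" using U that by auto
    define x where "x = sqrt (real b / real u)"
    have "\<bar>cotcell (real u / real b)\<bar> \<le> 1 / (pi * (real u / real b))"
      using u b by (intro abs_cotcell_le) auto
    also have "\<dots> = real b / real u / pi" by simp
    also have "\<dots> \<le> real b / real u / 1" using pi_gt3 u by (intro divide_left_mono) auto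
    also have "\<dots> = x * x" using u b by (simp add: x_def)
    also have "\<dots> \<le> sqrt (1 / \<eta>) * x"
    proof (rule mult_right_mono)
      have "real b / real u \<le> 1 / \<eta>" using u eta by (simp add: field_simps)
      then show "x \<le> sqrt (1 / \<eta>)" by (simp add: x_def)
    qed (simp add: x_def)
    also have "\<dots> = sqrt (real b) / sqrt \<eta> * (1 / sqrt (real u))"
      by (simp add: x_def real_sqrt_divide)
    also have "\<dots> \<le> sqrt (real b) / sqrt \<eta> * g (u div k)"
    proof (rule mult_left_mono)
      show "1 / sqrt (real u) \<le> g (u div k)"
      proof (cases "u div k = 0")
        case False
        have "k * (u div k) \<le> u" by simp
        then have "real k * real (u div k) \<le> real u" by (metis of_nat_le_iff of_nat_mult)
        moreover have "0 < real k * real (u div k)" using False k by simp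
        ultimately have "1 / sqrt (real u) \<le> 1 / sqrt (real k * real (u div k))"
          using u k False by (intro divide_left_mono real_sqrt_le_mono mult_pos_pos real_sqrt_gt_zero) auto
        then show ?thesis using False by (simp add: g_def)
      qed (use u in \<open>simp add: g_def\<close>)
    qed (use eta in auto)
    finally show ?thesis .
  qed
  have "(\<Sum>u\<in>U. \<bar>cotcell (real u / real b)\<bar>) = (\<Sum>u\<in>V. \<bar>cotcell (real u / real b)\<bar>)"
  proof (rule sum.mono_neutral_right)
    show "\<forall>u\<in>U - V. \<bar>cotcell (real u / real b)\<bar> = 0"
    proof
      fix u assume "u \<in> U - V"
      then have "\<bar>real u / real b\<bar> > 1 / 2" using b by (auto simp: V_def field_simps)
      then show "\<bar>cotcell (real u / real b)\<bar> = 0" by (simp add: cotcell_eq_0)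
    qed
  qed (use fin V in auto)
  also have "\<dots> \<le> (\<Sum>u\<in>V. sqrt (real b) / sqrt \<eta> * g (u div k))"
    using term_le V by (intro sum_mono) auto
  also have "\<dots> = sqrt (real b) / sqrt \<eta> * (\<Sum>i\<in>(\<lambda>u. u div k) ` V. g i)"
    by (simp add: sum.reindex[OF inj] sum_distrib_left)
  also have "\<dots> \<le> sqrt (real b) / sqrt \<eta> * (\<Sum>i\<le>b div k. g i)"
    using eta by (intro mult_left_mono sum_mono2) (auto simp: g_def V_def intro!: div_le_mono)
  also have "(\<Sum>i\<le>b div k. g i) = 1 + (\<Sum>i=1..b div k. 1 / sqrt (real k * real i))"
  proof -
    have "{..b div k} = insert 0 {1..b div k}" by auto
    then show ?thesis by (simp add: g_def)
  qed
  also have "(\<Sum>i=1..b div k. 1 / sqrt (real k * real i)) = (\<Sum>i=1..b div k. 1 / sqrt (real i)) / sqrt (real k)"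
    by (simp add: real_sqrt_mult sum_divide_distrib mult.commute)
  also have "\<dots> \<le> 2 * sqrt (real (b div k)) / sqrt (real k)"
    by (intro divide_right_mono sum_inverse_sqrt_le) auto
  also have "\<dots> \<le> 2 * sqrt (real b / real k) / sqrt (real k)"
    using of_nat_div_le_of_nat[of b k, where 'a = real] by (intro divide_right_mono mult_left_mono) auto
  also have "\<dots> = 2 * sqrt (real b) / real k"
    using k by (simp add: real_sqrt_divide)
  also have "sqrt (real b) / sqrt \<eta> * (1 + 2 * sqrt (real b) / real k)
     = (sqrt (real b) + 2 * real b / real k) / sqrt \<eta>"
    by (simp add: field_simps)
  finally show ?thesis using eta by (simp add: mult_left_mono divide_right_mono)
qed


definition dist_int :: "real \<Rightarrow> real" where
  "dist_int x = min (frac x) (1 - frac x)"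

lemma dist_int_pos: "x \<notin> \<int> \<Longrightarrow> 0 < dist_int x"
  using frac_lt_1[of x] frac_gt_0_iff[of x] by (simp add: dist_int_def)

text \<open>With J the floor of k \<alpha>, the cells j < J lie entirely below the cut and the cells
  j > J + 1 entirely above it. Cell J lacks only points above the cut and cell J + 1 keeps only
  points below it. All of these are at least \<open>dist_int (real k * \<alpha>)\<close> away from
  their pole, so the tail bound is applied twice.\<close>

lemma sum_cot_below_approx:
  fixes k b :: nat and \<alpha> :: real
  assumes al: "0 < \<alpha>" "\<alpha> < 1" and irr: "real k * \<alpha> \<notin> \<int>" and k: "k > 0" and b: "b > 0"
  shows "\<bar>(\<Sum>a | 0 < a \<and> real a < \<alpha> * real b. cot (pi * (real a * real k / real b)))
      - (\<Sum>j\<le>nat \<lfloor>real k * \<alpha>\<rfloor>. fullcell k b j)\<bar>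
      \<le> 2 * ((sqrt (real b) + 2 * real b / real k) / sqrt (dist_int (real k * \<alpha>)))"
proof -
  define \<theta> where "\<theta> = dist_int (real k * \<alpha>)"
  define J where "J = nat \<lfloor>real k * \<alpha>\<rfloor>"
  define e where "e = (sqrt (real b) + 2 * real b / real k) / sqrt \<theta>"
  have th: "\<theta> > 0" using dist_int_pos[OF irr] by (simp add: \<theta>_def)
  have "0 \<le> real k * \<alpha>" using al by simp
  then have J: "real k * \<alpha> = real J + frac (real k * \<alpha>)"
    by (simp add: J_def frac_def)
  have J1: "real J + \<theta> \<le> real k * \<alpha>" "real k * \<alpha> \<le> real (Suc J) - \<theta>"
    unfolding \<theta>_def dist_int_def using J by auto
  have "real k * \<alpha> < real k * 1" using al k by (intro mult_strict_left_mono) auto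
  then have "real J < real k" using J1 th by linarith
  then have Jk: "J < k" by simp
  define A where "A = {a. 0 < a \<and> real a < \<alpha> * real b}"
  define B where "B = {a\<in>{0<..<b}. \<not> real a < \<alpha> * real b}"
  have ab: "\<alpha> * real b < 1 * real b" using al b by (intro mult_strict_right_mono) auto
  have A_sub: "A \<subseteq> {0<..<b}" using ab by (auto simp: A_def)
  have finA: "finite A" using A_sub finite_subset by blast
  have finB: "finite B" by (auto simp: B_def)
  define t where "t = (\<lambda>a j. cotcell (real a * real k / real b - real j))"
  define S where "S = (\<lambda>j. \<Sum>a\<in>A. t a j)"
  have X: "(\<Sum>a\<in>A. cot (pi * (real a * real k / real b))) = (\<Sum>j\<le>k. S j)"
  proof -
    have "cot (pi * (real a * real k / real b)) = (\<Sum>j\<le>k. t a j)" if "a \<in> A" for a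
      unfolding t_def
    proof (rule cot_pi_eq_sum_cotcell)
      have "a < b" using that A_sub by auto
      then have "real a * real k < real b * real k" using k by simp
      then show "real a * real k / real b < real k" using b by (simp add: divide_less_eq mult.commute)
    qed simp
    then have "(\<Sum>a\<in>A. cot (pi * (real a * real k / real b))) = (\<Sum>a\<in>A. \<Sum>j\<le>k. t a j)" by simp
    then show ?thesis unfolding S_def by (subst (asm) sum.swap)
  qed
  have below: "real a * real k / real b < real k * \<alpha>" if "a \<in> A" for a
  proof -
    have "real a * real k < \<alpha> * real b * real k" using that k by (auto simp: A_def)
    then show ?thesis using b by (simp add: divide_less_eq mult_ac)
  qed
  have above: "real k * \<alpha> \<le> real a * real k / real b" if "a \<in> B" for a
  proof -
    have "\<alpha> * real b * real k \<le> real a * real k" using that by (auto simp: B_def intro!: mult_right_mono)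
    then show ?thesis using b by (simp add: le_divide_eq mult_ac)
  qed
  have S_far: "S j = 0" if "Suc (Suc J) \<le> j" for j
    unfolding S_def
  proof (rule sum.neutral, rule ballI)
    fix a assume "a \<in> A"
    from below[OF this] J1 th that have "real a * real k / real b - real j < - (1/2)" by auto
    then show "t a j = 0" unfolding t_def by (intro cotcell_eq_0) auto
  qed
  have full: "fullcell k b j = S j + (\<Sum>a\<in>B. t a j)" for j
  proof -
    have "{0<..<b} = A \<union> B" using A_sub by (auto simp: A_def B_def)
    moreover have "A \<inter> B = {}" by (auto simp: A_def B_def)
    ultimately show ?thesis unfolding fullcell_def S_def t_def using finA finB
      by (simp add: sum.union_disjoint)
  qed
  have S_near: "fullcell k b j = S j" if "j < J" for j
  proof -
    have "(\<Sum>a\<in>B. t a j) = 0"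
    proof (rule sum.neutral, rule ballI)
      fix a assume "a \<in> B"
      have "real j + 1 \<le> real J" using that by linarith
      then have "real a * real k / real b - real j > 1/2" using above[OF \<open>a \<in> B\<close>] J1 th by linarith
      then show "t a j = 0" unfolding t_def by (intro cotcell_eq_0) linarith
    qed
    then show ?thesis using full by simp
  qed
  \<comment> \<open>Here \<open>s\<close> selects the side of the pole, and \<open>h a\<close> is |k
    a - j b|, whose residue mod k does not depend on a.\<close>
  have tail: "(\<Sum>a\<in>C. \<bar>t a j\<bar>) \<le> e"
    if fin: "finite C" and sgn: "s = 1 \<or> s = -1"
      and lb: "\<And>a. a \<in> C \<Longrightarrow> \<theta> \<le> of_int s * (real a * real k / real b - real j)" for C s j
  proof -
    define h where "h = (\<lambda>a::nat. nat (s * (int a * int k - int j * int b)))"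
    have h: "int (h a) = s * (int a * int k - int j * int b)" "0 < h a" "\<theta> * real b \<le> real (h a)" if "a \<in> C" for a
    proof -
      have "\<theta> * real b \<le> of_int s * (real a * real k / real b - real j) * real b"
        using lb[OF that] by (intro mult_right_mono) auto
      also have "\<dots> = of_int (s * (int a * int k - int j * int b))" using b by (simp add: field_simps)
      finally have le: "\<theta> * real b \<le> of_int (s * (int a * int k - int j * int b))" .
      moreover have "0 < \<theta> * real b" using th b by simp
      ultimately have "0 < real_of_int (s * (int a * int k - int j * int b))" by linarith
      then have p: "0 < s * (int a * int k - int j * int b)" by (simp only: of_int_0_less_iff)
      then show 1: "int (h a) = s * (int a * int k - int j * int b)" by (simp add: h_def)
      show "0 < h a" using p by (simp add: h_def)
      show "\<theta> * real b \<le> real (h a)" using le unfolding 1[symmetric] by simp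
    qed
    have inj: "inj_on h C"
    proof (rule inj_onI)
      fix x y assume xy: "x \<in> C" "y \<in> C" "h x = h y"
      have "s * (int x * int k - int j * int b) = s * (int y * int k - int j * int b)"
        unfolding h(1)[OF xy(1), symmetric] h(1)[OF xy(2), symmetric] xy(3) ..
      then have "int x * int k = int y * int k" using sgn by auto
      then show "x = y" using k by simp
    qed
    have cong: "h x mod k = h y mod k" if "x \<in> C" "y \<in> C" for x y
    proof -
      have "int (h x) - int (h y) = int k * (s * (int x - int y))"
        unfolding h(1)[OF that(1)] h(1)[OF that(2)] by (simp add: algebra_simps)
      then have "int k dvd int (h x) - int (h y)" by (rule dvdI)
      then have "int (h x) mod int k = int (h y) mod int k" by (simp only: mod_eq_dvd_iff)
      then have "int (h x mod k) = int (h y mod k)" by (simp only: zmod_int)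
      then show ?thesis by (simp only: of_nat_eq_iff)
    qed
    have abs_t: "\<bar>t a j\<bar> = \<bar>cotcell (real (h a) / real b)\<bar>" if "a \<in> C" for a
    proof -
      have "real (h a) = of_int s * (real a * real k - real j * real b)"
        using arg_cong[OF h(1)[OF that], of real_of_int] by simp
      then have q: "real (h a) / real b = of_int s * (real a * real k / real b - real j)"
        using b by (simp add: right_diff_distrib diff_divide_distrib)
      have "cotcell (real (h a) / real b) = of_int s * t a j"
        unfolding q t_def using sgn by (elim disjE) (simp_all only: of_int_1 of_int_minus mult_minus_left mult_1 cotcell_minus)
      then show ?thesis using sgn by (elim disjE) (simp_all only: of_int_1 of_int_minus mult_minus_left mult_1 abs_minus_cancel)
    qed
    have "(\<Sum>a\<in>C. \<bar>t a j\<bar>) = (\<Sum>u\<in>h ` C. \<bar>cotcell (real u / real b)\<bar>)"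
      unfolding sum.reindex[OF inj] by (rule sum.cong) (simp_all only: abs_t o_def)
    also have "\<dots> \<le> e" unfolding e_def
    proof (rule sum_cotcell_tail_le[OF _ k b th])
      show "u mod k = v mod k" if uv: "u \<in> h ` C" "v \<in> h ` C" for u v
      proof -
        obtain x y where xy: "u = h x" "x \<in> C" "v = h y" "y \<in> C" using uv by blast
        show ?thesis unfolding xy(1,3) by (rule cong[OF xy(2,4)])
      qed
    qed (use fin h in auto)
    finally show ?thesis .
  qed
  have 1: "\<bar>\<Sum>a\<in>B. t a J\<bar> \<le> e"
  proof -
    have "(\<Sum>a\<in>B. \<bar>t a J\<bar>) \<le> e"
    proof (rule tail[OF finB, of 1])
      fix a assume "a \<in> B"
      from above[OF this] J1 show "\<theta> \<le> of_int 1 * (real a * real k / real b - real J)" by simp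
    qed simp
    then show ?thesis using sum_abs[of "\<lambda>a. t a J" B] by linarith
  qed
  have 2: "\<bar>S (Suc J)\<bar> \<le> e"
  proof -
    have "(\<Sum>a\<in>A. \<bar>t a (Suc J)\<bar>) \<le> e"
    proof (rule tail[OF finA, of "- 1"])
      fix a assume "a \<in> A"
      from below[OF this] J1 show "\<theta> \<le> of_int (- 1) * (real a * real k / real b - real (Suc J))" by simp
    qed simp
    then show ?thesis using sum_abs[of "\<lambda>a. t a (Suc J)" A] unfolding S_def by linarith
  qed
  have "(\<Sum>j\<le>k. S j) = (\<Sum>j\<le>Suc J. S j)"
    using Jk S_far by (intro sum.mono_neutral_right) auto
  also have "\<dots> = (\<Sum>j<J. S j) + S J + S (Suc J)"
    by (simp add: lessThan_Suc_atMost[symmetric])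
  also have "(\<Sum>j<J. S j) = (\<Sum>j<J. fullcell k b j)" by (simp add: S_near)
  also have "S J = fullcell k b J - (\<Sum>a\<in>B. t a J)" using full[of J] by simp
  finally have "(\<Sum>j\<le>k. S j) - (\<Sum>j\<le>J. fullcell k b j) = S (Suc J) - (\<Sum>a\<in>B. t a J)"
    by (simp add: lessThan_Suc_atMost[symmetric])
  then show ?thesis using 1 2 unfolding X[unfolded A_def] J_def[symmetric] \<theta>_def[symmetric] e_def[symmetric]
    by linarith
qed

text \<open>Only positive a occur at the pole 0, so nothing cancels and a harmonic sum up to n = b
  div (2 k), the end of the cell, remains. One b / k of the error comes from cot x - 1 / x, the
  other from comparing the harmonic sum with ln(b / k).\<close>

lemma fullcell_0_approx:
  fixes k b :: nat
  assumes k: "k > 0" "2 * k < b"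
  shows "\<bar>fullcell k b 0 - real b / (pi * real k) * ln (real b / real k)\<bar> \<le> 2 * (real b / real k)"
proof -
  define n where "n = b div (2 * k)"
  have le_n: "a \<le> n \<longleftrightarrow> a * (2 * k) \<le> b" for a
    unfolding n_def by (rule less_eq_div_iff_mult_less_eq) (use k in simp)
  have n1: "1 \<le> n" unfolding le_n using k by linarith
  have nle: "real n \<le> real b / (2 * real k)" using of_nat_div_le_of_nat[of b "2 * k", where 'a = real] unfolding n_def[symmetric] by simp
  have nge: "real b / (2 * real k) \<le> real n + 1"
  proof -
    have "b < (n + 1) * (2 * k)" using le_n[of "n + 1"] by linarith
    then have "real b < real ((n + 1) * (2 * k))" by (simp only: of_nat_less_iff)
    then have "real b \<le> (real n + 1) * (2 * real k)" by (simp add: distrib_right)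
    then show ?thesis using k by (simp add: divide_le_eq)
  qed
  have b: "b > 0" using k by simp
  have nb: "n < b" unfolding n_def by (rule div_less_dividend) (use k in auto)
  define x where "x = (\<lambda>a::nat. pi * (real a * real k / real b))"
  have small: "real a * real k / real b \<le> 1 / 2 \<longleftrightarrow> a \<le> n" for a
  proof -
    have "real a * real k / real b \<le> 1 / 2 \<longleftrightarrow> real (a * (2 * k)) \<le> real b" using b by (simp add: field_simps)
    also have "\<dots> \<longleftrightarrow> a \<le> n" unfolding of_nat_le_iff le_n ..
    finally show ?thesis .
  qed
  have "fullcell k b 0 = (\<Sum>a=1..n. cot (x a))"
    unfolding fullcell_def
  proof (rule sum.mono_neutral_cong_right)
    show "\<forall>i\<in>{0<..<b} - {1..n}. cotcell (real i * real k / real b - real 0) = 0"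
    proof
      fix i assume i: "i \<in> {0<..<b} - {1..n}"
      then have "1 / 2 < real i * real k / real b" using small[of i] by auto
      then show "cotcell (real i * real k / real b - real 0) = 0" by (intro cotcell_eq_0) simp
    qed
    show "cotcell (real i * real k / real b - real 0) = cot (x i)" if "i \<in> {1..n}" for i
      using that small[of i] by (simp add: cotcell_def x_def)
  qed (use nb in auto)
  also have "\<dots> = (\<Sum>a=1..n. 1 / x a) + (\<Sum>a=1..n. cot (x a) - 1 / x a)"
    by (simp add: sum_subtractf)
  also have "(\<Sum>a=1..n. 1 / x a) = real b / (pi * real k) * (\<Sum>a=1..n. 1 / real a)"
    by (simp add: sum_distrib_left x_def mult_ac)
  finally have eq: "fullcell k b 0 = real b / (pi * real k) * (\<Sum>a=1..n. 1 / real a) + (\<Sum>a=1..n. cot (x a) - 1 / x a)" .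
  have "\<bar>cot (x a) - 1 / x a\<bar> \<le> 2" if "a \<in> {1..n}" for a
  proof -
    have "0 < real a * real k / real b" "real a * real k / real b \<le> 1 / 2"
      using that small[of a] k b by auto
    then have xa: "0 < x a" "x a \<le> pi / 2" using first_quadrant_pi unfolding x_def by blast+
    have "x a \<le> 2" using xa pi_less_4 by linarith
    then show ?thesis using cot_le_inverse[OF xa] cot_ge_inverse_minus[OF xa] by linarith
  qed
  then have "(\<Sum>a=1..n. \<bar>cot (x a) - 1 / x a\<bar>) \<le> (\<Sum>a=1..n. 2)" by (rule sum_mono)
  then have "\<bar>\<Sum>a=1..n. cot (x a) - 1 / x a\<bar> \<le> (\<Sum>a=1..n. 2)" by (rule order_trans[OF sum_abs])
  also have "\<dots> = 2 * real n" by simp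
  also have "\<dots> \<le> real b / real k" using nle by simp
  finally have E: "\<bar>\<Sum>a=1..n. cot (x a) - 1 / x a\<bar> \<le> real b / real k" .
  have ln2: "ln 2 \<le> (1::real)" using ln_le_minus_one[of "2::real"] by simp
  have kb: "0 < real b / real k" using k b by simp
  have "(\<Sum>a=1..n. 1 / real a) \<le> 1 + ln (real n)" using n1 by (intro sum_inverse_le_ln) simp
  moreover have "ln (real n) \<le> ln (real b / real k)"
  proof (rule ln_mono)
    have "real b / (2 * real k) = real b / real k / 2" by simp
    then show "real n \<le> real b / real k" using nle kb by linarith
  qed (use n1 in simp)
  ultimately have up: "(\<Sum>a=1..n. 1 / real a) \<le> ln (real b / real k) + 1" by linarith
  have "ln (real b / (2 * real k)) = ln (real b / real k / 2)" by (simp add: mult.commute)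
  also have "\<dots> = ln (real b / real k) - ln 2" using kb by (subst ln_div) (use k b in auto)
  finally have "ln (real b / real k) - ln 2 = ln (real b / (2 * real k))" ..
  also have "\<dots> \<le> ln (real n + 1)" using nge k b by (intro ln_mono) auto
  also have "\<dots> \<le> (\<Sum>a=1..n. 1 / real a)"
    using ln_le_harm[of n] by (simp add: harm_def inverse_eq_divide)
  finally have "\<bar>(\<Sum>a=1..n. 1 / real a) - ln (real b / real k)\<bar> \<le> 1" using up ln2 by linarith
  then have "real b / (pi * real k) * \<bar>(\<Sum>a=1..n. 1 / real a) - ln (real b / real k)\<bar> \<le> real b / (pi * real k) * 1"
    by (intro mult_left_mono) auto
  also have "\<dots> \<le> real b / real k"
  proof -
    have "real b / (pi * real k) = real b / real k / pi" by simp
    also have "\<dots> \<le> real b / real k / 1" using pi_gt3 by (intro divide_left_mono) auto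
    finally show ?thesis by simp
  qed
  finally have "\<bar>real b / (pi * real k) * (\<Sum>a=1..n. 1 / real a) - real b / (pi * real k) * ln (real b / real k)\<bar> \<le> real b / real k"
    unfolding right_diff_distrib[symmetric] abs_mult by simp
  moreover have "\<bar>y - z\<bar> \<le> c \<Longrightarrow> \<bar>d\<bar> \<le> c \<Longrightarrow> \<bar>y + d - z\<bar> \<le> 2 * c" for y z d c :: real by linarith
  ultimately show ?thesis using E unfolding eq by blast
qed

section \<open>Sums over denominators\<close>

text \<open>Abel summation from the right: the tail sums of g are weighted by f m and the
  nonnegative increments of f, which add up to f n.\<close>

lemma abs_sum_mult_mono_le:
  fixes f g :: "nat \<Rightarrow> real"
  assumes mn: "m \<le> n"
    and mono: "\<And>i j. m \<le> i \<Longrightarrow> i \<le> j \<Longrightarrow> j \<le> n \<Longrightarrow> f i \<le> f j"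
    and nonneg: "0 \<le> f m"
    and bd: "\<And>l. \<bar>\<Sum>b\<in>{l..n}. g b\<bar> \<le> P"
  shows "\<bar>\<Sum>b\<in>{m..n}. f b * g b\<bar> \<le> P * f n"
proof -
  have "\<bar>(\<Sum>b\<in>{l..n}. f b * g b) - f l * (\<Sum>b\<in>{l..n}. g b)\<bar> \<le> P * (f n - f l)" if "m \<le> l" "l \<le> n" for l
    using that(2) that(1)
  proof (induction rule: inc_induct)
    case (step l)
    define G where "G = (\<Sum>b\<in>{Suc l..n}. g b)"
    define E where "E = (\<Sum>b\<in>{Suc l..n}. f b * g b)"
    have split: "{l..n} = insert l {Suc l..n}" using step by auto
    have s: "(\<Sum>b\<in>{l..n}. g b) = g l + G" "(\<Sum>b\<in>{l..n}. f b * g b) = f l * g l + E"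
      unfolding split by (simp_all add: G_def E_def)
    have d: "0 \<le> f (Suc l) - f l" using mono[of l "Suc l"] step by simp
    have "(f l * g l + E) - f l * (g l + G) = (E - f (Suc l) * G) + (f (Suc l) - f l) * G"
      by (simp add: algebra_simps)
    moreover have "\<bar>E - f (Suc l) * G\<bar> \<le> P * (f n - f (Suc l))"
      using step by (simp add: E_def G_def)
    moreover have "\<bar>(f (Suc l) - f l) * G\<bar> \<le> (f (Suc l) - f l) * P"
      unfolding abs_mult using d bd[of "Suc l"] by (simp add: G_def mult_left_mono)
    moreover have "P * (f n - f (Suc l)) + (f (Suc l) - f l) * P = P * (f n - f l)"
      by (simp add: algebra_simps)
    ultimately show ?case unfolding s by linarith
  qed simp
  from this[OF order.refl mn]
  have "\<bar>(\<Sum>b\<in>{m..n}. f b * g b) - f m * (\<Sum>b\<in>{m..n}. g b)\<bar> \<le> P * (f n - f m)" .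
  moreover have "\<bar>f m * (\<Sum>b\<in>{m..n}. g b)\<bar> \<le> f m * P"
    unfolding abs_mult using nonneg bd[of m] by (simp add: mult_left_mono)
  moreover have "P * (f n - f m) + f m * P = P * f n" by (simp add: algebra_simps)
  ultimately show ?thesis by linarith
qed

text \<open>Each term is at most the integral of y^2 / (y^2 + x^2) over x from k - 1 to k, expressed
  through arctan; the constant 2 stands for pi / 2.\<close>

lemma sum_lorentz_le:
  fixes y :: real
  assumes "y > 0"
  shows "(\<Sum>k=1..n. y\<^sup>2 / (y\<^sup>2 + (real k)\<^sup>2)) \<le> 2 * y"
proof -
  have "y\<^sup>2 / (y\<^sup>2 + (real k)\<^sup>2) \<le> y * (arctan (real k / y) - arctan (real (k - 1) / y))" if "k \<in> {1..n}" for k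
  proof -
    have lt: "real (k - 1) / y < real k / y" using that assms by (auto intro!: divide_strict_right_mono)
    obtain z where z: "real (k - 1) / y < z" "z < real k / y"
      "arctan (real k / y) - arctan (real (k - 1) / y) = (real k / y - real (k - 1) / y) * inverse (1 + z\<^sup>2)"
      using MVT2[OF lt, of arctan "\<lambda>x. inverse (1 + x\<^sup>2)"] DERIV_arctan by blast
    have "0 \<le> real (k - 1) / y" using assms by simp
    then have "z\<^sup>2 \<le> (real k / y)\<^sup>2" using z by (intro power_mono) auto
    then have "inverse (1 + (real k / y)\<^sup>2) \<le> inverse (1 + z\<^sup>2)"
      by (intro le_imp_inverse_le) (auto intro: add_pos_nonneg)
    moreover have "inverse (1 + (real k / y)\<^sup>2) = y\<^sup>2 / (y\<^sup>2 + (real k)\<^sup>2)"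
      using assms by (simp add: field_simps power_divide)
    moreover have "real k / y - real (k - 1) / y = 1 / y"
      using that by (simp add: of_nat_diff diff_divide_distrib)
    ultimately show ?thesis using z(3) assms by simp
  qed
  then have "(\<Sum>k=1..n. y\<^sup>2 / (y\<^sup>2 + (real k)\<^sup>2)) \<le> (\<Sum>k=1..n. y * (arctan (real k / y) - arctan (real (k - 1) / y)))"
    by (rule sum_mono)
  also have "\<dots> = y * (\<Sum>k=1..n. arctan (real k / y) - arctan (real (k - 1) / y))"
    by (simp only: sum_distrib_left)
  also have "(\<Sum>k=1..n. arctan (real k / y) - arctan (real (k - 1) / y)) = arctan (real n / y)"
    by (induction n) auto
  also have "y * arctan (real n / y) \<le> y * 2"
    using assms arctan_ubound[of "real n / y"] pi_less_4 by (intro mult_left_mono) auto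
  finally show ?thesis by simp
qed

lemma sum_inverse_k_sqrt_k_le: "(\<Sum>k=1..n. 1 / (real k * sqrt (real k))) \<le> 3"
proof -
  \<comment> \<open>The bound 3 alone is not inductive; the subtracted 2 / sqrt(n + 1) dominates the
    tail of the series.\<close>
  have "(\<Sum>k=1..Suc n. 1 / (real k * sqrt (real k))) \<le> 3 - 2 / sqrt (real (Suc n))" for n
  proof (induction n)
    case (Suc n)
    define x y where "x = sqrt (real (Suc n))" and "y = sqrt (real (Suc (Suc n)))"
    have xy: "0 < x" "x < y" "y\<^sup>2 - x\<^sup>2 = 1" "y * y = real (Suc (Suc n))" by (auto simp: x_def y_def)
    have "2 / x - 2 / y = 2 * (y - x) / (x * y)" using xy by (simp add: field_simps)
    also have "y - x = 1 / (x + y)" using xy by (simp add: field_simps power2_eq_square)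
    finally have e: "2 / x - 2 / y = 2 / ((x + y) * (x * y))" by simp
    have "(x + y) * (x * y) \<le> (y + y) * (y * y)" using xy by (intro mult_mono) auto
    then have "2 / ((y + y) * (y * y)) \<le> 2 / ((x + y) * (x * y))"
      using xy by (intro divide_left_mono mult_pos_pos add_pos_pos) auto
    then have "1 / (y * y * y) \<le> 2 / x - 2 / y" unfolding e by (simp add: mult_ac)
    then show ?case using Suc xy(4) by (simp add: x_def[symmetric] y_def[symmetric] del: of_nat_Suc)
  qed simp
  then have *: "(\<Sum>k=1..Suc n. 1 / (real k * sqrt (real k))) \<le> 3" for n
    by (rule order_trans) simp
  show ?thesis using *[of "n - 1"] by (cases n) auto
qed

text \<open>The tail is compared with a telescoping sum through 1 / (N + 1)^2 \<le> 2 / (N + 1) - 2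
  / (N + 2). The case n = 0 also yields the bound 2 for the whole series.\<close>

lemma basel_tail:
  "0 \<le> pi\<^sup>2 / 6 - (\<Sum>k=1..n. 1 / (real k)\<^sup>2)" "pi\<^sup>2 / 6 - (\<Sum>k=1..n. 1 / (real k)\<^sup>2) \<le> 2 / (real n + 1)"
proof -
  have conv: "(\<lambda>N. \<Sum>k=1..N. 1 / (real k)\<^sup>2) \<longlonglongrightarrow> pi\<^sup>2 / 6"
  proof -
    have "(\<Sum>k=1..N. 1 / (real k)\<^sup>2) = (\<Sum>k<N. 1 / (real k + 1)\<^sup>2)" for N
      by (rule sum.reindex_bij_witness[of _ Suc "\<lambda>k. k - 1"]) (auto simp: of_nat_diff add.commute)
    then show ?thesis using inverse_squares_sums by (simp add: sums_def add.commute)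
  qed
  have up: "(\<Sum>k=1..N. 1 / (real k)\<^sup>2) \<le> (\<Sum>k=1..n. 1 / (real k)\<^sup>2) + 2 / (real n + 1) - 2 / (real N + 1)" if "n \<le> N" for N
    using that
  proof (induction rule: dec_induct)
    case (step N)
    have "1 / (real (Suc N))\<^sup>2 = 2 / (2 * (real N + 1)\<^sup>2)" by (simp add: add.commute)
    also have "\<dots> \<le> 2 / ((real N + 1) * (real N + 2))"
      by (intro divide_left_mono) (auto simp: power2_eq_square algebra_simps add_pos_nonneg)
    also have "\<dots> = 2 / (real N + 1) - 2 / (real (Suc N) + 1)"
      by (simp add: diff_frac_eq algebra_simps)
    finally have "1 / (real (Suc N))\<^sup>2 \<le> 2 / (real N + 1) - 2 / (real (Suc N) + 1)" .
    then show ?case using step by simp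
  qed simp
  have "pi\<^sup>2 / 6 \<le> (\<Sum>k=1..n. 1 / (real k)\<^sup>2) + 2 / (real n + 1)"
  proof (rule LIMSEQ_le_const2[OF conv], intro exI[of _ n] allI impI)
    fix N assume N: "n \<le> N"
    have "0 \<le> 2 / (real N + 1)" by simp
    then show "(\<Sum>k=1..N. 1 / (real k)\<^sup>2) \<le> (\<Sum>k=1..n. 1 / (real k)\<^sup>2) + 2 / (real n + 1)"
      using up[OF N] by linarith
  qed
  then show "pi\<^sup>2 / 6 - (\<Sum>k=1..n. 1 / (real k)\<^sup>2) \<le> 2 / (real n + 1)" by linarith
  have "(\<Sum>k=1..n. 1 / (real k)\<^sup>2) \<le> pi\<^sup>2 / 6"
  proof (rule LIMSEQ_le_const[OF conv], intro exI[of _ n] allI impI)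
    fix N assume "n \<le> N"
    then show "(\<Sum>k=1..n. 1 / (real k)\<^sup>2) \<le> (\<Sum>k=1..N. 1 / (real k)\<^sup>2)" by (intro sum_mono2) auto
  qed
  then show "0 \<le> pi\<^sup>2 / 6 - (\<Sum>k=1..n. 1 / (real k)\<^sup>2)" by linarith
qed

lemma half_range: "{k. 0 < k \<and> 2 * k < b} = {1..(b - 1) div 2}" for b :: nat
  by auto

lemma sum_half_range_swap:
  fixes F :: "nat \<Rightarrow> nat \<Rightarrow> real"
  shows "(\<Sum>b=1..Q. \<Sum>k | 0 < k \<and> 2 * k < b. F b k)
     = (\<Sum>k | 0 < k \<and> 2 * k < Q. \<Sum>b\<in>{2 * k + 1..Q}. F b k)"
proof -
  have "(\<Sum>b=1..Q. \<Sum>k | 0 < k \<and> 2 * k < b. F b k)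
      = (\<Sum>b=1..Q. \<Sum>k | k \<in> {k. 0 < k \<and> 2 * k < Q} \<and> 2 * k < b. F b k)"
    by (intro sum.cong refl) auto
  also have "\<dots> = (\<Sum>k | 0 < k \<and> 2 * k < Q. \<Sum>b | b \<in> {1..Q} \<and> 2 * k < b. F b k)"
    unfolding half_range by (rule sum.swap_restrict) auto
  also have "\<dots> = (\<Sum>k | 0 < k \<and> 2 * k < Q. \<Sum>b\<in>{2 * k + 1..Q}. F b k)"
    by (intro sum.cong refl) auto
  finally show ?thesis .
qed

text \<open>The summand is b / (2 pi^2) * (ln b - ln k) / k^2, and the Basel sum pi^2 / 6 produces b
  / 12 * ln b. The missing Basel tail is O(1 / b) against ln b \<le> b and costs at most 4, the sum
  of ln k / k^2 at most 6, and 10 \<le> 2 pi^2.\<close>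

lemma sum_ln_ratio_approx:
  fixes b :: nat
  assumes b: "b > 0"
  shows "\<bar>(\<Sum>k | 0 < k \<and> 2 * k < b. 1 / (2 * real b) * (real b / (pi * real k))\<^sup>2 * ln (real b / real k))
     - real b / 12 * ln (real b)\<bar> \<le> real b"
proof -
  define n where "n = (b - 1) div 2"
  have "b \<le> 2 * (n + 1)" unfolding n_def by presburger
  then have "real b \<le> real (2 * (n + 1))" by (simp only: of_nat_le_iff)
  then have n: "real b \<le> 2 * (real n + 1)" by simp
  define S2 where "S2 = (\<Sum>k=1..n. 1 / (real k)\<^sup>2)"
  define SL where "SL = (\<Sum>k=1..n. ln (real k) / (real k)\<^sup>2)"
  have lnb: "0 \<le> ln (real b)" "ln (real b) \<le> real b" using b ln_le_minus_one[of "real b"] by auto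
  have "(\<Sum>k | 0 < k \<and> 2 * k < b. 1 / (2 * real b) * (real b / (pi * real k))\<^sup>2 * ln (real b / real k))
     = (\<Sum>k=1..n. real b / (2 * pi\<^sup>2) * (ln (real b) * (1 / (real k)\<^sup>2) - ln (real k) / (real k)\<^sup>2))"
    unfolding half_range n_def[symmetric]
  proof (rule sum.cong[OF refl])
    fix k assume k: "k \<in> {1..n}"
    have l: "ln (real b / real k) = ln (real b) - ln (real k)" using k b by (simp add: ln_div)
    show "1 / (2 * real b) * (real b / (pi * real k))\<^sup>2 * ln (real b / real k)
       = real b / (2 * pi\<^sup>2) * (ln (real b) * (1 / (real k)\<^sup>2) - ln (real k) / (real k)\<^sup>2)"
      unfolding l using k b by (simp add: power_mult_distrib power_divide power2_eq_square[of "real b"] diff_divide_distrib right_diff_distrib)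
  qed
  also have "\<dots> = real b / (2 * pi\<^sup>2) * (ln (real b) * S2 - SL)"
    unfolding S2_def SL_def sum_distrib_left[of "ln (real b)"] sum_subtractf[symmetric]
      sum_distrib_left[of "real b / (2 * pi\<^sup>2)"] ..
  finally have eq: "(\<Sum>k | 0 < k \<and> 2 * k < b. 1 / (2 * real b) * (real b / (pi * real k))\<^sup>2 * ln (real b / real k))
     - real b / 12 * ln (real b) = - (real b / (2 * pi\<^sup>2) * (ln (real b) * (pi\<^sup>2 / 6 - S2) + SL))"
    by (simp add: field_simps)
  have SL0: "0 \<le> SL" unfolding SL_def by (intro sum_nonneg) auto
  have "ln (real k) / (real k)\<^sup>2 \<le> 2 * (1 / (real k * sqrt (real k)))" if "k \<in> {1..n}" for k
  proof -
    have k: "real k \<ge> 1" using that by simp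
    have "ln (real k) = 2 * ln (sqrt (real k))" using k by (simp add: ln_sqrt)
    also have "\<dots> \<le> 2 * sqrt (real k)" using ln_le_minus_one[of "sqrt (real k)"] k by simp
    finally have "ln (real k) / (real k)\<^sup>2 \<le> 2 * sqrt (real k) / (real k)\<^sup>2" by (intro divide_right_mono) auto
    also have "\<dots> = 2 * (1 / (real k * sqrt (real k)))"
      using k by (simp add: field_simps power2_eq_square)
    finally show ?thesis .
  qed
  then have "SL \<le> (\<Sum>k=1..n. 2 * (1 / (real k * sqrt (real k))))" unfolding SL_def by (rule sum_mono)
  also have "\<dots> \<le> 2 * 3" unfolding sum_distrib_left[symmetric] using sum_inverse_k_sqrt_k_le by (intro mult_left_mono) auto
  finally have SL6: "SL \<le> 6" by simp
  have T: "0 \<le> pi\<^sup>2 / 6 - S2" "pi\<^sup>2 / 6 - S2 \<le> 2 / (real n + 1)" using basel_tail[of n] by (simp_all add: S2_def)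
  have "ln (real b) * (pi\<^sup>2 / 6 - S2) \<le> real b * (2 / (real n + 1))" using lnb T by (intro mult_mono) auto
  also have "\<dots> \<le> 4" using n by (simp add: divide_le_eq)
  finally have "ln (real b) * (pi\<^sup>2 / 6 - S2) + SL \<le> 10" using SL6 by linarith
  moreover have "0 \<le> ln (real b) * (pi\<^sup>2 / 6 - S2) + SL" using lnb T SL0 by auto
  ultimately have "\<bar>real b / (2 * pi\<^sup>2) * (ln (real b) * (pi\<^sup>2 / 6 - S2) + SL)\<bar> \<le> real b / (2 * pi\<^sup>2) * 10"
    unfolding abs_mult by (intro mult_mono) auto
  also have "\<dots> \<le> real b"
  proof -
    have "3\<^sup>2 \<le> pi\<^sup>2" using pi_gt3 by (intro power_mono) auto
    then have "10 \<le> 2 * pi\<^sup>2" by simp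
    then have "real b * 10 \<le> real b * (2 * pi\<^sup>2)" by (intro mult_left_mono) auto
    then show ?thesis by (simp add: divide_le_eq)
  qed
  finally show ?thesis unfolding eq abs_minus_cancel .
qed

text \<open>Write ln b = ln Q - ln(Q / b); the loss b ln(Q / b) is at most Q for every b.\<close>

lemma sum_mult_ln_approx:
  assumes "Q > 0"
  shows "\<bar>(\<Sum>b=1..Q. real b / 12 * ln (real b)) - (real Q)\<^sup>2 / 24 * ln (real Q)\<bar> \<le> (real Q)\<^sup>2"
proof -
  define D where "D = (\<Sum>b=1..Q. real b * ln (real Q / real b))"
  have gauss: "(\<Sum>b=1..Q. real b) = real Q * (real Q + 1) / 2" by (induction Q) (auto simp: field_simps)
  have lnQ: "0 \<le> ln (real Q)" "ln (real Q) \<le> real Q" using assms ln_le_minus_one[of "real Q"] by auto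
  have "(\<Sum>b=1..Q. real b / 12 * ln (real b)) = (\<Sum>b=1..Q. ln (real Q) / 12 * real b - real b * ln (real Q / real b) / 12)"
    using assms by (intro sum.cong) (auto simp: ln_div field_simps)
  also have "\<dots> = ln (real Q) / 12 * (real Q * (real Q + 1) / 2) - D / 12"
    unfolding D_def sum_subtractf sum_distrib_left[symmetric] gauss by (simp only: sum_divide_distrib)
  finally have eq: "(\<Sum>b=1..Q. real b / 12 * ln (real b)) - (real Q)\<^sup>2 / 24 * ln (real Q) = ln (real Q) * real Q / 24 - D / 12"
    by (simp add: field_simps power2_eq_square)
  have D0: "0 \<le> D" unfolding D_def by (intro sum_nonneg mult_nonneg_nonneg) auto
  have "D \<le> (\<Sum>b=1..Q. real Q)" unfolding D_def
  proof (rule sum_mono)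
    fix b assume b: "b \<in> {1..Q}"
    have "real b * ln (real Q / real b) \<le> real b * (real Q / real b)"
      using b assms ln_le_minus_one[of "real Q / real b"] by (intro mult_left_mono) auto
    then show "real b * ln (real Q / real b) \<le> real Q" using b by simp
  qed
  then have D1: "D \<le> (real Q)\<^sup>2" by (simp add: power2_eq_square)
  have "ln (real Q) * real Q \<le> (real Q)\<^sup>2" "0 \<le> ln (real Q) * real Q" using lnQ by (auto simp: power2_eq_square mult_right_mono)
  then show ?thesis unfolding eq using D0 D1 by linarith
qed


text \<open>The kernel is \<open>p k\<close> up to \<open>C\<close>, the cell at 0 is
  \<open>p k * L k\<close> up to 2 b / k, and both \<open>p k\<close> and \<open>L k\<close> are at
  most b / k. Each product is thus off by O((b / k)^2); the sum over k converges, and division by 2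
  b leaves O(b).\<close>

lemma sum_ckernel_fullcell_0_approx:
  fixes b :: nat
  assumes r: "1 / 2 \<le> r" "r < 1" and b: "b > 0"
  shows "\<bar>(\<Sum>k | 0 < k \<and> 2 * k < b. 1 / (2 * real b) * (ckernel r (real k / real b) * fullcell k b 0))
     - real b / 12 * ln (real b)\<bar> \<le> (5 + 8 / (1 - r)\<^sup>2) * real b"
proof -
  define C where "C = 2 + 8 / (1 - r)\<^sup>2"
  define K where "K = {k. 0 < k \<and> 2 * k < b}"
  have C: "C \<ge> 0" by (simp add: C_def)
  define p where "p = (\<lambda>k. real b / (pi * real k))"
  define L where "L = (\<lambda>k. ln (real b / real k))"
  have term_le: "\<bar>ckernel r (real k / real b) * fullcell k b 0 - (p k)\<^sup>2 * L k\<bar> \<le> (C + 2) * (real b)\<^sup>2 * (1 / (real k)\<^sup>2)"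
    if "k \<in> K" for k
  proof -
    have k: "0 < k" "2 * k < b" using that by (auto simp: K_def)
    define x where "x = real b / real k"
    have x: "2 \<le> x" using k by (simp add: x_def le_divide_eq)
    have t: "0 < real k / real b" "real k / real b \<le> 1 / 2" using k by (auto simp: field_simps)
    have pk: "1 / (pi * (real k / real b)) = p k" by (simp add: p_def)
    have p: "0 \<le> p k" "p k \<le> x"
    proof -
      show "0 \<le> p k" by (simp add: p_def)
      have "p k = x / pi" by (simp add: p_def x_def)
      also have "\<dots> \<le> x / 1" using x pi_gt3 by (intro divide_left_mono) auto
      finally show "p k \<le> x" by simp
    qed
    have L: "0 \<le> L k" "L k \<le> x" using x ln_le_minus_one[of x] by (auto simp: L_def x_def[symmetric])
    have F: "\<bar>fullcell k b 0 - p k * L k\<bar> \<le> 2 * x"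
      using fullcell_0_approx[OF k] by (simp add: p_def L_def x_def)
    have c: "0 \<le> ckernel r (real k / real b)" "ckernel r (real k / real b) \<le> p k" "p k - C \<le> ckernel r (real k / real b)"
      using ckernel_nonneg[OF r t] ckernel_le_inverse[OF r t] ckernel_ge[OF r t] unfolding pk C_def by auto
    have "ckernel r (real k / real b) * fullcell k b 0 - (p k)\<^sup>2 * L k
       = ckernel r (real k / real b) * (fullcell k b 0 - p k * L k) + (ckernel r (real k / real b) - p k) * (p k * L k)"
      by (simp add: algebra_simps power2_eq_square)
    also have "\<bar>\<dots>\<bar> \<le> ckernel r (real k / real b) * \<bar>fullcell k b 0 - p k * L k\<bar> + \<bar>ckernel r (real k / real b) - p k\<bar> * (p k * L k)"
      using c(1) p(1) L(1) by (intro order.trans[OF abs_triangle_ineq]) (simp add: abs_mult)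
    also have "\<dots> \<le> x * (2 * x) + C * (x * x)"
      using F c p L C x by (intro add_mono mult_mono) auto
    also have "\<dots> = (C + 2) * (real b)\<^sup>2 * (1 / (real k)\<^sup>2)" by (simp add: x_def power2_eq_square algebra_simps)
    finally show ?thesis .
  qed
  have K: "K = {1..(b - 1) div 2}" unfolding K_def by (rule half_range)
  have "\<bar>\<Sum>k\<in>K. 1 / (2 * real b) * (ckernel r (real k / real b) * fullcell k b 0 - (p k)\<^sup>2 * L k)\<bar>
     \<le> (\<Sum>k\<in>K. 1 / (2 * real b) * ((C + 2) * (real b)\<^sup>2 * (1 / (real k)\<^sup>2)))"
  proof (rule order.trans[OF sum_abs], rule sum_mono)
    fix k assume "k \<in> K"
    then show "\<bar>1 / (2 * real b) * (ckernel r (real k / real b) * fullcell k b 0 - (p k)\<^sup>2 * L k)\<bar>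
      \<le> 1 / (2 * real b) * ((C + 2) * (real b)\<^sup>2 * (1 / (real k)\<^sup>2))"
      unfolding abs_mult[of "1 / (2 * real b)"] using term_le[of k] by (intro mult_mono) simp_all
  qed
  also have "\<dots> = (C + 2) * real b / 2 * (\<Sum>k\<in>K. 1 / (real k)\<^sup>2)"
    unfolding sum_distrib_left using b by (intro sum.cong) (auto simp: power2_eq_square)
  also have "\<dots> \<le> (C + 2) * real b / 2 * 2"
  proof (rule mult_left_mono)
    have "(\<Sum>k\<in>K. 1 / (real k)\<^sup>2) \<le> (\<Sum>k=1..0. 1 / (real k)\<^sup>2) + 2"
      using basel_tail[of 0] basel_tail(1)[of "(b - 1) div 2"] unfolding K by simp
    then show "(\<Sum>k\<in>K. 1 / (real k)\<^sup>2) \<le> 2" by simp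
  qed (use C in auto)
  finally have A: "\<bar>\<Sum>k\<in>K. 1 / (2 * real b) * (ckernel r (real k / real b) * fullcell k b 0 - (p k)\<^sup>2 * L k)\<bar> \<le> (C + 2) * real b"
    by simp
  have "(\<Sum>k\<in>K. 1 / (2 * real b) * (ckernel r (real k / real b) * fullcell k b 0))
     = (\<Sum>k\<in>K. 1 / (2 * real b) * (ckernel r (real k / real b) * fullcell k b 0 - (p k)\<^sup>2 * L k))
       + (\<Sum>k\<in>K. 1 / (2 * real b) * (p k)\<^sup>2 * L k)"
    by (simp only: sum.distrib[symmetric] right_diff_distrib mult.assoc diff_add_cancel)
  moreover have "\<bar>(\<Sum>k\<in>K. 1 / (2 * real b) * (p k)\<^sup>2 * L k) - real b / 12 * ln (real b)\<bar> \<le> real b"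
    using sum_ln_ratio_approx[OF b] by (simp only: K_def p_def L_def)
  moreover have "(C + 2) * real b + real b = (5 + 8 / (1 - r)\<^sup>2) * real b" by (simp add: C_def algebra_simps)
  ultimately show ?thesis using A unfolding K_def[symmetric] by linarith
qed

text \<open>The source of the factor 1 - r: the weight k removes the pole of the kernel, and what
  remains is a Lorentz profile of height b and width y = (1 - r) b.\<close>

lemma sum_ckernel_mult_le:
  fixes b :: nat
  assumes r: "1 / 2 \<le> r" "r < 1" and b: "b > 0"
  shows "(\<Sum>k | 0 < k \<and> 2 * k < b. ckernel r (real k / real b) * real k) \<le> 2 * (1 - r) * (real b)\<^sup>2"
proof -
  define y where "y = (1 - r) * real b"
  have y: "y > 0" using r b by (simp add: y_def)
  have "ckernel r (real k / real b) * real k \<le> real b * (y\<^sup>2 / (y\<^sup>2 + (real k)\<^sup>2))" if k: "0 < k" "2 * k < b" for k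
  proof -
    have t: "0 < real k / real b" "real k / real b \<le> 1 / 2" using k by (auto simp: field_simps)
    have e: "(1 - r)\<^sup>2 / ((1 - r)\<^sup>2 + (real k / real b)\<^sup>2) = y\<^sup>2 / (y\<^sup>2 + (real k)\<^sup>2)"
    proof -
      have "y\<^sup>2 = (1 - r)\<^sup>2 * (real b)\<^sup>2" "(real k)\<^sup>2 = (real k / real b)\<^sup>2 * (real b)\<^sup>2"
        using b by (simp_all add: y_def power_mult_distrib power_divide)
      then have "y\<^sup>2 / (y\<^sup>2 + (real k)\<^sup>2) = (1 - r)\<^sup>2 * (real b)\<^sup>2 / (((1 - r)\<^sup>2 + (real k / real b)\<^sup>2) * (real b)\<^sup>2)"
        by (simp only: distrib_right)
      also have "\<dots> = (1 - r)\<^sup>2 / ((1 - r)\<^sup>2 + (real k / real b)\<^sup>2)"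
        using b by (intro mult_divide_mult_cancel_right) simp
      finally show ?thesis ..
    qed
    have "1 / (pi * (real k / real b)) = real b / real k / pi" by simp
    also have "\<dots> \<le> real b / real k / 1" using pi_gt3 by (intro divide_left_mono) auto
    finally have "1 / (pi * (real k / real b)) \<le> real b / real k" by simp
    then have "1 / (pi * (real k / real b)) * (y\<^sup>2 / (y\<^sup>2 + (real k)\<^sup>2)) \<le> real b / real k * (y\<^sup>2 / (y\<^sup>2 + (real k)\<^sup>2))"
      by (intro mult_right_mono) auto
    then have "ckernel r (real k / real b) \<le> real b / real k * (y\<^sup>2 / (y\<^sup>2 + (real k)\<^sup>2))"
      using ckernel_le[OF r t] unfolding e by linarith
    then have "ckernel r (real k / real b) * real k \<le> real b / real k * (y\<^sup>2 / (y\<^sup>2 + (real k)\<^sup>2)) * real k"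
      by (intro mult_right_mono) auto
    then show ?thesis using k by simp
  qed
  then have "(\<Sum>k | 0 < k \<and> 2 * k < b. ckernel r (real k / real b) * real k)
      \<le> (\<Sum>k | 0 < k \<and> 2 * k < b. real b * (y\<^sup>2 / (y\<^sup>2 + (real k)\<^sup>2)))"
    by (intro sum_mono) auto
  also have "\<dots> = real b * (\<Sum>k=1..(b - 1) div 2. y\<^sup>2 / (y\<^sup>2 + (real k)\<^sup>2))"
    unfolding half_range by (simp only: sum_distrib_left)
  also have "\<dots> \<le> real b * (2 * y)" by (intro mult_left_mono sum_lorentz_le y) auto
  finally show ?thesis by (simp add: y_def power2_eq_square mult_ac)
qed

text \<open>Fewer than k cells belong to each k, so bounds per cell enter with the weight k and
  \<open>sum_ckernel_mult_le\<close> supplies 1 - r. \<open>E\<close> collects the O(1) error of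
  every cell; \<open>M\<close> holds the periodic parts, for which b is summed first.\<close>

lemma sum_ckernel_fullcell_le:
  fixes J :: "nat \<Rightarrow> nat"
  assumes r: "1 / 2 \<le> r" "r < 1" and Q: "Q > 0" and J: "\<And>k. 0 < k \<Longrightarrow> J k < k"
  shows "\<bar>\<Sum>b=1..Q. \<Sum>k | 0 < k \<and> 2 * k < b. 1 / (2 * real b) * (ckernel r (real k / real b) * (\<Sum>j=1..J k. fullcell k b j))\<bar>
     \<le> 4 * (1 - r) * (real Q)\<^sup>2 * (1 + ln (real Q))"
proof -
  \<comment> \<open>The window Q serves all b \<le> Q at once, so \<open>resum\<close> depends on b
    only through the residue of \<open>j * b\<close>.\<close>
  define R where "R = (\<lambda>k b. \<Sum>j=1..J k. resum Q k (j * b))"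
  define c where "c = (\<lambda>k b. ckernel r (real k / real b))"
  have c0: "0 \<le> c k b" if "0 < k" "2 * k < b" for k b
    unfolding c_def using that by (intro ckernel_nonneg[OF r]) (auto simp: field_simps)
  have approx: "\<bar>(\<Sum>j=1..J k. fullcell k b j) - real b / pi * R k b\<bar> \<le> 2 * real k" if "0 < k" "1 \<le> b" "b \<le> Q" for k b
  proof -
    have "(\<Sum>j=1..J k. fullcell k b j) - real b / pi * R k b
        = (\<Sum>j=1..J k. fullcell k b j - real b / pi * resum Q k (j * b))"
      unfolding R_def by (simp only: sum_distrib_left sum_subtractf)
    also have "\<bar>\<dots>\<bar> \<le> (\<Sum>j=1..J k. 2)"
    proof (rule order.trans[OF sum_abs], rule sum_mono)
      fix j assume "j \<in> {1..J k}"
      moreover have "b * 1 \<le> Q * k" using that by (intro mult_le_mono) auto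
      ultimately show "\<bar>fullcell k b j - real b / pi * resum Q k (j * b)\<bar> \<le> 2"
        using J[OF that(1)] that by (intro fullcell_resum_approx) auto
    qed
    also have "\<dots> \<le> 2 * real k" using J[OF that(1)] by simp
    finally show ?thesis .
  qed
  define E where "E = (\<Sum>b=1..Q. \<Sum>k | 0 < k \<and> 2 * k < b. 1 / (2 * real b) * (c k b * ((\<Sum>j=1..J k. fullcell k b j) - real b / pi * R k b)))"
  have "\<bar>E\<bar> \<le> (\<Sum>b=1..Q. 2 * (1 - r) * real b)"
    unfolding E_def
  proof (rule order.trans[OF sum_abs], rule sum_mono)
    fix b assume b: "b \<in> {1..Q}"
    have "\<bar>\<Sum>k | 0 < k \<and> 2 * k < b. 1 / (2 * real b) * (c k b * ((\<Sum>j=1..J k. fullcell k b j) - real b / pi * R k b))\<bar>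
      \<le> (\<Sum>k | 0 < k \<and> 2 * k < b. 1 / real b * (c k b * real k))"
    proof (rule order.trans[OF sum_abs], rule sum_mono)
      fix k assume k: "k \<in> {k. 0 < k \<and> 2 * k < b}"
      have "\<bar>1 / (2 * real b) * (c k b * ((\<Sum>j=1..J k. fullcell k b j) - real b / pi * R k b))\<bar>
         = 1 / (2 * real b) * (c k b * \<bar>(\<Sum>j=1..J k. fullcell k b j) - real b / pi * R k b\<bar>)"
        using c0[of k b] k by (simp only: abs_mult) simp
      also have "\<dots> \<le> 1 / (2 * real b) * (c k b * (2 * real k))"
        using c0[of k b] k b approx[of k b] by (intro mult_left_mono) auto
      finally show "\<bar>1 / (2 * real b) * (c k b * ((\<Sum>j=1..J k. fullcell k b j) - real b / pi * R k b))\<bar>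
         \<le> 1 / real b * (c k b * real k)" by simp
    qed
    also have "\<dots> = 1 / real b * (\<Sum>k | 0 < k \<and> 2 * k < b. c k b * real k)" by (simp only: sum_distrib_left)
    also have "\<dots> \<le> 1 / real b * (2 * (1 - r) * (real b)\<^sup>2)"
      unfolding c_def using b by (intro mult_left_mono sum_ckernel_mult_le r) auto
    also have "\<dots> = 2 * (1 - r) * real b" using b by (simp add: power2_eq_square)
    finally show "\<bar>\<Sum>k | 0 < k \<and> 2 * k < b. 1 / (2 * real b) * (c k b * ((\<Sum>j=1..J k. fullcell k b j) - real b / pi * R k b))\<bar>
      \<le> 2 * (1 - r) * real b" .
  qed
  also have "\<dots> \<le> (\<Sum>b=1..Q. 2 * (1 - r) * real Q)" using r by (intro sum_mono mult_left_mono) auto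
  also have "\<dots> = 2 * (1 - r) * (real Q)\<^sup>2" by (simp add: power2_eq_square)
  finally have E: "\<bar>E\<bar> \<le> 2 * (1 - r) * (real Q)\<^sup>2" .
  define M where "M = (\<Sum>b=1..Q. \<Sum>k | 0 < k \<and> 2 * k < b. 1 / (2 * pi) * (c k b * R k b))"
  \<comment> \<open>For fixed k the range becomes 2 k < b \<le> Q, on which the kernel weights are
    nonnegative and increasing in b; Abel summation then leaves only the weight at b = Q.\<close>
  have Meq: "M = (\<Sum>k | 0 < k \<and> 2 * k < Q. \<Sum>b\<in>{2 * k + 1..Q}. 1 / (2 * pi) * (c k b * R k b))"
    unfolding M_def by (rule sum_half_range_swap)
  have "\<bar>M\<bar> \<le> (\<Sum>k | 0 < k \<and> 2 * k < Q. (1 + ln (real Q)) * (c k Q * real k))"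
    unfolding Meq
  proof (rule order.trans[OF sum_abs], rule sum_mono)
    fix k assume k: "k \<in> {k. 0 < k \<and> 2 * k < Q}"
    have inner: "\<bar>\<Sum>b\<in>{2 * k + 1..Q}. c k b * resum Q k (j * b)\<bar> \<le> 2 * (1 + ln (real k)) * c k Q" for j
    proof (rule abs_sum_mult_mono_le)
      fix i b assume ib: "2 * k + 1 \<le> i" "i \<le> b" "b \<le> Q"
      show "c k i \<le> c k b" unfolding c_def
      proof (rule ckernel_antimono[OF r])
        show "real k / real b \<le> real k / real i" using ib k by (intro divide_left_mono) auto
        show "real k / real i \<le> 1 / 2" using ib k by (simp add: divide_le_eq)
      qed (use ib k in auto)
    next
      show "0 \<le> c k (2 * k + 1)" using k by (intro c0) auto
      show "\<bar>\<Sum>b\<in>{l..Q}. resum Q k (j * b)\<bar> \<le> 2 * (1 + ln (real k))" for l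
        using abs_sum_resum_le[of k Q j l "Suc Q"] k by (simp add: atLeastLessThanSuc_atLeastAtMost)
    qed (use k in auto)
    have lnk: "0 \<le> ln (real k)" "ln (real k) \<le> ln (real Q)" using k by auto
    have ck: "0 \<le> c k Q" using k by (intro c0) auto
    have "(\<Sum>b\<in>{2 * k + 1..Q}. 1 / (2 * pi) * (c k b * R k b))
       = 1 / (2 * pi) * (\<Sum>j=1..J k. \<Sum>b\<in>{2 * k + 1..Q}. c k b * resum Q k (j * b))"
      unfolding R_def sum_distrib_left by (rule sum.swap)
    also have "\<bar>\<dots>\<bar> \<le> 1 / (2 * pi) * (\<Sum>j=1..J k. 2 * (1 + ln (real Q)) * c k Q)"
    proof -
      have "\<bar>\<Sum>j=1..J k. \<Sum>b\<in>{2 * k + 1..Q}. c k b * resum Q k (j * b)\<bar> \<le> (\<Sum>j=1..J k. 2 * (1 + ln (real Q)) * c k Q)"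
      proof (rule order.trans[OF sum_abs], rule sum_mono)
        fix j assume "j \<in> {1..J k}"
        have "2 * (1 + ln (real k)) * c k Q \<le> 2 * (1 + ln (real Q)) * c k Q"
          using lnk ck by (intro mult_right_mono) auto
        then show "\<bar>\<Sum>b\<in>{2 * k + 1..Q}. c k b * resum Q k (j * b)\<bar> \<le> 2 * (1 + ln (real Q)) * c k Q"
          using inner[of j] by linarith
      qed
      then show ?thesis unfolding abs_mult by (intro mult_mono) auto
    qed
    also have "\<dots> = 1 / pi * (real (J k) * ((1 + ln (real Q)) * c k Q))"
    proof -
      have "1 / (2 * pi) * (\<Sum>j=1..J k. 2 * x) = 1 / pi * (real (J k) * x)" for x by simp
      then show ?thesis by (simp only: mult.assoc)
    qed
    also have "\<dots> \<le> 1 * (real k * ((1 + ln (real Q)) * c k Q))"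
      using J[of k] k ck lnk pi_gt3 by (intro mult_mono) (auto simp: divide_le_eq)
    finally show "\<bar>\<Sum>b\<in>{2 * k + 1..Q}. 1 / (2 * pi) * (c k b * R k b)\<bar> \<le> (1 + ln (real Q)) * (c k Q * real k)"
      by (simp add: mult_ac)
  qed
  then have "\<bar>M\<bar> \<le> (1 + ln (real Q)) * (\<Sum>k | 0 < k \<and> 2 * k < Q. c k Q * real k)"
    unfolding sum_distrib_left .
  also have "\<dots> \<le> (1 + ln (real Q)) * (2 * (1 - r) * (real Q)\<^sup>2)"
  proof (rule mult_left_mono)
    show "(\<Sum>k | 0 < k \<and> 2 * k < Q. c k Q * real k) \<le> 2 * (1 - r) * (real Q)\<^sup>2"
      unfolding c_def by (rule sum_ckernel_mult_le[OF r Q])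
    have "0 \<le> ln (real Q)" using Q by simp
    then show "0 \<le> 1 + ln (real Q)" by linarith
  qed
  finally have M: "\<bar>M\<bar> \<le> (1 + ln (real Q)) * (2 * (1 - r) * (real Q)\<^sup>2)" .
  have EM: "(\<Sum>b=1..Q. \<Sum>k | 0 < k \<and> 2 * k < b. 1 / (2 * real b) * (c k b * (\<Sum>j=1..J k. fullcell k b j))) = E + M"
    unfolding E_def M_def sum.distrib[symmetric]
  proof (intro sum.cong refl)
    fix b k assume "b \<in> {1..Q}"
    then have "1 / (2 * real b) * (c k b * (F - real b / pi * X)) + 1 / (2 * pi) * (c k b * X) = 1 / (2 * real b) * (c k b * F)" for F X
      by (simp add: right_diff_distrib)
    then show "1 / (2 * real b) * (c k b * (\<Sum>j=1..J k. fullcell k b j))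
      = 1 / (2 * real b) * (c k b * ((\<Sum>j=1..J k. fullcell k b j) - real b / pi * R k b)) + 1 / (2 * pi) * (c k b * R k b)"
      by (simp only:)
  qed
  have le: "2 * (1 - r) * (real Q)\<^sup>2 \<le> (1 + ln (real Q)) * (2 * (1 - r) * (real Q)\<^sup>2)"
  proof -
    have "0 \<le> ln (real Q)" using Q by simp
    then have "0 \<le> ln (real Q) * (2 * (1 - r) * (real Q)\<^sup>2)" using r by (intro mult_nonneg_nonneg) auto
    then show ?thesis by (simp only: distrib_right mult_1)
  qed
  have "\<bar>E + M\<bar> \<le> (1 + ln (real Q)) * (2 * (1 - r) * (real Q)\<^sup>2) + (1 + ln (real Q)) * (2 * (1 - r) * (real Q)\<^sup>2)"
    by (rule order.trans[OF abs_triangle_ineq add_mono[OF order.trans[OF E le] M]])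
  also have "\<dots> = 4 * (1 - r) * (real Q)\<^sup>2 * (1 + ln (real Q))" by simp
  finally show ?thesis using EM unfolding c_def by (simp only:)
qed

text \<open>Origin of the constants: 1 / (1 - r) is the Poisson part (\<open>D\<close> against
  \<open>B\<close>), 5 + 8 / (1 - r)^2 the cells at 0 (\<open>B0\<close>), 3 S the cells cut at
  \<alpha> (\<open>B2\<close>), and one further unit the passage from b ln b to Q^2 ln Q. Only the
  interior cells (\<open>B1\<close>) lose a logarithm.\<close>

lemma dedekind_sum_triangle_approx:
  fixes \<alpha> r S :: real
  assumes r: "1 / 2 \<le> r" "r < 1" and al: "0 < \<alpha>" "\<alpha> < 1"
    and irr: "\<And>k. 0 < k \<Longrightarrow> real k * \<alpha> \<notin> \<int>"
    and S: "\<And>n. (\<Sum>k=1..n. 1 / (sqrt (dist_int (real k * \<alpha>)) * (real k * sqrt (real k)))) \<le> S"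
    and Q: "Q > 0"
  shows "\<bar>(\<Sum>b=1..Q. \<Sum>a | 0 < a \<and> real a < \<alpha> * real b. dedekind_sum (int a) (int b)) - (real Q)\<^sup>2 / 24 * ln (real Q)\<bar>
    \<le> 4 * (1 - r) * (real Q)\<^sup>2 * (1 + ln (real Q)) + (1 / (1 - r) + 6 + 8 / (1 - r)\<^sup>2 + 3 * S) * (real Q)\<^sup>2"
proof -
  define c where "c = (\<lambda>k b. ckernel r (real k / real b))"
  define A where "A = (\<lambda>b::nat. {a. 0 < a \<and> real a < \<alpha> * real b})"
  define X where "X = (\<lambda>k b. \<Sum>a\<in>A b. cot (pi * (real a * real k / real b)))"
  define J where "J = (\<lambda>k. nat \<lfloor>real k * \<alpha>\<rfloor>)"
  define W where "W = (\<lambda>k b. X k b - (\<Sum>j\<le>J k. fullcell k b j))"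
  define D where "D = (\<lambda>b. \<Sum>a\<in>A b. dedekind_sum (int a) (int b))"
  define B where "B = (\<lambda>b. \<Sum>k | 0 < k \<and> 2 * k < b. 1 / (2 * real b) * (c k b * X k b))"
  define B0 where "B0 = (\<lambda>b. \<Sum>k | 0 < k \<and> 2 * k < b. 1 / (2 * real b) * (c k b * fullcell k b 0))"
  define B1 where "B1 = (\<lambda>b. \<Sum>k | 0 < k \<and> 2 * k < b. 1 / (2 * real b) * (c k b * (\<Sum>j=1..J k. fullcell k b j)))"
  define B2 where "B2 = (\<lambda>b. \<Sum>k | 0 < k \<and> 2 * k < b. 1 / (2 * real b) * (c k b * W k b))"
  have A_sub: "A b \<subseteq> {0<..<b}" for b
  proof
    fix a assume a: "a \<in> A b"
    have "real a < \<alpha> * real b" using a by (simp add: A_def)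
    also have "\<dots> \<le> 1 * real b" using al by (intro mult_right_mono) auto
    finally show "a \<in> {0<..<b}" using a by (simp add: A_def)
  qed
  have A_fin: "finite (A b)" for b using finite_subset[OF A_sub] by simp
  have A_card: "real (card (A b)) \<le> real b" for b
    using card_mono[OF _ A_sub[of b]] by simp
  have DB: "\<bar>D b - B b\<bar> \<le> 1 / (1 - r) * real b" if "b > 0" for b
  proof -
    define Y where "Y = (\<lambda>a. 1 / (2 * real b) * (\<Sum>k | 0 < k \<and> 2 * k < b. c k b * cot (pi * of_int (int a) * real k / real b)))"
    have "B b = (\<Sum>k | 0 < k \<and> 2 * k < b. \<Sum>a\<in>A b. 1 / (2 * real b) * (c k b * cot (pi * of_int (int a) * real k / real b)))"
      unfolding B_def X_def by (simp add: sum_distrib_left mult.assoc)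
    also have "\<dots> = (\<Sum>a\<in>A b. Y a)"
      unfolding Y_def by (subst sum.swap) (simp only: sum_distrib_left)
    finally have "D b - B b = (\<Sum>a\<in>A b. dedekind_sum (int a) (int b) - Y a)"
      by (simp only: D_def sum_subtractf)
    also have "\<bar>\<dots>\<bar> \<le> (\<Sum>a\<in>A b. 1 / (1 - r))"
    proof (rule order.trans[OF sum_abs], rule sum_mono)
      fix a
      show "\<bar>dedekind_sum (int a) (int b) - Y a\<bar> \<le> 1 / (1 - r)"
        unfolding Y_def c_def using r by (intro dedekind_sum_half_ckernel_approx that) auto
    qed
    also have "\<dots> = real (card (A b)) * (1 / (1 - r))" by simp
    also have "\<dots> \<le> real b * (1 / (1 - r))" using A_card r by (intro mult_right_mono) auto
    finally show ?thesis by simp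
  qed
  have split: "B b = B0 b + B1 b + B2 b" for b
    unfolding B_def B0_def B1_def B2_def sum.distrib[symmetric] distrib_left[symmetric]
  proof (intro sum.cong refl)
    fix k
    have "{..J k} = insert 0 {1..J k}" by auto
    then have "(\<Sum>j\<le>J k. fullcell k b j) = fullcell k b 0 + (\<Sum>j=1..J k. fullcell k b j)" by simp
    then have "X k b = fullcell k b 0 + (\<Sum>j=1..J k. fullcell k b j) + W k b" by (simp add: W_def)
    then show "1 / (2 * real b) * (c k b * X k b) = 1 / (2 * real b) * (c k b * (fullcell k b 0 + (\<Sum>j=1..J k. fullcell k b j) + W k b))"
      by (simp only:)
  qed
  have B0: "\<bar>B0 b - real b / 12 * ln (real b)\<bar> \<le> (5 + 8 / (1 - r)\<^sup>2) * real b" if "b > 0" for b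
    unfolding B0_def c_def by (rule sum_ckernel_fullcell_0_approx[OF r that])
  have JK: "J k < k" if "0 < k" for k
  proof -
    have "real k * \<alpha> < real k" using that al by simp
    moreover have "0 \<le> real k * \<alpha>" using al by simp
    ultimately show ?thesis unfolding J_def by (simp add: nat_less_iff floor_less_iff)
  qed
  have B1: "\<bar>\<Sum>b=1..Q. B1 b\<bar> \<le> 4 * (1 - r) * (real Q)\<^sup>2 * (1 + ln (real Q))"
    unfolding B1_def c_def by (rule sum_ckernel_fullcell_le[OF r Q JK])
  have S0: "0 \<le> S" using S[of 0] by simp
  have B2: "\<bar>B2 b\<bar> \<le> 3 * S * real b" if b: "b > 0" for b
  proof -
    have "\<bar>B2 b\<bar> \<le> (\<Sum>k | 0 < k \<and> 2 * k < b. 3 * real b * (1 / (sqrt (dist_int (real k * \<alpha>)) * (real k * sqrt (real k)))))"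
      unfolding B2_def
    proof (rule order.trans[OF sum_abs], rule sum_mono)
      fix k assume "k \<in> {k. 0 < k \<and> 2 * k < b}"
      then have k: "0 < k" "2 * k < b" by auto
      have t: "0 < real k / real b" "real k / real b \<le> 1 / 2" using k by (auto simp: field_simps)
      define x y z where "x = sqrt (real k)" and "y = sqrt (real b)" and "z = sqrt (dist_int (real k * \<alpha>))"
      have xyz: "1 \<le> x" "x \<le> y" "0 < z" "real k = x * x" "real b = y * y"
        using k dist_int_pos[OF irr[OF k(1)]] by (auto simp: x_def y_def z_def)
      have c: "0 \<le> c k b" "c k b \<le> real b / real k"
      proof -
        show "0 \<le> c k b" unfolding c_def by (rule ckernel_nonneg[OF r t])
        have "c k b \<le> 1 / (pi * (real k / real b))" unfolding c_def by (rule ckernel_le_inverse[OF r t])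
        also have "\<dots> = real b / real k / pi" by simp
        also have "\<dots> \<le> real b / real k / 1" using pi_gt3 by (intro divide_left_mono) auto
        finally show "c k b \<le> real b / real k" by simp
      qed
      have W: "\<bar>W k b\<bar> \<le> 2 * ((y + 2 * real b / real k) / z)"
        unfolding W_def X_def A_def J_def y_def z_def
        by (rule sum_cot_below_approx[OF al irr[OF k(1)] k(1) b])
      have "\<bar>1 / (2 * real b) * (c k b * W k b)\<bar> = 1 / (2 * real b) * (c k b * \<bar>W k b\<bar>)"
        using c(1) by (simp only: abs_mult) simp
      also have "\<dots> \<le> 1 / (2 * real b) * (real b / real k * (2 * ((y + 2 * real b / real k) / z)))"
        using c W by (intro mult_left_mono mult_mono) auto
      also have "\<dots> = (y + 2 * real b / real k) / (real k * z)"
      proof -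
        have "1 / (2 * real b) * (real b / real k * (2 * (w / z))) = w / (real k * z)" for w
          using b by simp
        then show ?thesis .
      qed
      \<comment> \<open>Since k \<le> b, both sqrt b and b / k are at most b / sqrt k. Together with
        the factor 1 / k this makes the weight k^(-3/2), whose sum over k converges.\<close>
      also have "\<dots> \<le> 3 * real b / x / (real k * z)"
      proof (rule divide_right_mono)
        have "x * y \<le> y * y" using xyz by (intro mult_right_mono) auto
        then have "y \<le> real b / x" using xyz by (simp add: le_divide_eq mult.commute)
        moreover have "real b / real k \<le> real b / x"
        proof (rule divide_left_mono)
          show "x \<le> real k" using xyz mult_left_mono[of 1 x x] by simp
        qed (use xyz k in auto)
        moreover have "2 * real b / real k = 2 * (real b / real k)" "3 * real b / x = 3 * (real b / x)" by simp_all
        ultimately show "y + 2 * real b / real k \<le> 3 * real b / x" by linarith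
      qed (use xyz(3) in auto)
      also have "\<dots> = 3 * real b * (1 / (z * (real k * x)))" by simp
      finally show "\<bar>1 / (2 * real b) * (c k b * W k b)\<bar> \<le> 3 * real b * (1 / (sqrt (dist_int (real k * \<alpha>)) * (real k * sqrt (real k))))"
        unfolding x_def z_def .
    qed
    also have "\<dots> = 3 * real b * (\<Sum>k=1..(b - 1) div 2. 1 / (sqrt (dist_int (real k * \<alpha>)) * (real k * sqrt (real k))))"
      unfolding half_range by (simp only: sum_distrib_left)
    also have "\<dots> \<le> 3 * real b * S" by (intro mult_left_mono S) auto
    finally show ?thesis by (simp add: mult_ac)
  qed
  have sumb: "(\<Sum>b=1..Q. C * real b) \<le> C * (real Q)\<^sup>2" if "0 \<le> C" for C
  proof -
    have "(\<Sum>b=1..Q. C * real b) \<le> (\<Sum>b=1..Q. C * real Q)" using that by (intro sum_mono mult_left_mono) auto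
    then show ?thesis by (simp add: power2_eq_square mult_ac)
  qed
  have abs_sumb: "\<bar>\<Sum>b=1..Q. g b\<bar> \<le> C * (real Q)\<^sup>2" if "\<And>b. b > 0 \<Longrightarrow> \<bar>g b\<bar> \<le> C * real b" "0 \<le> C" for g C
  proof -
    have "\<bar>\<Sum>b=1..Q. g b\<bar> \<le> (\<Sum>b=1..Q. C * real b)"
      using that by (intro order.trans[OF sum_abs] sum_mono) auto
    then show ?thesis using sumb[OF that(2)] by linarith
  qed
  have e: "D b = (D b - B b) + (B0 b - real b / 12 * ln (real b)) + B2 b + B1 b + real b / 12 * ln (real b)" for b
    using split[of b] by simp
  have tot: "(\<Sum>b=1..Q. D b) = (\<Sum>b=1..Q. D b - B b) + (\<Sum>b=1..Q. B0 b - real b / 12 * ln (real b))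
      + (\<Sum>b=1..Q. B2 b) + (\<Sum>b=1..Q. B1 b) + (\<Sum>b=1..Q. real b / 12 * ln (real b))"
    unfolding sum.distrib[symmetric] by (intro sum.cong refl e)
  have 1: "\<bar>\<Sum>b=1..Q. D b - B b\<bar> \<le> 1 / (1 - r) * (real Q)\<^sup>2"
    by (rule abs_sumb[OF DB]) (use r in auto)
  have 2: "\<bar>\<Sum>b=1..Q. B0 b - real b / 12 * ln (real b)\<bar> \<le> (5 + 8 / (1 - r)\<^sup>2) * (real Q)\<^sup>2"
    by (rule abs_sumb[OF B0]) auto
  have 3: "\<bar>\<Sum>b=1..Q. B2 b\<bar> \<le> 3 * S * (real Q)\<^sup>2"
    by (rule abs_sumb[OF B2]) (use S0 in auto)
  have six: "\<bar>p + q + s + t + u - v\<bar> \<le> p' + q' + s' + t' + w'"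
    if "\<bar>p\<bar> \<le> p'" "\<bar>q\<bar> \<le> q'" "\<bar>s\<bar> \<le> s'" "\<bar>t\<bar> \<le> t'" "\<bar>u - v\<bar> \<le> w'" for p q s t u v p' q' s' t' w' :: real
    using that by linarith
  have "\<bar>(\<Sum>b=1..Q. D b) - (real Q)\<^sup>2 / 24 * ln (real Q)\<bar>
     \<le> 1 / (1 - r) * (real Q)\<^sup>2 + (5 + 8 / (1 - r)\<^sup>2) * (real Q)\<^sup>2 + 3 * S * (real Q)\<^sup>2
       + 4 * (1 - r) * (real Q)\<^sup>2 * (1 + ln (real Q)) + (real Q)\<^sup>2"
    unfolding tot by (rule six[OF 1 2 3 B1 sum_mult_ln_approx[OF Q]])
  also have "\<dots> = 4 * (1 - r) * (real Q)\<^sup>2 * (1 + ln (real Q)) + (1 / (1 - r) + 6 + 8 / (1 - r)\<^sup>2 + 3 * S) * (real Q)\<^sup>2"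
    by (simp add: distrib_right)
  finally show ?thesis unfolding D_def A_def .
qed

section \<open>Farey fractions\<close>

lemma quotient_of_of_nat_divide:
  fixes a b :: nat
  assumes "b > 0"
  shows "quotient_of (of_nat a / of_nat b) = (int (a div gcd a b), int (b div gcd a b))"
proof -
  have "quotient_of (of_int x / of_int y) = (x div gcd x y, y div gcd x y)" if "y > 0" for x y
    using that by (simp add: quotient_of_Fract Rat.normalize_def Let_def flip: Fract_of_int_quotient)
  from this[of "int b" "int a"] assms show ?thesis by (simp add: zdiv_int)
qed

lemma farey_eq: "farey m = {x. 0 \<le> x \<and> x \<le> 1 \<and> snd (quotient_of x) \<le> int m}"
proof -
  have "(\<exists>v w :: int. 1 \<le> w \<and> w \<le> int m \<and> x = of_int v / of_int w) \<longleftrightarrow> snd (quotient_of x) \<le> int m" for x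
  proof
    obtain p q where pq: "quotient_of x = (p, q)" by (cases "quotient_of x")
    have q: "q > 0" and x: "x = of_int p / of_int q" and cop: "coprime p q"
      using quotient_of_denom_pos[OF pq] quotient_of_div[OF pq] quotient_of_coprime[OF pq] by auto
    {
      assume "\<exists>v w :: int. 1 \<le> w \<and> w \<le> int m \<and> x = of_int v / of_int w"
      then obtain v w :: int where vw: "1 \<le> w" "w \<le> int m" "x = of_int v / of_int w" by blast
      have "(of_int (p * w) :: rat) = of_int (v * q)" using x vw q by (simp add: field_simps)
      then have "p * w = v * q" by (simp only: of_int_eq_iff)
      then have "q dvd p * w" by simp
      then have "q dvd w" using cop by (metis coprime_commute coprime_dvd_mult_right_iff)
      then have "q \<le> w" using vw(1) by (intro zdvd_imp_le) auto
      then show "snd (quotient_of x) \<le> int m" using vw(2) pq by simp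
    next
      assume "snd (quotient_of x) \<le> int m"
      then show "\<exists>v w :: int. 1 \<le> w \<and> w \<le> int m \<and> x = of_int v / of_int w"
        using pq q x by (intro exI[of _ p] exI[of _ q]) auto
    }
  qed
  then show ?thesis by (simp add: farey_def)
qed

text \<open>Each pair \<open>(a, b)\<close> is \<open>g\<close> times a reduced fraction, where \<open>g = gcd a b\<close>.\<close>

lemma sum_all_fractions_eq_sum_farey:
  fixes f :: "rat \<Rightarrow> real" and P :: "rat \<Rightarrow> bool"
  shows "(\<Sum>b=1..Q. \<Sum>a | a \<le> b \<and> P (of_nat a / of_nat b). f (of_nat a / of_nat b))
    = (\<Sum>g=1..Q. \<Sum>x | x \<in> farey (Q div g) \<and> P x. f x)"
proof -
  define i where "i = (\<lambda>(b, a). (gcd a b, of_nat a / of_nat b :: rat))"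
  define j where "j = (\<lambda>(g, x). (g * nat (snd (quotient_of x)), g * nat (fst (quotient_of x))))"
  have fin1: "finite {a. a \<le> b \<and> P (of_nat a / of_nat b)}" for b :: nat by simp
  have fin2: "finite {x. x \<in> farey (Q div g) \<and> P x}" for g by (simp add: finite_farey)
  have "(\<Sum>b=1..Q. \<Sum>a | a \<le> b \<and> P (of_nat a / of_nat b). f (of_nat a / of_nat b))
     = (\<Sum>(b, a)\<in>(SIGMA b:{1..Q}. {a. a \<le> b \<and> P (of_nat a / of_nat b)}). f (of_nat a / of_nat b))"
    by (intro sum.Sigma) (auto simp: fin1)
  also have "\<dots> = (\<Sum>(g, x)\<in>(SIGMA g:{1..Q}. {x. x \<in> farey (Q div g) \<and> P x}). f x)"
  proof (rule sum.reindex_bij_witness[of _ j i])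
    fix y assume "y \<in> (SIGMA b:{1..Q}. {a. a \<le> b \<and> P (of_nat a / of_nat b)})"
    then obtain a b where y: "y = (b, a)" "1 \<le> b" "b \<le> Q" "a \<le> b" "P (of_nat a / of_nat b)" by auto
    have q: "quotient_of (of_nat a / of_nat b) = (int (a div gcd a b), int (b div gcd a b))"
      using y by (intro quotient_of_of_nat_divide) auto
    have g: "gcd a b \<ge> 1" "gcd a b \<le> b" using y by (auto simp: Suc_le_eq intro!: gcd_le2_nat)
    show "j (i y) = y" by (simp add: y(1) i_def j_def q)
    have "b div gcd a b \<le> Q div gcd a b" using y by (intro div_le_mono)
    then have "of_nat a / of_nat b \<in> farey (Q div gcd a b)"
      using y q by (simp add: farey_eq divide_le_eq_1)
    then show "i y \<in> (SIGMA g:{1..Q}. {x. x \<in> farey (Q div g) \<and> P x})"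
      using y g by (simp add: i_def)
    show "(case i y of (g, x) \<Rightarrow> f x) = (case y of (b, a) \<Rightarrow> f (of_nat a / of_nat b))"
      by (simp add: y(1) i_def)
  next
    fix z assume "z \<in> (SIGMA g:{1..Q}. {x. x \<in> farey (Q div g) \<and> P x})"
    then obtain g x where z: "z = (g, x)" "1 \<le> g" "g \<le> Q" "x \<in> farey (Q div g)" "P x" by auto
    obtain p q where pq: "quotient_of x = (p, q)" by (cases "quotient_of x")
    have q: "q > 0" and x: "x = of_int p / of_int q" and cop: "coprime p q"
      using quotient_of_denom_pos[OF pq] quotient_of_div[OF pq] quotient_of_coprime[OF pq] by auto
    have x01: "0 \<le> x" "x \<le> 1" "q \<le> int (Q div g)" using z(4) pq by (auto simp: farey_eq)
    have p: "0 \<le> p" "p \<le> q" using x01 q by (simp_all add: x zero_le_divide_iff divide_le_eq_1)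
    define p' q' where "p' = nat p" and "q' = nat q"
    have pq': "p = int p'" "q = int q'" using p q by (simp_all add: p'_def q'_def)
    have q'0: "q' > 0" and p'q': "p' \<le> q'" and q'Q: "q' \<le> Q div g" and cop': "gcd p' q' = 1"
      using p q x01(3) cop by (auto simp: pq' coprime_iff_gcd_eq_1)
    have e: "of_nat (g * p') / of_nat (g * q') = x" using z(2) q'0 by (simp add: x pq')
    have "g * q' \<le> g * (Q div g)" using q'Q by (rule mult_le_mono2)
    also have "\<dots> \<le> Q" by simp
    finally have le: "g * q' \<le> Q" .
    have ge: "1 \<le> g * q'" using z(2) q'0 by simp
    have jz: "j z = (g * q', g * p')" by (simp add: z(1) j_def pq p'_def q'_def)
    show "i (j z) = z" unfolding jz using e cop' by (simp add: i_def z(1) gcd_mult_left[symmetric] flip: gcd_mult_distrib_nat)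
    show "j z \<in> (SIGMA b:{1..Q}. {a. a \<le> b \<and> P (of_nat a / of_nat b)})"
      unfolding jz using e z le ge p'q' by auto
  qed
  also have "\<dots> = (\<Sum>g=1..Q. \<Sum>x | x \<in> farey (Q div g) \<and> P x. f x)"
    by (rule sum.Sigma[symmetric]) (auto simp: fin2)
  finally show ?thesis .
qed

text \<open>For the constant function 1 the sum over all fractions just counts b + 1 numerators for
  each b. This exact value stands in for the asymptotic size of the Farey sets.\<close>

lemma sum_card_farey: "(\<Sum>g=1..Q. real (card (farey (Q div g)))) = real Q * (real Q + 3) / 2"
proof -
  have "(\<Sum>g=1..Q. real (card (farey (Q div g)))) = (\<Sum>b=1..Q. \<Sum>a | a \<le> b. 1)"
    using sum_all_fractions_eq_sum_farey[where P = "\<lambda>_. True" and f = "\<lambda>_. 1" and Q = Q] by simp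
  also have "\<dots> = (\<Sum>b=1..Q. real b + 1)" by (simp add: add.commute)
  also have "\<dots> = real Q * (real Q + 3) / 2" by (induction Q) (auto simp: field_simps)
  finally show ?thesis .
qed

lemma sum_farey_below_dedekind:
  assumes "0 < \<alpha>" "\<alpha> < 1"
  shows "(\<Sum>g=1..Q. \<Sum>x\<in>farey_below \<alpha> (Q div g). dedekind_rat x)
    = (\<Sum>b=1..Q. \<Sum>a | 0 < a \<and> real a < \<alpha> * real b. dedekind_sum (int a) (int b))"
proof -
  have e: "farey_below \<alpha> m = {x. x \<in> farey m \<and> real_of_rat x < \<alpha>}" for m
    by (auto simp: farey_below_def farey_def)
  have "(\<Sum>g=1..Q. \<Sum>x\<in>farey_below \<alpha> (Q div g). dedekind_rat x)
     = (\<Sum>b=1..Q. \<Sum>a | a \<le> b \<and> real_of_rat (of_nat a / of_nat b) < \<alpha>. dedekind_rat (of_nat a / of_nat b))"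
    unfolding e by (rule sum_all_fractions_eq_sum_farey[symmetric])
  also have "\<dots> = (\<Sum>b=1..Q. \<Sum>a | 0 < a \<and> real a < \<alpha> * real b. dedekind_sum (int a) (int b))"
  proof (rule sum.cong[OF refl])
    fix b assume b: "b \<in> {1..Q}"
    have d: "dedekind_rat (of_nat a / of_nat b) = dedekind_sum (int a) (int b)" for a
      using dedekind_rat_divide[of "int b" "int a"] b by simp
    have r: "real_of_rat (of_nat a / of_nat b) < \<alpha> \<longleftrightarrow> real a < \<alpha> * real b" for a
      using b by (simp add: of_rat_divide divide_less_eq)
    have lt: "a \<le> b" if "real a < \<alpha> * real b" for a
    proof -
      have "\<alpha> * real b \<le> 1 * real b" using assms by (intro mult_right_mono) auto
      then show ?thesis using that by simp
    qed
    show "(\<Sum>a | a \<le> b \<and> real_of_rat (of_nat a / of_nat b) < \<alpha>. dedekind_rat (of_nat a / of_nat b))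
       = (\<Sum>a | 0 < a \<and> real a < \<alpha> * real b. dedekind_sum (int a) (int b))"
      unfolding d r
    proof (rule sum.mono_neutral_right)
      show "\<forall>a\<in>{a. a \<le> b \<and> real a < \<alpha> * real b} - {a. 0 < a \<and> real a < \<alpha> * real b}. dedekind_sum (int a) (int b) = 0"
      proof
        fix a assume "a \<in> {a. a \<le> b \<and> real a < \<alpha> * real b} - {a. 0 < a \<and> real a < \<alpha> * real b}"
        then have "a = 0" by auto
        then show "dedekind_sum (int a) (int b) = 0" by (simp add: dedekind_sum_def sawtooth_def)
      qed
    qed (use lt in auto)
  qed
  finally show ?thesis .
qed

lemma sum_inverse_squares_from_2_le: "(\<Sum>g=2..Q. 1 / (real g)\<^sup>2) \<le> 3 / 4"
proof (cases "Q = 0")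
  case False
  \<comment> \<open>From pi \<le> 16 / 5 follows pi^2 / 6 \<le> 7 / 4, so the sum from 2 on stays
    safely below 1.\<close>
  have "pi\<^sup>2 \<le> (16 / 5)\<^sup>2" using pi_approx by (intro power_mono) auto
  then have "(\<Sum>g=1..Q. 1 / (real g)\<^sup>2) \<le> 7 / 4" using basel_tail(1)[of Q] by (simp add: power_divide)
  moreover have "{1..Q} = insert 1 {2..Q}" using False by auto
  ultimately show ?thesis by simp
qed simp

text \<open>The factor 4 solves c = 1 + 3/4 c, with 3/4 from
  \<open>sum_inverse_squares_from_2_le\<close>. For 2 \<le> g \<le> Q one has 0 < Q div g < Q, and
  the inductive bound scales at worst like (Q / g)^2 because ln is increasing.\<close>

lemma bounded_by_divisor_sums:
  fixes e :: "nat \<Rightarrow> real"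
  assumes eps: "0 \<le> \<epsilon>" "0 \<le> C"
    and hyp: "\<And>Q. 0 < Q \<Longrightarrow> \<bar>\<Sum>g=1..Q. e (Q div g)\<bar> \<le> (real Q)\<^sup>2 * (\<epsilon> * ln (real Q) + C)"
    and Q: "0 < Q"
  shows "\<bar>e Q\<bar> \<le> 4 * ((real Q)\<^sup>2 * (\<epsilon> * ln (real Q) + C))"
  using Q
proof (induction Q rule: less_induct)
  case (less Q)
  define L where "L = \<epsilon> * ln (real Q) + C"
  have L: "L \<ge> 0" using less.prems eps by (simp add: L_def)
  have "{1..Q} = insert 1 {2..Q}" using less.prems by auto
  then have split: "(\<Sum>g=1..Q. e (Q div g)) = e Q + (\<Sum>g=2..Q. e (Q div g))" by simp
  have "\<bar>\<Sum>g=2..Q. e (Q div g)\<bar> \<le> (\<Sum>g=2..Q. 4 * ((real Q)\<^sup>2 * L) * (1 / (real g)\<^sup>2))"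
  proof (rule order.trans[OF sum_abs], rule sum_mono)
    fix g assume g: "g \<in> {2..Q}"
    have d: "0 < Q div g" "Q div g < Q" using g by (auto simp: div_greater_zero_iff)
    have le: "real (Q div g) \<le> real Q / real g" by (rule of_nat_div_le_of_nat)
    have "\<bar>e (Q div g)\<bar> \<le> 4 * ((real (Q div g))\<^sup>2 * (\<epsilon> * ln (real (Q div g)) + C))"
      by (rule less.IH[OF d(2,1)])
    also have "\<dots> \<le> 4 * ((real Q / real g)\<^sup>2 * L)"
    proof -
      have "\<epsilon> * ln (real (Q div g)) + C \<le> L" unfolding L_def using d eps by (intro add_mono mult_left_mono) auto
      moreover have "0 \<le> \<epsilon> * ln (real (Q div g)) + C" using d eps by simp
      ultimately show ?thesis using le by (intro mult_left_mono mult_mono power_mono) auto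
    qed
    also have "\<dots> = 4 * ((real Q)\<^sup>2 * L) * (1 / (real g)\<^sup>2)" by (simp add: power_divide)
    finally show "\<bar>e (Q div g)\<bar> \<le> 4 * ((real Q)\<^sup>2 * L) * (1 / (real g)\<^sup>2)" .
  qed
  also have "\<dots> = 4 * ((real Q)\<^sup>2 * L) * (\<Sum>g=2..Q. 1 / (real g)\<^sup>2)" by (rule sum_distrib_left[symmetric])
  also have "\<dots> \<le> 4 * ((real Q)\<^sup>2 * L) * (3 / 4)"
    using L by (intro mult_left_mono sum_inverse_squares_from_2_le) auto
  finally have "\<bar>\<Sum>g=2..Q. e (Q div g)\<bar> \<le> 4 * ((real Q)\<^sup>2 * L) * (3 / 4)" .
  moreover have "\<bar>e Q + (\<Sum>g=2..Q. e (Q div g))\<bar> \<le> (real Q)\<^sup>2 * L"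
    using hyp[OF less.prems] unfolding split L_def .
  ultimately show ?case unfolding L_def[symmetric] by linarith
qed

lemma card_farey_le: "real (card (farey m)) \<le> real m * (real m + 3) / 2"
proof (cases "m = 0")
  case False
  have "real (card (farey (m div 1))) \<le> (\<Sum>g=1..m. real (card (farey (m div g))))"
    by (rule member_le_sum[where f = "\<lambda>g. real (card (farey (m div g)))"]) (use False in auto)
  then show ?thesis unfolding sum_card_farey by simp
next
  case True
  have "farey 0 = {}" by (auto simp: farey_def)
  then show ?thesis using True by simp
qed

text \<open>From the exact total in \<open>sum_card_farey\<close> subtract the upper bound
  \<open>card_farey_le\<close> for each g \<ge> 2; the coefficient is 1/2 * (1 - 3/4) = 1/8.\<close>

lemma card_farey_ge:
  assumes "Q > 0"
  shows "(real Q)\<^sup>2 / 8 - 3 / 2 * (real Q * (1 + ln (real Q))) \<le> real (card (farey Q))"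
proof -
  have "{1..Q} = insert 1 {2..Q}" using assms by auto
  then have split: "(\<Sum>g=1..Q. real (card (farey (Q div g)))) = real (card (farey Q)) + (\<Sum>g=2..Q. real (card (farey (Q div g))))"
    by simp
  have "(\<Sum>g=2..Q. real (card (farey (Q div g)))) \<le> (\<Sum>g=2..Q. (real Q)\<^sup>2 / 2 * (1 / (real g)\<^sup>2) + 3 / 2 * real Q * (1 / real g))"
  proof (rule sum_mono)
    fix g assume "g \<in> {2..Q}"
    define x where "x = real Q / real g"
    have x: "real (Q div g) \<le> x" unfolding x_def by (rule of_nat_div_le_of_nat)
    have "real (card (farey (Q div g))) \<le> real (Q div g) * (real (Q div g) + 3) / 2" by (rule card_farey_le)
    also have "\<dots> \<le> x * (x + 3) / 2" using x by (intro divide_right_mono mult_mono) auto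
    also have "\<dots> = (real Q)\<^sup>2 / 2 * (1 / (real g)\<^sup>2) + 3 / 2 * real Q * (1 / real g)"
    proof -
      have "x * (x + 3) / 2 = x\<^sup>2 / 2 + 3 / 2 * x" by (simp add: power2_eq_square distrib_left add_divide_distrib)
      then show ?thesis by (simp add: x_def power_divide)
    qed
    finally show "real (card (farey (Q div g))) \<le> (real Q)\<^sup>2 / 2 * (1 / (real g)\<^sup>2) + 3 / 2 * real Q * (1 / real g)" .
  qed
  also have "\<dots> = (real Q)\<^sup>2 / 2 * (\<Sum>g=2..Q. 1 / (real g)\<^sup>2) + 3 / 2 * real Q * (\<Sum>g=2..Q. 1 / real g)"
    by (simp only: sum.distrib sum_distrib_left)
  also have "\<dots> \<le> (real Q)\<^sup>2 / 2 * (3 / 4) + 3 / 2 * real Q * (1 + ln (real Q))"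
  proof (intro add_mono mult_left_mono sum_inverse_squares_from_2_le)
    have "(\<Sum>g=2..Q. 1 / real g) \<le> (\<Sum>g=1..Q. 1 / real g)" by (intro sum_mono2) auto
    also have "\<dots> \<le> 1 + ln (real Q)" by (rule sum_inverse_le_ln[OF assms])
    finally show "(\<Sum>g=2..Q. 1 / real g) \<le> 1 + ln (real Q)" .
  qed auto
  finally have "(\<Sum>g=2..Q. real (card (farey (Q div g)))) \<le> (real Q)\<^sup>2 / 2 * (3 / 4) + 3 / 2 * real Q * (1 + ln (real Q))" .
  then have "real Q * (real Q + 3) / 2 \<le> real (card (farey Q)) + ((real Q)\<^sup>2 / 2 * (3 / 4) + 3 / 2 * real Q * (1 + ln (real Q)))"
    using sum_card_farey[of Q] unfolding split by linarith
  then show ?thesis by (simp add: power2_eq_square algebra_simps add_divide_distrib)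
qed

lemma eventually_card_farey_ge: "\<forall>\<^sub>F Q in sequentially. (real Q)\<^sup>2 / 16 \<le> real (card (farey Q))"
proof -
  have "(\<lambda>Q. ln (real Q) / real Q) \<longlonglongrightarrow> 0" by (rule lim_ln_over_n)
  \<comment> \<open>With Q \<ge> 48 this gives 1 + ln Q \<le> Q / 24, so the subtracted term is at
    most Q^2 / 16, half of the main one.\<close>
  then have "\<forall>\<^sub>F Q in sequentially. ln (real Q) / real Q < 1 / 48" by (rule order_tendstoD) simp
  moreover have "\<forall>\<^sub>F Q in sequentially. Q \<ge> 48" by (rule eventually_ge_at_top)
  ultimately show ?thesis
  proof eventually_elim
    case (elim Q)
    have "ln (real Q) \<le> real Q / 48" using elim by (simp add: field_simps)
    moreover have "1 \<le> real Q / 48" using elim by simp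
    ultimately have "real Q * (1 + ln (real Q)) \<le> real Q * (real Q / 24)" by (intro mult_left_mono) auto
    moreover have "(real Q)\<^sup>2 / 8 - 3 / 2 * (real Q * (1 + ln (real Q))) \<le> real (card (farey Q))"
      using elim by (intro card_farey_ge) auto
    ultimately show ?case by (simp add: power2_eq_square)
  qed
qed

text \<open>Summed over g, the expected main term reproduces the Q^2 / 24 * ln Q of the sum over all
  pairs. Replacing ln(Q div g) by ln Q costs at most ln(2 g) \<le> 3 sqrt g per fraction, and there
  are at most 2 (Q / g)^2 fractions: a convergent series in g.\<close>

lemma sum_card_farey_ln_approx:
  assumes "Q > 0"
  shows "\<bar>(\<Sum>g=1..Q. 1 / 12 * real (card (farey (Q div g))) * ln (real (Q div g))) - (real Q)\<^sup>2 / 24 * ln (real Q)\<bar> \<le> 3 * (real Q)\<^sup>2"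
proof -
  define D where "D = (\<Sum>g=1..Q. real (card (farey (Q div g))) * ln (real Q / real (Q div g)))"
  have lnQ: "0 \<le> ln (real Q)" "ln (real Q) \<le> real Q" using assms ln_le_minus_one[of "real Q"] by auto
  have d: "0 < Q div g" "0 < real (Q div g)" if "g \<in> {1..Q}" for g using that by (auto simp: div_greater_zero_iff)
  have term_le: "real (card (farey (Q div g))) * ln (real Q / real (Q div g)) \<le> 6 * (real Q)\<^sup>2 * (1 / (real g * sqrt (real g)))"
    and term_ge: "0 \<le> real (card (farey (Q div g))) * ln (real Q / real (Q div g))" if g: "g \<in> {1..Q}" for g
  proof -
    define m where "m = Q div g"
    have m: "0 < m" "real m > 0" using d[OF g] by (auto simp: m_def)
    have mQ: "real m \<le> real Q / real g" unfolding m_def by (rule of_nat_div_le_of_nat)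
    \<comment> \<open>As m \<ge> 1, rounding down loses at most a factor 2.\<close>
    have "Q < (m + 1) * g" using g dividend_less_div_times[of g Q] by (simp add: m_def)
    also have "\<dots> \<le> (2 * m) * g" using m by (intro mult_right_mono) auto
    finally have "real Q < real ((2 * m) * g)" by (simp only: of_nat_less_iff)
    then have "real Q \<le> 2 * real g * real m" by (simp add: mult_ac)
    then have q2: "real Q / real m \<le> 2 * real g" using m by (simp add: divide_le_eq)
    have "real m \<le> real Q" by (simp add: m_def)
    then have q1: "1 \<le> real Q / real m" using m by (simp add: le_divide_eq)
    then have ln0: "0 \<le> ln (real Q / real m)" by simp
    then show "0 \<le> real (card (farey (Q div g))) * ln (real Q / real (Q div g))" by (simp add: m_def)
    have "ln (real Q / real m) \<le> ln (2 * real g)" using q1 q2 by (intro ln_mono) auto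
    also have "\<dots> = 2 * ln (sqrt (2 * real g))" using g by (simp add: ln_sqrt)
    also have "\<dots> \<le> 2 * (sqrt (2 * real g) - 1)" using g by (intro mult_left_mono ln_le_minus_one) auto
    also have "\<dots> \<le> 2 * sqrt 2 * sqrt (real g)" by (simp add: real_sqrt_mult)
    also have "\<dots> \<le> 3 * sqrt (real g)"
    proof -
      have "sqrt 2 \<le> 3 / 2" by (rule real_le_lsqrt) (auto simp: power2_eq_square)
      then show ?thesis by (intro mult_right_mono) auto
    qed
    finally have ln3: "ln (real Q / real m) \<le> 3 * sqrt (real g)" .
    have "real (card (farey m)) \<le> real m * (real m + 3) / 2" by (rule card_farey_le)
    also have "\<dots> \<le> 2 * (real m)\<^sup>2"
    proof -
      have "real m * 1 \<le> real m * real m" using m by (intro mult_left_mono) auto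
      then show ?thesis by (simp add: power2_eq_square algebra_simps)
    qed
    also have "\<dots> \<le> 2 * (real Q / real g)\<^sup>2" using mQ by (intro mult_left_mono power_mono) auto
    finally have "real (card (farey m)) * ln (real Q / real m) \<le> 2 * (real Q / real g)\<^sup>2 * (3 * sqrt (real g))"
      using ln3 ln0 by (intro mult_mono) auto
    also have "\<dots> = 6 * (real Q)\<^sup>2 * (sqrt (real g) / (real g * real g))" by (simp add: power2_eq_square)
    also have "sqrt (real g) / (real g * real g) = 1 / (real g * sqrt (real g))"
      using g by (simp add: field_simps)
    finally show "real (card (farey (Q div g))) * ln (real Q / real (Q div g)) \<le> 6 * (real Q)\<^sup>2 * (1 / (real g * sqrt (real g)))"
      by (simp add: m_def)
  qed
  have D0: "0 \<le> D" unfolding D_def using term_ge by (intro sum_nonneg)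
  have "D \<le> (\<Sum>g=1..Q. 6 * (real Q)\<^sup>2 * (1 / (real g * sqrt (real g))))"
    unfolding D_def by (rule sum_mono) (rule term_le)
  also have "\<dots> = 6 * (real Q)\<^sup>2 * (\<Sum>g=1..Q. 1 / (real g * sqrt (real g)))" by (rule sum_distrib_left[symmetric])
  also have "\<dots> \<le> 6 * (real Q)\<^sup>2 * 3" by (intro mult_left_mono sum_inverse_k_sqrt_k_le) auto
  finally have D1: "D \<le> 18 * (real Q)\<^sup>2" by simp
  have "(\<Sum>g=1..Q. 1 / 12 * real (card (farey (Q div g))) * ln (real (Q div g)))
     = (\<Sum>g=1..Q. ln (real Q) / 12 * real (card (farey (Q div g))) - real (card (farey (Q div g))) * ln (real Q / real (Q div g)) / 12)"
  proof (rule sum.cong[OF refl])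
    fix g assume "g \<in> {1..Q}"
    then have l: "ln (real Q / real (Q div g)) = ln (real Q) - ln (real (Q div g))"
      using d[of g] assms by (simp add: ln_div)
    show "1 / 12 * real (card (farey (Q div g))) * ln (real (Q div g))
      = ln (real Q) / 12 * real (card (farey (Q div g))) - real (card (farey (Q div g))) * ln (real Q / real (Q div g)) / 12"
      unfolding l by (simp add: field_simps)
  qed
  also have "\<dots> = ln (real Q) / 12 * (real Q * (real Q + 3) / 2) - D / 12"
    unfolding sum_subtractf sum_distrib_left[symmetric] sum_card_farey D_def by (simp only: sum_divide_distrib)
  finally have eq: "(\<Sum>g=1..Q. 1 / 12 * real (card (farey (Q div g))) * ln (real (Q div g))) - (real Q)\<^sup>2 / 24 * ln (real Q)
     = ln (real Q) * real Q / 8 - D / 12"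
    by (simp add: field_simps power2_eq_square)
  have "ln (real Q) * real Q \<le> (real Q)\<^sup>2" "0 \<le> ln (real Q) * real Q"
    using lnQ by (auto simp: power2_eq_square mult_right_mono)
  then show ?thesis unfolding eq using D0 D1 by linarith
qed

section \<open>Almost every endpoint\<close>

text \<open>The analogue of \<open>cotcell\<close> for the inverse square root of
  \<open>dist_int\<close>. Its integer translates dominate that function, and since it lives on the
  whole line it can be integrated by an affine substitution.\<close>

definition inv_sqrt_cell :: "real \<Rightarrow> real" where
  "inv_sqrt_cell t = indicator {- (1/2)..1/2} t * (1 / sqrt \<bar>t\<bar>)"

lemma inv_sqrt_cell_nonneg: "0 \<le> inv_sqrt_cell t"
  by (simp add: inv_sqrt_cell_def)

lemma inv_sqrt_cell_measurable [measurable]: "inv_sqrt_cell \<in> borel_measurable borel"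
  unfolding inv_sqrt_cell_def by measurable

lemma nn_integral_inv_sqrt_cell: "(\<integral>\<^sup>+t. ennreal (inv_sqrt_cell t) \<partial>lborel) \<le> ennreal 3"
proof -
  let ?h = "\<lambda>t::real. indicator {0..1/2} t * (1 / sqrt t)"
  have h: "(\<integral>\<^sup>+t. ennreal (?h t) \<partial>lborel) = ennreal (sqrt 2)"
  proof -
    have "((\<lambda>x::real. x powr (- 1/2)) has_integral ((1/2) powr (- 1/2 + 1) / (- 1/2 + 1))) {0..1/2}"
      by (rule has_integral_powr_from_0) auto
    moreover have "(1/2::real) powr (- 1/2 + 1) / (- 1/2 + 1) = sqrt 2"
      by (simp add: powr_half_sqrt real_sqrt_divide) (simp add: field_simps)
    moreover have "x powr (- 1/2) = 1 / sqrt x" if "x \<in> {0..1/2}" for x :: real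
      using that by (simp add: powr_minus_divide powr_half_sqrt[symmetric])
    ultimately have "((\<lambda>x::real. 1 / sqrt x) has_integral sqrt 2) {0..1/2}"
      by (metis (no_types, lifting) has_integral_cong)
    then show ?thesis by (intro nn_integral_has_integral_lebesgue) auto
  qed
  have "(\<integral>\<^sup>+t. ennreal (inv_sqrt_cell t) \<partial>lborel) \<le> (\<integral>\<^sup>+t. ennreal (?h t) + ennreal (?h (- t)) \<partial>lborel)"
    by (intro nn_integral_mono) (auto simp: inv_sqrt_cell_def indicator_def)
  also have "\<dots> = (\<integral>\<^sup>+t. ennreal (?h t) \<partial>lborel) + (\<integral>\<^sup>+t. ennreal (?h (- t)) \<partial>lborel)"
    by (intro nn_integral_add) measurable
  also have "(\<integral>\<^sup>+t. ennreal (?h (- t)) \<partial>lborel) = (\<integral>\<^sup>+t. ennreal (?h t) \<partial>lborel)"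
    using nn_integral_real_affine[where f = "\<lambda>t. ennreal (?h t)" and c = "-1" and t = 0] by simp
  also have "(\<integral>\<^sup>+t. ennreal (?h t) \<partial>lborel) + (\<integral>\<^sup>+t. ennreal (?h t) \<partial>lborel) = ennreal (2 * sqrt 2)"
    unfolding h by (simp flip: ennreal_plus)
  also have "\<dots> \<le> ennreal 3"
  proof (rule ennreal_leI)
    have "sqrt 2 \<le> 3 / 2" by (rule real_le_lsqrt) (auto simp: power2_eq_square)
    then show "2 * sqrt 2 \<le> (3::real)" by simp
  qed
  finally show ?thesis .
qed

lemma inverse_sqrt_dist_int_le:
  fixes \<alpha> :: real
  assumes "0 \<le> \<alpha>" "\<alpha> \<le> 1"
  shows "1 / sqrt (dist_int (real k * \<alpha>)) \<le> (\<Sum>j\<le>k. inv_sqrt_cell (real k * \<alpha> - real j))"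
proof -
  define y where "y = real k * \<alpha>"
  define n where "n = nat \<lfloor>y\<rfloor>"
  have y: "0 \<le> y" "y \<le> real k" using assms by (auto simp: y_def mult_left_le)
  have fr: "frac y = y - real n" using y by (simp add: n_def frac_def)
  have nk: "n \<le> k" using y by (simp add: n_def nat_le_iff floor_le_iff)
  have ge: "inv_sqrt_cell (y - real j) \<le> (\<Sum>j\<le>k. inv_sqrt_cell (y - real j))" if "j \<le> k" for j
    using that by (intro member_le_sum) (auto simp: inv_sqrt_cell_nonneg)
  have sum0: "0 \<le> (\<Sum>j\<le>k. inv_sqrt_cell (y - real j))" by (intro sum_nonneg inv_sqrt_cell_nonneg)
  have fb: "0 \<le> frac y" "frac y < 1" by (simp_all add: frac_lt_1)
  show ?thesis
  proof (cases "frac y \<le> 1/2")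
    case True
    then have "1 / sqrt (dist_int y) = inv_sqrt_cell (y - real n)"
      using fb fr by (simp add: dist_int_def inv_sqrt_cell_def min_def)
    then show ?thesis using ge[OF nk] by (simp add: y_def)
  next
    case False
    then have "real n < real k" using fr y fb by linarith
    then have "Suc n \<le> k" by simp
    moreover have "1 / sqrt (dist_int y) = inv_sqrt_cell (y - real (Suc n))"
      using False fb fr by (simp add: dist_int_def inv_sqrt_cell_def min_def abs_if)
    ultimately show ?thesis using ge[of "Suc n"] by (simp add: y_def)
  qed
qed

text \<open>Each of the k + 1 cells has mass at most 3 / k after the substitution t = k \<alpha> -
  j, and (k + 1) * 3 / k \<le> 6 for every k.\<close>

lemma nn_integral_inverse_sqrt_dist_int_le:
  assumes k: "0 < k"
  shows "(\<integral>\<^sup>+\<alpha>. ennreal (1 / sqrt (dist_int (real k * \<alpha>))) * indicator {0..1} \<alpha> \<partial>lborel) \<le> ennreal 6"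
proof -
  have cell: "(\<integral>\<^sup>+\<alpha>. ennreal (inv_sqrt_cell (real k * \<alpha> - real j)) \<partial>lborel) \<le> ennreal (3 / real k)" for j
  proof -
    have "(\<integral>\<^sup>+t. ennreal (inv_sqrt_cell t) \<partial>lborel)
       = ennreal (real k) * (\<integral>\<^sup>+\<alpha>. ennreal (inv_sqrt_cell (- real j + real k * \<alpha>)) \<partial>lborel)"
      using k nn_integral_real_affine[where f = "\<lambda>t. ennreal (inv_sqrt_cell t)" and c = "real k" and t = "- real j"] by simp
    then have "ennreal (1 / real k) * (ennreal (real k) * (\<integral>\<^sup>+\<alpha>. ennreal (inv_sqrt_cell (real k * \<alpha> - real j)) \<partial>lborel))
       \<le> ennreal (1 / real k) * ennreal 3"
      using nn_integral_inv_sqrt_cell by (intro mult_left_mono) (simp_all add: add.commute)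
    moreover have "ennreal (1 / real k) * ennreal (real k) = 1" using k by (simp flip: ennreal_mult)
    moreover have "ennreal (1 / real k) * ennreal 3 = ennreal (1 / real k * 3)"
      by (rule ennreal_mult[symmetric]) auto
    ultimately show ?thesis by (simp add: mult.assoc[symmetric])
  qed
  have "(\<integral>\<^sup>+\<alpha>. ennreal (1 / sqrt (dist_int (real k * \<alpha>))) * indicator {0..1} \<alpha> \<partial>lborel)
     \<le> (\<integral>\<^sup>+\<alpha>. (\<Sum>j\<le>k. ennreal (inv_sqrt_cell (real k * \<alpha> - real j))) \<partial>lborel)"
  proof (rule nn_integral_mono)
    fix \<alpha> :: real
    show "ennreal (1 / sqrt (dist_int (real k * \<alpha>))) * indicator {0..1} \<alpha> \<le> (\<Sum>j\<le>k. ennreal (inv_sqrt_cell (real k * \<alpha> - real j)))"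
      using inverse_sqrt_dist_int_le[of \<alpha> k]
      by (auto simp: indicator_def sum_ennreal inv_sqrt_cell_nonneg intro!: ennreal_leI)
  qed
  also have "\<dots> = (\<Sum>j\<le>k. \<integral>\<^sup>+\<alpha>. ennreal (inv_sqrt_cell (real k * \<alpha> - real j)) \<partial>lborel)"
    by (intro nn_integral_sum) measurable
  also have "\<dots> \<le> (\<Sum>j\<le>k. ennreal (3 / real k))" by (intro sum_mono cell)
  also have "\<dots> = ennreal (\<Sum>j\<le>k. 3 / real k)" by (rule sum_ennreal) auto
  also have "(\<Sum>j\<le>k. 3 / real k) = (real k + 1) * (3 / real k)" by (simp add: add.commute)
  also have "\<dots> \<le> ennreal 6" using k by (intro ennreal_leI) (simp add: field_simps)
  finally show ?thesis .
qed

text \<open>Tonelli: the weights k^(-3/2) sum to at most 3, so the integral of the series is at most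
  3 * 6 = 18 and the series is finite almost everywhere.\<close>

lemma AE_sum_inverse_sqrt_dist_int_bounded:
  "AE \<alpha> in lborel. \<alpha> \<in> {0..1} \<longrightarrow>
     (\<exists>S. \<forall>n. (\<Sum>k=1..n. 1 / (sqrt (dist_int (real k * \<alpha>)) * (real k * sqrt (real k)))) \<le> S)"
proof -
  define w where "w = (\<lambda>k. 1 / (real k * sqrt (real k)))"
  define F where "F = (\<lambda>(k::nat) \<alpha>. ennreal (w (Suc k)) * (ennreal (1 / sqrt (dist_int (real (Suc k) * \<alpha>))) * indicator {0..1} \<alpha>))"
  have [measurable]: "dist_int \<in> borel_measurable borel"
    unfolding dist_int_def frac_def by measurable
  have [measurable]: "F k \<in> borel_measurable lborel" for k
    unfolding F_def by measurable
  have "(\<integral>\<^sup>+\<alpha>. (\<Sum>k. F k \<alpha>) \<partial>lborel) = (\<Sum>k. \<integral>\<^sup>+\<alpha>. F k \<alpha> \<partial>lborel)"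
    by (rule nn_integral_suminf) measurable
  also have "\<dots> \<le> ennreal 18"
  proof (rule suminf_le_const)
    fix n
    have "(\<Sum>k<n. \<integral>\<^sup>+\<alpha>. F k \<alpha> \<partial>lborel) \<le> (\<Sum>k<n. ennreal (w (Suc k) * 6))"
    proof (rule sum_mono)
      fix k
      have "(\<integral>\<^sup>+\<alpha>. F k \<alpha> \<partial>lborel)
          = ennreal (w (Suc k)) * (\<integral>\<^sup>+\<alpha>. ennreal (1 / sqrt (dist_int (real (Suc k) * \<alpha>))) * indicator {0..1} \<alpha> \<partial>lborel)"
        unfolding F_def by (rule nn_integral_cmult) measurable
      also have "\<dots> \<le> ennreal (w (Suc k)) * ennreal 6"
        by (intro mult_left_mono nn_integral_inverse_sqrt_dist_int_le) auto
      also have "\<dots> = ennreal (w (Suc k) * 6)" by (rule ennreal_mult[symmetric]) (auto simp: w_def)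
      finally show "(\<integral>\<^sup>+\<alpha>. F k \<alpha> \<partial>lborel) \<le> ennreal (w (Suc k) * 6)" .
    qed
    also have "\<dots> = ennreal (\<Sum>k<n. w (Suc k) * 6)" by (intro sum_ennreal) (simp add: w_def)
    also have "\<dots> \<le> ennreal 18"
    proof (rule ennreal_leI)
      have "(\<Sum>k<n. w (Suc k) * 6) = (\<Sum>k=1..n. w k) * 6"
        unfolding sum_distrib_right by (rule sum.reindex_bij_witness[of _ "\<lambda>k. k - 1" Suc]) auto
      also have "\<dots> \<le> 3 * 6" unfolding w_def by (intro mult_right_mono sum_inverse_k_sqrt_k_le) auto
      finally show "(\<Sum>k<n. w (Suc k) * 6) \<le> 18" by simp
    qed
    finally show "(\<Sum>k<n. \<integral>\<^sup>+\<alpha>. F k \<alpha> \<partial>lborel) \<le> ennreal 18" .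
  qed auto
  finally have "(\<integral>\<^sup>+\<alpha>. (\<Sum>k. F k \<alpha>) \<partial>lborel) \<noteq> \<infinity>"
    by (metis ennreal_less_top infinity_ennreal_def leD top.not_eq_extremum)
  then have "AE \<alpha> in lborel. (\<Sum>k. F k \<alpha>) \<noteq> \<infinity>"
    by (intro nn_integral_noteq_infinite) measurable
  then show ?thesis
  proof (rule AE_mp, intro AE_I2 impI)
    fix \<alpha> :: real
    assume fin: "(\<Sum>k. F k \<alpha>) \<noteq> \<infinity>" and al: "\<alpha> \<in> {0..1}"
    define T where "T = enn2real (\<Sum>k. F k \<alpha>)"
    have T: "(\<Sum>k. F k \<alpha>) = ennreal T" using fin by (simp add: T_def less_top)
    have "(\<Sum>k=1..n. 1 / (sqrt (dist_int (real k * \<alpha>)) * (real k * sqrt (real k)))) \<le> T" for n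
    proof -
      have dn: "0 \<le> dist_int x" for x using frac_lt_1[of x] by (simp add: dist_int_def)
      define f where "f = (\<lambda>k. 1 / (sqrt (dist_int (real k * \<alpha>)) * (real k * sqrt (real k))))"
      have f0: "0 \<le> f k" for k using dn by (simp add: f_def)
      have Ff: "F k \<alpha> = ennreal (f (Suc k))" for k
        unfolding F_def using al dn by (simp add: w_def f_def mult.commute flip: ennreal_mult)
      have "ennreal (\<Sum>k<n. f (Suc k)) = (\<Sum>k<n. F k \<alpha>)" using f0 by (simp add: Ff sum_ennreal)
      also have "\<dots> \<le> (\<Sum>k. F k \<alpha>)" by (intro sum_le_suminf) auto
      finally have "ennreal (\<Sum>k<n. f (Suc k)) \<le> ennreal T" unfolding T .
      then have "(\<Sum>k<n. f (Suc k)) \<le> T" by (simp add: T_def)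
      moreover have "(\<Sum>k<n. f (Suc k)) = (\<Sum>k=1..n. f k)"
        by (rule sum.reindex_bij_witness[of _ "\<lambda>k. k - 1" Suc]) auto
      ultimately show ?thesis by (simp add: f_def)
    qed
    then show "\<exists>S. \<forall>n. (\<Sum>k=1..n. 1 / (sqrt (dist_int (real k * \<alpha>)) * (real k * sqrt (real k)))) \<le> S" by blast
  qed
qed

section \<open>From sums over all pairs to Farey averages\<close>

lemma farey_below_average_smallo:
  fixes \<alpha> S :: real
  assumes al: "0 < \<alpha>" "\<alpha> < 1" and irr: "\<And>k. 0 < k \<Longrightarrow> real k * \<alpha> \<notin> \<int>"
    and S: "\<And>n. (\<Sum>k=1..n. 1 / (sqrt (dist_int (real k * \<alpha>)) * (real k * sqrt (real k)))) \<le> S"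
  shows "(\<lambda>Q :: nat. 1 / real (card (farey Q)) * (\<Sum>x\<in>farey_below \<alpha> Q. dedekind_rat x) - 1 / 12 * ln (real Q))
        \<in> o[at_top](\<lambda>Q. ln (real Q))"
proof (rule landau_o.smallI)
  fix c :: real assume c: "c > 0"
  \<comment> \<open>The logarithmic error per fraction is 4 * 16 * 4 \<delta>, from
    \<open>bounded_by_divisor_sums\<close>, the Farey count and the triangle sum; c / 512 makes it
    at most c / 2. The other half of c absorbs the constant \<open>C'\<close> for large Q.\<close>
  define \<delta> where "\<delta> = min (1 / 2) (c / 512)"
  define r where "r = 1 - \<delta>"
  have del: "0 < \<delta>" "\<delta> \<le> 1 / 2" "\<delta> \<le> c / 512" using c by (auto simp: \<delta>_def)
  have r: "1 / 2 \<le> r" "r < 1" using del by (auto simp: r_def)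
  define C where "C = 1 / \<delta> + 6 + 8 / \<delta>\<^sup>2 + 3 * S"
  define C' where "C' = 4 * \<delta> + C + 3"
  have S0: "0 \<le> S" using S[of 0] by simp
  have C0: "0 \<le> C" "0 \<le> C'" using S0 del by (auto simp: C_def C'_def)
  define T where "T = (\<lambda>Q. \<Sum>x\<in>farey_below \<alpha> Q. dedekind_rat x)"
  define N where "N = (\<lambda>Q. real (card (farey Q)))"
  \<comment> \<open>Summed over Q div g, the two parts of \<open>e\<close> have the same main term
    Q^2 / 24 * ln Q, which cancels.\<close>
  define e where "e = (\<lambda>Q. T Q - 1 / 12 * N Q * ln (real Q))"
  have "\<bar>e Q\<bar> \<le> 4 * ((real Q)\<^sup>2 * (4 * \<delta> * ln (real Q) + C'))" if Q: "0 < Q" for Q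
  proof (rule bounded_by_divisor_sums[OF _ C0(2) _ Q])
    fix Q :: nat assume Q: "0 < Q"
    have sT: "(\<Sum>g=1..Q. T (Q div g)) = (\<Sum>b=1..Q. \<Sum>a | 0 < a \<and> real a < \<alpha> * real b. dedekind_sum (int a) (int b))"
      unfolding T_def by (rule sum_farey_below_dedekind[OF al])
    have 1: "\<bar>(\<Sum>g=1..Q. T (Q div g)) - (real Q)\<^sup>2 / 24 * ln (real Q)\<bar> \<le> 4 * \<delta> * (real Q)\<^sup>2 * (1 + ln (real Q)) + C * (real Q)\<^sup>2"
      unfolding sT using dedekind_sum_triangle_approx[OF r al irr S Q] by (simp add: r_def C_def)
    have 2: "\<bar>(\<Sum>g=1..Q. 1 / 12 * N (Q div g) * ln (real (Q div g))) - (real Q)\<^sup>2 / 24 * ln (real Q)\<bar> \<le> 3 * (real Q)\<^sup>2"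
      unfolding N_def by (rule sum_card_farey_ln_approx[OF Q])
    have s: "(\<Sum>g=1..Q. e (Q div g)) = (\<Sum>g=1..Q. T (Q div g)) - (\<Sum>g=1..Q. 1 / 12 * N (Q div g) * ln (real (Q div g)))"
      unfolding e_def by (rule sum_subtractf)
    have tri: "\<bar>x - y\<bar> \<le> u + v" if "\<bar>x - z\<bar> \<le> u" "\<bar>y - z\<bar> \<le> v" for x y z u v :: real using that by linarith
    have "\<bar>\<Sum>g=1..Q. e (Q div g)\<bar> \<le> 4 * \<delta> * (real Q)\<^sup>2 * (1 + ln (real Q)) + C * (real Q)\<^sup>2 + 3 * (real Q)\<^sup>2"
      unfolding s by (rule tri[OF 1 2])
    also have "\<dots> = (real Q)\<^sup>2 * (4 * \<delta> * ln (real Q) + C')" by (simp add: C'_def algebra_simps)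
    finally show "\<bar>\<Sum>g=1..Q. e (Q div g)\<bar> \<le> (real Q)\<^sup>2 * (4 * \<delta> * ln (real Q) + C')" .
  qed (use del in auto)
  note e_bd = this
  have "filterlim (\<lambda>Q. ln (real Q)) at_top sequentially"
    by (rule filterlim_compose[OF ln_at_top filterlim_real_sequentially])
  then have "\<forall>\<^sub>F Q in sequentially. 128 * C' / c \<le> ln (real Q)" by (simp add: filterlim_at_top)
  moreover have "\<forall>\<^sub>F Q::nat in sequentially. 0 < Q" by (rule eventually_gt_at_top)
  ultimately show "\<forall>\<^sub>F Q in sequentially. norm (1 / real (card (farey Q)) * (\<Sum>x\<in>farey_below \<alpha> Q. dedekind_rat x) - 1 / 12 * ln (real Q))
      \<le> c * norm (ln (real Q))"
    using eventually_card_farey_ge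
  proof eventually_elim
    case (elim Q)
    have Q2: "0 < (real Q)\<^sup>2" using elim by simp
    have N: "(real Q)\<^sup>2 / 16 \<le> N Q" using elim by (simp add: N_def)
    then have N0: "0 < N Q" using Q2 by linarith
    have ln0: "0 \<le> ln (real Q)" using elim by simp
    have "\<bar>e Q\<bar> / N Q \<le> 4 * ((real Q)\<^sup>2 * (4 * \<delta> * ln (real Q) + C')) / ((real Q)\<^sup>2 / 16)"
      using e_bd[of Q] elim N Q2 del C0 ln0 by (intro frac_le) auto
    also have "\<dots> = 64 * (4 * \<delta> * ln (real Q) + C')" using Q2 by simp
    also have "\<dots> \<le> c * ln (real Q)"
    proof -
      have "256 * \<delta> * ln (real Q) \<le> c / 2 * ln (real Q)" using del ln0 by (intro mult_right_mono) auto
      moreover have "64 * C' \<le> c / 2 * ln (real Q)" using elim c by (simp add: field_simps)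
      ultimately show ?thesis by (simp add: algebra_simps)
    qed
    finally have "\<bar>e Q\<bar> / N Q \<le> c * ln (real Q)" .
    moreover have "1 / N Q * T Q - 1 / 12 * ln (real Q) = e Q / N Q" using N0 by (simp add: e_def field_simps)
    ultimately have "norm (1 / N Q * T Q - 1 / 12 * ln (real Q)) \<le> c * norm (ln (real Q))"
      using N0 ln0 by (simp add: abs_divide)
    then show ?case by (simp only: N_def T_def)
  qed
qed

theorem theorem1p2:
  "\<exists>S :: real set. S \<subseteq> {0..1/2} \<and> {0..1/2} - S \<in> null_sets lebesgue \<and>
     (\<forall>\<alpha>\<in>S.
        (\<lambda>Q :: nat. 1 / real (card (farey Q)) * (\<Sum>x\<in>farey_below \<alpha> Q. dedekind_rat x)
                    - 1 / 12 * ln (real Q))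
        \<in> o[at_top](\<lambda>Q. ln (real Q)))"
proof -
  define B where "B = (\<lambda>\<alpha>. \<exists>S. \<forall>n. (\<Sum>k=1..n. 1 / (sqrt (dist_int (real k * \<alpha>)) * (real k * sqrt (real k)))) \<le> S)"
  \<comment> \<open>Rationals have to be excluded separately: as 1 / sqrt 0 is 0, the terms with k
    \<alpha> integral vanish and \<open>B\<close> holds for them too. This also removes the
    endpoints 0 and 1/2.\<close>
  define S where "S = {\<alpha> \<in> {0..1/2}. \<alpha> \<notin> \<rat> \<and> B \<alpha>}"
  have "AE \<alpha> in lborel. \<alpha> \<in> {0..1} \<longrightarrow> B \<alpha>"
    unfolding B_def by (rule AE_sum_inverse_sqrt_dist_int_bounded)
  then obtain M where M: "M \<in> null_sets lborel" "{\<alpha>. \<not> (\<alpha> \<in> {0..1} \<longrightarrow> B \<alpha>)} \<subseteq> M"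
    unfolding eventually_ae_filter space_lborel by auto
  have "\<rat> \<in> null_sets (lborel :: real measure)"
    by (rule countable_imp_null_set_lborel[OF countable_rat])
  then have "\<rat> \<union> M \<in> null_sets lebesgue"
    using M(1) by (intro null_sets_completionI null_sets.Un)
  moreover have "{0..1/2} - S \<subseteq> \<rat> \<union> M"
    using M(2) by (auto simp: S_def)
  \<comment> \<open>Completeness of Lebesgue measure makes every subset of a null set null, so an
    inclusion is enough.\<close>
  ultimately have "{0..1/2} - S \<in> null_sets lebesgue"
    using completion.complete2 by blast
  moreover have "(\<lambda>Q :: nat. 1 / real (card (farey Q)) * (\<Sum>x\<in>farey_below \<alpha> Q. dedekind_rat x) - 1 / 12 * ln (real Q))
        \<in> o[at_top](\<lambda>Q. ln (real Q))" if "\<alpha> \<in> S" for \<alpha>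
  proof -
    have a: "0 \<le> \<alpha>" "\<alpha> \<le> 1/2" "\<alpha> \<notin> \<rat>" "B \<alpha>" using that by (auto simp: S_def)
    obtain C where C: "\<And>n. (\<Sum>k=1..n. 1 / (sqrt (dist_int (real k * \<alpha>)) * (real k * sqrt (real k)))) \<le> C"
      using a(4) by (auto simp: B_def)
    have "\<alpha> \<noteq> 0" using a(3) by auto
    moreover have "real k * \<alpha> \<notin> \<int>" if "0 < k" for k
    proof
      assume "real k * \<alpha> \<in> \<int>"
      then have "real k * \<alpha> / real k \<in> \<rat>" by (intro Rats_divide) (auto elim: Ints_cases)
      then show False using a(3) that by simp
    qed
    ultimately show ?thesis using a C by (intro farey_below_average_smallo[where S = C]) auto
  qed
  ultimately show ?thesis by (intro exI[of _ S]) (auto simp: S_def)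
qed

end
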